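(* Let $l\ge 1$ and let $\mathcal{N}_1,\mathcal{N}_2,\dots,\mathcal{N}_l$ be partial normal subgroups of a locality $(\mathcal{L},\Delta,S)$. Then $\mathcal{N}_1\mathcal{N}_2\cdots\mathcal{N}_l$ is a partial normal subgroup of $\mathcal{L}$. Moreover, the following hold: (a) $\mathcal{N}_1\mathcal{N}_2\cdots\mathcal{N}_l=(\mathcal{N}_1\cdots\mathcal{N}_k)(\mathcal{N}_{k+1}\cdots\mathcal{N}_l)$ for every $1\le k<l$. (b) $\mathcal{N}_1\mathcal{N}_2\cdots\mathcal{N}_l=\mathcal{N}_{1\sigma}\mathcal{N}_{2\sigma}\cdots\mathcal{N}_{l\sigma}$ for every permutation $\sigma\in S_l$ (the symmetric group on $\{1,\dots,l\}$, with $i\sigma$ the image of $i$ under $\sigma$). (c) For every $g\in\mathcal{N}_1\cdots\mathcal{N}_l$ there exists $(n_1,\dots,n_l)\in\mathbf{D}$ with $n_i\in\mathcal{N}_i$ for every $i=1,\dots,l$, $g=\Pi(n_1,\dots,n_l)$ and $S_g=S_{(n_1,\dots,n_l)}$.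
   Context: **Partial groups.** For a set $\mathcal{L}$ let $\mathbf{W}(\mathcal{L})$ be the set of (finite, possibly empty) words in $\mathcal{L}$, with $\circ$ denoting concatenation and $\emptyset$ the empty word; elements of $\mathcal{L}$ are identified with words of length one. A partial group is a non-empty set $\mathcal{L}$ with a subset $\mathbf{D}\subseteq\mathbf{W}(\mathcal{L})$, a map $\Pi\colon\mathbf{D}\to\mathcal{L}$ (the product) and an involutory bijection $f\mapsto f^{-1}$ of $\mathcal{L}$ (the inversion), extended to words by $(f_1,\dots,f_n)^{-1}=(f_n^{-1},\dots,f_1^{-1})$, such that: (1) $\mathcal{L}\subseteq\mathbf{D}$, and $u\circ v\in\mathbf{D}$ implies $u,v\in\mathbf{D}$; (2) $\Pi$ restricts to the identity on $\mathcal{L}$; (3) if $u\circ v\circ w\in\mathbf{D}$ then $u\circ(\Pi(v))\circ w\in\mathbf{D}$ and $\Pi(u\circ v\circ w)=\Pi(u\circ(\Pi(v))\circ w)$; (4) if $w\in\mathbf{D}$ then $w^{-1}\circ w\in\mathbf{D}$ and $\Pi(w^{-1}\circ w)=\mathbf{1}$, where $\mathbf{1}:=\Pi(\emptyset)$. **Subobjects and products.** A non-empty subset $\mathcal{H}\subseteq\mathcal{L}$ is a partial subgroup if $h^{-1}\in\mathcal{H}$ for all $h\in\mathcal{H}$ and $\Pi(v)\in\mathcal{H}$ for all $v\in\mathbf{W}(\mathcal{H})\cap\mathbf{D}$. It is a subgroup of $\mathcal{L}$ if moreover $\mathbf{W}(\mathcal{H})\subseteq\mathbf{D}$ (then $\mathcal{H}$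 is a group under $\Pi$); a $p$-subgroup is a subgroup whose order is a power of the prime $p$. For $g\in\mathcal{L}$ let $\mathbf{D}(g)=\{x\in\mathcal{L}\colon (g^{-1},x,g)\in\mathbf{D}\}$ and, for $x\in\mathbf{D}(g)$, $x^g:=\Pi(g^{-1},x,g)$; for $X\subseteq\mathbf{D}(g)$ put $X^g=\{x^g\colon x\in X\}$. A partial subgroup $\mathcal{N}$ is a partial normal subgroup if $x^f\in\mathcal{N}$ for all $f\in\mathcal{L}$ and $x\in\mathcal{N}\cap\mathbf{D}(f)$. For subsets $\mathcal{N}_1,\dots,\mathcal{N}_l\subseteq\mathcal{L}$, $$\mathcal{N}_1\mathcal{N}_2\cdots\mathcal{N}_l:=\{\Pi(n_1,\dots,n_l)\colon (n_1,\dots,n_l)\in\mathbf{D},\ n_i\in\mathcal{N}_i\text{ for }1\le i\le l\};$$ in particular, $XY=\{\Pi(x,y)\colon x\in X,\ y\in Y,\ (x,y)\in\mathbf{D}\}$ for two subsets $X,Y$. **Localities.** Let $p$ be a prime. $(\mathcal{L},\Delta,S)$ is a locality if $\mathcal{L}$ is a partial group that is finite as a set, $S$ is a $p$-subgroup of $\mathcal{L}$, $\Delta$ is a non-empty set of subgroups of $S$, and: (L1) $S$ is maximal with respect to inclusion among the $p$-subgroups of $\mathcal{L}$; (L2) a word $(f_1,\dots,f_n)\in\mathbf{W}(\mathcal{L})$ lies in $\mathbf{D}$ if and only if there exist $P_0,\dots,P_n\in\Delta$ with $P_{i-1}\subseteq\mathbf{D}(f_i)$ and $P_{i-1}^{f_i}=P_i$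 for $i=1,\dots,n$; (L3) if $Q$ is a subgroup of $S$ for which there exist $P\in\Delta$ and $g\in\mathcal{L}$ with $P\subseteq\mathbf{D}(g)$ and $P^g\le Q$, then $Q\in\Delta$. **The sets $S_g$ and $S_v$.** For $g\in\mathcal{L}$, $S_g=\{s\in S\colon s\in\mathbf{D}(g),\ s^g\in S\}$. For a word $v=(g_1,\dots,g_n)$ in $\mathcal{L}$, $S_v$ is the set of all $s\in S$ for which there exist $x_0,\dots,x_n\in S$ with $s=x_0$, $(g_i^{-1},x_{i-1},g_i)\in\mathbf{D}$ and $x_{i-1}^{g_i}=x_i$ for $i=1,\dots,n$. *)

theory Defs
  imports
    "HOL-Computational_Algebra.Primes"
    "HOL-Combinatorics.Permutations"
    "HOL-Algebra.Congruence"
begin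

(* Words are lists; the words in a subset H of the carrier form the set "lists H".
   The product and the inversion are total functions, only constrained on pg_dom and on the
   carrier respectively. *)

record 'a partial_grp = "'a partial_object" +
  pg_dom :: "'a list set"
  pg_prod :: "'a list \<Rightarrow> 'a"
  pg_inv :: "'a \<Rightarrow> 'a"

definition word_inv :: "('a, 'm) partial_grp_scheme \<Rightarrow> 'a list \<Rightarrow> 'a list" where
  "word_inv L w = rev (map (pg_inv L) w)"

locale partial_group =
  fixes L :: "('a, 'm) partial_grp_scheme"
  assumes carrier_nonempty: "carrier L \<noteq> {}"
    and dom_words: "pg_dom L \<subseteq> lists (carrier L)"
    and prod_closed: "w \<in> pg_dom L \<Longrightarrow> pg_prod L w \<in> carrier L"
    and inv_closed: "f \<in> carrier L \<Longrightarrow> pg_inv L f \<in> carrier L"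
    and inv_inv: "f \<in> carrier L \<Longrightarrow> pg_inv L (pg_inv L f) = f"
    and singleton_dom: "f \<in> carrier L \<Longrightarrow> [f] \<in> pg_dom L"
    and append_dom: "u @ v \<in> pg_dom L \<Longrightarrow> u \<in> pg_dom L \<and> v \<in> pg_dom L"
    and prod_singleton: "f \<in> carrier L \<Longrightarrow> pg_prod L [f] = f"
    and contract_dom: "u @ v @ w \<in> pg_dom L \<Longrightarrow> u @ [pg_prod L v] @ w \<in> pg_dom L"
    and contract_prod:
      "u @ v @ w \<in> pg_dom L \<Longrightarrow> pg_prod L (u @ v @ w) = pg_prod L (u @ [pg_prod L v] @ w)"
    and inv_append_dom: "w \<in> pg_dom L \<Longrightarrow> word_inv L w @ w \<in> pg_dom L"
    and inv_append_prod: "w \<in> pg_dom L \<Longrightarrow> pg_prod L (word_inv L w @ w) = pg_prod L []"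

definition partial_subgroup :: "('a, 'm) partial_grp_scheme \<Rightarrow> 'a set \<Rightarrow> bool" where
  "partial_subgroup L H \<longleftrightarrow>
     H \<noteq> {} \<and> H \<subseteq> carrier L \<and> (\<forall>h\<in>H. pg_inv L h \<in> H) \<and>
     (\<forall>v \<in> lists H \<inter> pg_dom L. pg_prod L v \<in> H)"

definition pg_subgroup :: "('a, 'm) partial_grp_scheme \<Rightarrow> 'a set \<Rightarrow> bool" where
  "pg_subgroup L H \<longleftrightarrow> partial_subgroup L H \<and> lists H \<subseteq> pg_dom L"

definition pg_p_subgroup :: "nat \<Rightarrow> ('a, 'm) partial_grp_scheme \<Rightarrow> 'a set \<Rightarrow> bool" where
  "pg_p_subgroup p L H \<longleftrightarrow> pg_subgroup L H \<and> (\<exists>n. card H = p ^ n)"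

definition conj_dom :: "('a, 'm) partial_grp_scheme \<Rightarrow> 'a \<Rightarrow> 'a set" where
  "conj_dom L g = {x \<in> carrier L. [pg_inv L g, x, g] \<in> pg_dom L}"

definition conj_elem :: "('a, 'm) partial_grp_scheme \<Rightarrow> 'a \<Rightarrow> 'a \<Rightarrow> 'a" where
  "conj_elem L x g = pg_prod L [pg_inv L g, x, g]"

(* Only meaningful for subsets X of conj_dom L g. *)
definition conj_set :: "('a, 'm) partial_grp_scheme \<Rightarrow> 'a set \<Rightarrow> 'a \<Rightarrow> 'a set" where
  "conj_set L X g = (\<lambda>x. conj_elem L x g) ` X"

definition partial_normal_subgroup :: "('a, 'm) partial_grp_scheme \<Rightarrow> 'a set \<Rightarrow> bool" where
  "partial_normal_subgroup L N \<longleftrightarrow>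
     partial_subgroup L N \<and>
     (\<forall>f \<in> carrier L. \<forall>x \<in> N \<inter> conj_dom L f. conj_elem L x f \<in> N)"

definition set_product :: "('a, 'm) partial_grp_scheme \<Rightarrow> 'a set list \<Rightarrow> 'a set" where
  "set_product L Ns = {pg_prod L w | w. w \<in> pg_dom L \<and> list_all2 (\<in>) w Ns}"

(* The subgroups of S are exactly the subgroups of L contained in S, as lists S is contained
   in pg_dom L. *)
locale locality = partial_group L
  for L :: "('a, 'm) partial_grp_scheme" +
  fixes p :: nat and \<Delta> :: "'a set set" and S :: "'a set"
  assumes prime_p: "prime p"
    and finite_carrier: "finite (carrier L)"
    and S_p_subgroup: "pg_p_subgroup p L S"
    and Delta_nonempty: "\<Delta> \<noteq> {}"
    and Delta_subgroups: "P \<in> \<Delta> \<Longrightarrow> pg_subgroup L P \<and> P \<subseteq> S"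
    and S_maximal: "pg_p_subgroup p L R \<Longrightarrow> S \<subseteq> R \<Longrightarrow> R = S"
    and dom_iff: "w \<in> lists (carrier L) \<Longrightarrow>
      w \<in> pg_dom L \<longleftrightarrow>
      (\<exists>P :: nat \<Rightarrow> 'a set. (\<forall>i \<le> length w. P i \<in> \<Delta>) \<and>
         (\<forall>i < length w. P i \<subseteq> conj_dom L (w ! i) \<and> conj_set L (P i) (w ! i) = P (Suc i)))"
    and Delta_closed: "\<lbrakk>pg_subgroup L Q; Q \<subseteq> S; P \<in> \<Delta>; g \<in> carrier L;
      P \<subseteq> conj_dom L g; conj_set L P g \<subseteq> Q\<rbrakk> \<Longrightarrow> Q \<in> \<Delta>"

definition S_elem :: "('a, 'm) partial_grp_scheme \<Rightarrow> 'a set \<Rightarrow> 'a \<Rightarrow> 'a set" where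
  "S_elem L S g = {s \<in> S. s \<in> conj_dom L g \<and> conj_elem L s g \<in> S}"

definition S_word :: "('a, 'm) partial_grp_scheme \<Rightarrow> 'a set \<Rightarrow> 'a list \<Rightarrow> 'a set" where
  "S_word L S v = {s \<in> S. \<exists>x :: nat \<Rightarrow> 'a. x 0 = s \<and> (\<forall>i \<le> length v. x i \<in> S) \<and>
     (\<forall>i < length v. [pg_inv L (v ! i), x i, v ! i] \<in> pg_dom L \<and>
        conj_elem L (x i) (v ! i) = x (Suc i))}"

end

theory Submission
  imports Defs "HOL-Number_Theory.Cong" "HOL-Algebra.Sylow" "HOL-Algebra.Group_Action"
    "HOL-Algebra.Multiplicative_Group" "HOL-Algebra.Zassenhaus"
begin

text \<open>
  Conjugation between members of \<open>\<Delta>\<close> is a groupoid, and all computations take place in it.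
  For a partial normal subgroup \<open>K\<close>, every element is \<open>f \<cdot> k\<close> with \<open>k \<in> K\<close>, the same
  conjugation domain and \<open>f\<close> maximal, meaning that multiplying \<open>f\<close> by elements of \<open>K\<close> cannot
  enlarge \<open>S\<^sub>f\<close>. A Sylow argument in normalizers of objects shows that \<open>K \<inter> S\<close> lies in
  \<open>S\<^sub>f\<close> for such \<open>f\<close>, and that \<open>S\<^sub>f\<close> is what the image of \<open>f\<close> would conjugate
  into the image of \<open>S\<close> in a quotient by \<open>K\<close>. This allows the reduction to \<open>M \<inter> N \<subseteq> S\<close>
  to be imitated without constructing quotient localities.

  For partial normal \<open>M\<close> and \<open>N\<close> take \<open>K = M \<inter> N\<close>. A \<open>K\<close>-maximal \<open>f \<in> N\<close> has
  \<open>M \<inter> S \<subseteq> S\<^sub>f\<close>, because commutators of \<open>M \<inter> S\<close> with \<open>f\<close> lie in \<open>K\<close>; so factors can be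
  interchanged and \<open>M N = N M\<close>. A factorization of maximal domain gives
  \<open>S \<inter> M N = (S \<inter> N) (S \<inter> M)\<close>, and this in turn gives \<open>S\<^sub>g = S\<^bsub>(f, m)\<^esub>\<close> for
  \<open>g = f \<cdot> m\<close> with \<open>f\<close> maximal, from which closure of \<open>M N\<close> under products and conjugation
  follows.
\<close>

section \<open>Finite p-groups and Sylow conjugacy\<close>

text \<open>The obstacle is the domain. From \<open>[g, h] \<in> pg_dom L\<close> and
  \<open>g = m \<cdot> n\<close> it does not follow that \<open>[m, n, h] \<in> pg_dom L\<close>:
  the objects along which \<open>g\<close> conjugates lie in \<open>Sg g\<close>, while the word
  \<open>[m, n]\<close> needs one inside \<open>S_pair m n\<close>, which may be smaller. So
  equality of these two subgroups for a suitable factorization is a precondition of closure of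
  \<open>M N\<close>, and this is why (c) is carried through the induction on the number of factors.
  Equality is tested on one element: if it fails, some \<open>s\<close> in \<open>Sg g\<close>
  normalizes \<open>S_pair f m\<close> without lying in it, and \<open>s \<up> f\<close> differs
  from \<open>s\<close> by an element of \<open>N\<close> and from \<open>s \<up> g\<close> by an
  element of \<open>M\<close>. The quotient of these two commutators lies both in \<open>S\<close>
  and in \<open>M N\<close>; splitting it is what the factorization of \<open>S \<inter> M N\<close>
  is for. The axioms give only inclusion-maximality of \<open>S\<close> among p-subgroups, so
  Sylow's theorem is needed in the form that an inclusion-maximal p-subgroup of a finite group
  absorbs every p-subgroup up to conjugacy.\<close>

lemma p_group_fixed_points:
  fixes X :: "('a, 'b) monoid_scheme" and act :: "'a \<Rightarrow> 'e \<Rightarrow> 'e"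
  assumes X: "group X" "card (carrier X) = p ^ n" and p: "prime p" and E: "finite E"
    and closed: "\<And>x e. x \<in> carrier X \<Longrightarrow> e \<in> E \<Longrightarrow> act x e \<in> E"
    and one: "\<And>e. e \<in> E \<Longrightarrow> act \<one>\<^bsub>X\<^esub> e = e"
    and mult: "\<And>x y e. x \<in> carrier X \<Longrightarrow> y \<in> carrier X \<Longrightarrow> e \<in> E
       \<Longrightarrow> act (x \<otimes>\<^bsub>X\<^esub> y) e = act x (act y e)"
  shows "[card E = card {e \<in> E. \<forall>x\<in>carrier X. act x e = e}] (mod p)"
proof -
  interpret X: group X by fact
  \<comment> \<open>Elements of \<open>BijGroup E\<close> are extensional functions, so the raw
    action has to be restricted to \<open>E\<close> to become a homomorphism.\<close>
  define \<phi> where "\<phi> x = restrict (act x) E" for x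
  have bij: "bij_betw (act x) E E" if "x \<in> carrier X" for x
  proof (rule bij_betw_byWitness[where f' = "act (inv\<^bsub>X\<^esub> x)"])
    show "\<forall>e\<in>E. act (inv\<^bsub>X\<^esub> x) (act x e) = e"
      using that mult[of "inv\<^bsub>X\<^esub> x" x] one by auto
    show "\<forall>e\<in>E. act x (act (inv\<^bsub>X\<^esub> x) e) = e"
      using that mult[of x "inv\<^bsub>X\<^esub> x"] one by auto
  qed (use that closed in auto)
  have "\<phi> \<in> hom X (BijGroup E)"
    unfolding hom_def BijGroup_def Bij_def \<phi>_def
    using bij mult closed by (auto simp: compose_def fun_eq_iff cong: bij_betw_cong)
  then interpret \<phi>: group_action X E \<phi>
    by (simp add: group_action_def group_hom_def group_hom_axioms_def X group_BijGroup)
  have orb: "orbit X \<phi> e = (\<lambda>x. act x e) ` carrier X" if "e \<in> E" for e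
    using that unfolding orbit_def \<phi>_def by auto
  let ?F = "{e \<in> E. \<forall>x\<in>carrier X. act x e = e}"
  let ?O = "orbits X E \<phi>"
  have orbE: "\<Union>?O = E" by (rule \<phi>.orbits_coverture)
  have fin: "finite ?O" using E unfolding orbits_def by (simp add: setcompr_eq_image)
  have fino: "finite B" if "B \<in> ?O" for B using that orbE E by (metis Union_upper finite_subset)
  have "card E = (\<Sum>B\<in>?O. card B)"
    using \<phi>.disjoint_sum[OF E, of "\<lambda>_. 1::nat"] by simp
  also have "card ?F = (\<Sum>B\<in>?O. card (B \<inter> ?F))"
  proof -
    have "card (\<Union>B\<in>?O. B \<inter> ?F) = (\<Sum>B\<in>?O. card (B \<inter> ?F))"
      using fin fino \<phi>.disjoint_union by (intro card_UN_disjoint) blast+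
    moreover have "(\<Union>B\<in>?O. B \<inter> ?F) = ?F" using orbE by blast
    ultimately show ?thesis by simp
  qed
  \<comment> \<open>Orbit by orbit: the length is a power of p, so either the orbit is a single
    fixed point or its length is divisible by p and it contains no fixed point.\<close>
  moreover have "[(\<Sum>B\<in>?O. card B) = (\<Sum>B\<in>?O. card (B \<inter> ?F))] (mod p)"
  proof (rule cong_sum)
    fix B assume B: "B \<in> ?O"
    then obtain e where e: "e \<in> E" "B = orbit X \<phi> e" unfolding orbits_def by auto
    have "card B dvd p ^ n"
      using \<phi>.orbit_stabilizer_theorem[OF e(1)] X(2) e(2) unfolding order_def
      by (metis dvd_triv_left)
    then obtain i where i: "card B = p ^ i" using divides_primepow_nat[OF p] by auto
    have eB: "e \<in> B" using e(1) \<phi>.orbit_refl e(2) by auto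
    show "[card B = card (B \<inter> ?F)] (mod p)"
    proof (cases "i = 0")
      case True
      then have "B = {e}" using i eB by (auto simp: card_1_singleton_iff)
      then have "B \<inter> ?F = {e}" using e orb by auto
      with \<open>B = {e}\<close> show ?thesis by simp
    next
      case False
      have "B \<inter> ?F = {}"
      proof (rule ccontr)
        assume "B \<inter> ?F \<noteq> {}"
        then obtain d where d: "d \<in> B" "d \<in> ?F" by auto
        then obtain x where x: "x \<in> carrier X" "d = act x e" using e orb by auto
        have "act (inv\<^bsub>X\<^esub> x) d = e" using x e one mult[of "inv\<^bsub>X\<^esub> x" x e] by simp
        then have "d = e" using d(2) x(1) by auto
        then have "B = {d}" using e orb d by auto
        then have "p ^ i = 1" using i by simp
        then show False using False prime_gt_1_nat[OF p] by simp
      qed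
      moreover have "p dvd card B" using i False by simp
      ultimately show ?thesis by (simp add: cong_0_iff)
    qed
  qed
  ultimately show ?thesis by simp
qed

context group
begin

text \<open>Right multiplication of cosets is a right action, so the count is applied to
  \<open>C #> inv x\<close>; as \<open>X\<close> is closed under inverses, the fixed cosets are the
  same.\<close>

lemma cosets_fixed_points:
  assumes fin: "finite (carrier G)" and p: "prime p"
    and H: "subgroup H G" and X: "subgroup X G" "card X = p ^ n"
  shows "[card (rcosets H) = card {C \<in> rcosets H. \<forall>x\<in>X. C #> x = C}] (mod p)"
proof -
  have gX: "group (G\<lparr>carrier := X\<rparr>)" using X(1) by (simp add: subgroup_imp_group)
  have Xc: "X \<subseteq> carrier G" using X subgroup.subset by auto
  have Hc: "H \<subseteq> carrier G" using H subgroup.subset by auto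
  have invX: "inv x \<in> X" if "x \<in> X" for x using that X by (simp add: subgroup.m_inv_closed)
  have Cc: "C \<subseteq> carrier G" if "C \<in> rcosets H" for C
    using that rcosets_part_G[OF H] by blast
  have "[card (rcosets H) = card {C \<in> rcosets H. \<forall>x\<in>carrier (G\<lparr>carrier := X\<rparr>). C #> inv x = C}] (mod p)"
  proof (rule p_group_fixed_points[OF gX _ p])
    show "finite (rcosets H)"
      using fin Cc by (meson PowI finite_Pow_iff finite_subset subsetI)
    show "C #> inv x \<in> rcosets H" if "x \<in> carrier (G\<lparr>carrier := X\<rparr>)" "C \<in> rcosets H" for x C
      using that Xc Hc by (auto simp: RCOSETS_def coset_mult_assoc subset_iff intro!: bexI[of _ "_ \<otimes> inv x"])
  next
    fix x y C assume *: "x \<in> carrier (G\<lparr>carrier := X\<rparr>)" "y \<in> carrier (G\<lparr>carrier := X\<rparr>)" "C \<in> rcosets H"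
    then have "x \<in> carrier G" "y \<in> carrier G" using Xc by auto
    then show "C #> inv (x \<otimes>\<^bsub>G\<lparr>carrier := X\<rparr>\<^esub> y) = C #> inv y #> inv x"
      using * Cc by (simp add: inv_mult_group coset_mult_assoc)
  qed (use X Cc in auto)
  moreover have "{C \<in> rcosets H. \<forall>x\<in>X. C #> inv x = C} = {C \<in> rcosets H. \<forall>x\<in>X. C #> x = C}"
    using invX Xc by (metis inv_inv subsetD)
  ultimately show ?thesis by simp
qed

lemma coset_fixed_iff:
  assumes H: "subgroup H G" and g: "g \<in> carrier G" and x: "x \<in> carrier G"
  shows "(H #> g) #> x = H #> g \<longleftrightarrow> g \<otimes> x \<otimes> inv g \<in> H"
proof -
  have Hc: "H \<subseteq> carrier G" using H subgroup.subset by auto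
  have "(H #> g) #> x = H #> (g \<otimes> x)" using Hc g x by (simp add: coset_mult_assoc)
  moreover have "H #> (g \<otimes> x) = H #> g \<longleftrightarrow> g \<otimes> x \<otimes> inv g \<in> H"
  proof
    assume "H #> (g \<otimes> x) = H #> g"
    then have "g \<otimes> x \<in> H #> g" using H g x by (metis m_closed rcos_self)
    then show "g \<otimes> x \<otimes> inv g \<in> H" using Hc g x unfolding r_coset_def
      by (auto simp: m_assoc) (metis g inv_solve_right m_assoc m_closed r_inv r_one subsetD inv_closed)
  next
    assume a: "g \<otimes> x \<otimes> inv g \<in> H"
    have "g \<otimes> x = (g \<otimes> x \<otimes> inv g) \<otimes> g" using g x by (simp add: m_assoc)
    then have "g \<otimes> x \<in> H #> g" using a unfolding r_coset_def by blast
    then show "H #> (g \<otimes> x) = H #> g" using H g by (metis repr_independence)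
  qed
  ultimately show ?thesis by simp
qed

text \<open>Let \<open>H\<close> act on its own right cosets. The index is a multiple of p, hence so
  is the number of fixed cosets; \<open>H\<close> is one of them, so there is another, and
  \<open>coset_fixed_iff\<close> reads off the claim from its representative.\<close>

lemma p_group_normalizer_grows:
  assumes fin: "finite (carrier G)" and p: "prime p" and G: "order G = p ^ n"
    and H: "subgroup H G" and ne: "H \<noteq> carrier G"
  shows "\<exists>g\<in>carrier G - H. \<forall>h\<in>H. g \<otimes> h \<otimes> inv g \<in> H"
proof -
  have Hc: "H \<subseteq> carrier G" using H subgroup.subset by auto
  have lag: "card (rcosets H) * card H = p ^ n" using lagrange[OF H] G by simp
  then obtain i where i: "card (rcosets H) = p ^ i"
    by (metis divides_primepow_nat dvd_triv_left p)
  obtain j where j: "card H = p ^ j" using lag p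
    by (metis divides_primepow_nat dvd_triv_right)
  have "i \<noteq> 0"
  proof
    assume "i = 0"
    then have "card H = card (carrier G)" using lag i G by (simp add: order_def)
    then show False using ne Hc fin card_subset_eq by blast
  qed
  then have pd: "p dvd card (rcosets H)" using i by simp
  let ?F = "{C \<in> rcosets H. \<forall>x\<in>H. C #> x = C}"
  have "p dvd card ?F"
    using cosets_fixed_points[OF fin p H H j] pd by (simp add: cong_dvd_iff)
  moreover have HF: "H \<in> ?F"
    using H Hc by (auto simp: coset_join2 subsetD subgroup.subgroup_in_rcosets[OF _ is_group])
  moreover have "finite ?F"
    using fin rcosets_part_G[OF H] finite_UnionD[of "rcosets H"] by simp
  ultimately have "?F \<noteq> {H}" using p by (auto dest!: prime_gt_1_nat)
  then obtain C where C: "C \<in> ?F" "C \<noteq> H" using HF by blast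
  then obtain g where g: "g \<in> carrier G" "C = H #> g" unfolding RCOSETS_def by auto
  have "g \<notin> H" using C g H by (metis coset_join2)
  moreover have "g \<otimes> h \<otimes> inv g \<in> H" if "h \<in> H" for h
    using C(1) g that coset_fixed_iff[OF H g(1)] Hc by auto
  ultimately show ?thesis using g by blast
qed

text \<open>\<open>Y\<close> is maximal only under inclusion, so it is compared with a subgroup
  \<open>H\<close> of order the full p-part. The index of \<open>H\<close> is prime to p, so every
  p-subgroup fixes a coset of \<open>H\<close> and is conjugate into \<open>H\<close>. Thus a
  conjugate \<open>Z\<close> of \<open>H\<close> contains \<open>Y\<close> and equals it, and
  \<open>X\<close> is moved into \<open>Z\<close> by way of \<open>H\<close>.\<close>

lemma sylow_conjugate_into:
  assumes fin: "finite (carrier G)" and p: "prime p"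
    and Y: "subgroup Y G" "card Y = p ^ m"
    and max: "\<And>Z j. subgroup Z G \<Longrightarrow> card Z = p ^ j \<Longrightarrow> Y \<subseteq> Z \<Longrightarrow> Z = Y"
    and X: "subgroup X G" "card X = p ^ n"
  shows "\<exists>g\<in>carrier G. \<forall>x\<in>X. inv g \<otimes> x \<otimes> g \<in> Y"
proof -
  define a where "a = multiplicity p (order G)"
  have oG: "order G > 0" using fin by (simp add: order_gt_0_iff_finite)
  obtain c where c: "order G = p ^ a * c" "\<not> p dvd c"
    using multiplicity_decompose'[of "order G" p] p oG a_def by (metis less_irrefl not_prime_unit)
  obtain H where H: "subgroup H G" "card H = p ^ a" using sylow_thm[OF p _ c(1) fin] is_group by auto
  have pn: "p ^ a \<noteq> 0" using p by (simp add: prime_gt_0_nat)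
  have "card (rcosets H) = c" using lagrange[OF H(1)] H(2) c(1) pn by (metis mult.commute mult_cancel1)
  have into: "\<exists>g\<in>carrier G. \<forall>z\<in>Z. g \<otimes> z \<otimes> inv g \<in> H" if Z: "subgroup Z G" "card Z = p ^ k" for Z k
  proof -
    have "\<not> p dvd card {C \<in> rcosets H. \<forall>x\<in>Z. C #> x = C}"
      using cosets_fixed_points[OF fin p H(1) Z] \<open>card (rcosets H) = c\<close> c(2) by (simp add: cong_dvd_iff)
    then have "{C \<in> rcosets H. \<forall>x\<in>Z. C #> x = C} \<noteq> {}" by (metis card.empty dvd_0_right)
    then obtain g where "g \<in> carrier G" "\<forall>x\<in>Z. (H #> g) #> x = H #> g" unfolding RCOSETS_def by auto
    then show ?thesis using coset_fixed_iff[OF H(1)] subgroup.subset[OF Z(1)] by blast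
  qed
  obtain g where g: "g \<in> carrier G" "\<forall>y\<in>Y. g \<otimes> y \<otimes> inv g \<in> H" using into[OF Y] by auto
  obtain h where h: "h \<in> carrier G" "\<forall>x\<in>X. h \<otimes> x \<otimes> inv h \<in> H" using into[OF X] by auto
  have Hc: "H \<subseteq> carrier G" using H subgroup.subset by auto
  have Xc: "X \<subseteq> carrier G" using X subgroup.subset by auto
  have Yc: "Y \<subseteq> carrier G" using Y subgroup.subset by auto
  define Z where "Z = (inv g) <# H #> g"
  have Zs: "subgroup Z G" unfolding Z_def using subgroup_conjugation_is_surj1 g(1) H(1) by blast
  have Zi: "Z = (\<lambda>h. inv g \<otimes> h \<otimes> g) ` H" unfolding Z_def l_coset_def r_coset_def by auto
  have "inj_on (\<lambda>h. inv g \<otimes> h \<otimes> g) H"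
  proof (rule inj_onI)
    fix x y assume "x \<in> H" "y \<in> H" "inv g \<otimes> x \<otimes> g = inv g \<otimes> y \<otimes> g"
    then show "x = y" using Hc g by (simp add: subset_iff)
  qed
  then have "card Z = p ^ a" using Zi H(2) by (simp add: card_image)
  moreover have "Y \<subseteq> Z"
  proof
    fix y assume y: "y \<in> Y"
    then have "y = inv g \<otimes> (g \<otimes> y \<otimes> inv g) \<otimes> g" using g(1) Yc
      by (simp add: m_assoc subset_iff inv_solve_left)
    then show "y \<in> Z" using g y Zi by blast
  qed
  ultimately have "Z = Y" using max Zs by blast
  have "inv (inv h \<otimes> g) \<otimes> x \<otimes> (inv h \<otimes> g) \<in> Y" if "x \<in> X" for x
  proof -
    have "inv (inv h \<otimes> g) \<otimes> x \<otimes> (inv h \<otimes> g) = inv g \<otimes> (h \<otimes> x \<otimes> inv h) \<otimes> g"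
      using that Xc h(1) g(1) by (simp add: m_assoc inv_mult_group subset_iff)
    then show ?thesis using h(2) that Zi \<open>Z = Y\<close> by auto
  qed
  then show ?thesis using h(1) g(1) by (intro bexI[of _ "inv h \<otimes> g"]) auto
qed

text \<open>Growth is applied inside the subgroup \<open>T <#> H\<close>. The normalizing element
  found there is \<open>t \<otimes> u\<close> with \<open>u \<in> H\<close>; since \<open>u\<close>
  normalizes \<open>H\<close>, the factor \<open>t\<close> does so by itself.\<close>

lemma normalizer_grows_normal:
  assumes fin: "finite (carrier G)" and p: "prime p" and G: "order G = p ^ n"
    and H: "subgroup H G" and T: "T \<lhd> G" and ne: "\<not> T \<subseteq> H"
  shows "\<exists>t\<in>T - H. \<forall>h\<in>H. t \<otimes> h \<otimes> inv t \<in> H"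
proof -
  define K where "K = T <#> H"
  have Tc: "T \<subseteq> carrier G" and Hc: "H \<subseteq> carrier G" and Ts: "subgroup T G"
    using normal_imp_subgroup[OF T] subgroup.subset[OF H] subgroup.subset by auto
  have Ks: "subgroup K G" unfolding K_def by (rule mult_norm_subgroup[OF T H])
  have "T \<subseteq> K" "H \<subseteq> K" unfolding K_def set_mult_def using Tc Hc H Ts
    by (auto simp: subset_iff) (metis r_one subgroup.one_closed, metis l_one subgroup.one_closed)
  interpret K: group "G\<lparr>carrier := K\<rparr>" using Ks by (simp add: subgroup_imp_group)
  have "card K dvd p ^ n" using lagrange[OF Ks] G by (metis dvd_triv_right)
  then obtain j where j: "card K = p ^ j" by (metis divides_primepow_nat p)
  have HK: "subgroup H (G\<lparr>carrier := K\<rparr>)" using H Ks \<open>H \<subseteq> K\<close> by (simp add: subgroup_incl)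
  have "\<exists>g\<in>carrier (G\<lparr>carrier := K\<rparr>) - H. \<forall>h\<in>H. g \<otimes> h \<otimes> inv\<^bsub>G\<lparr>carrier := K\<rparr>\<^esub> g \<in> H"
    using K.p_group_normalizer_grows[OF _ p _ HK, of j] Ks fin j ne \<open>T \<subseteq> K\<close>
      subgroup.subset[OF Ks] finite_subset by (auto simp: order_def)
  then obtain g where g: "g \<in> K" "g \<notin> H" "\<And>h. h \<in> H \<Longrightarrow> g \<otimes> h \<otimes> inv g \<in> H"
    using m_inv_consistent[OF Ks] by auto
  obtain t u where tu: "t \<in> T" "u \<in> H" "g = t \<otimes> u" using g(1) unfolding K_def set_mult_def by auto
  have "t \<notin> H" using g(2) tu H by (meson subgroup.m_closed)
  moreover have "t \<otimes> h \<otimes> inv t \<in> H" if "h \<in> H" for h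
  proof -
    have "inv u \<otimes> h \<otimes> u \<in> H" using that tu H by (simp add: subgroup.m_closed subgroup.m_inv_closed)
    then have "g \<otimes> (inv u \<otimes> h \<otimes> u) \<otimes> inv g \<in> H" using g(3) by blast
    moreover have "g \<otimes> (inv u \<otimes> h \<otimes> u) \<otimes> inv g = t \<otimes> h \<otimes> inv t"
    proof -
      have c: "t \<in> carrier G" "u \<in> carrier G" "h \<in> carrier G" using tu that Tc Hc by auto
      have "u \<otimes> (inv u \<otimes> z) = z" if "z \<in> carrier G" for z
        using c that by (simp flip: m_assoc)
      then show ?thesis using c by (simp add: tu(3) inv_mult_group m_assoc)
    qed
    ultimately show ?thesis by simp
  qed
  ultimately show ?thesis using tu by blast
qed

text \<open>Let \<open>p ^ b * r\<close> be the order of \<open>x\<close>, with \<open>r\<close>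
  prime to p. The exponent \<open>i\<close> is chosen divisible by \<open>r\<close> and congruent to
  1 modulo \<open>p ^ a\<close>: the former makes \<open>x [^] i\<close> a p-element, the latter
  makes \<open>x [^] (1 - i)\<close> a power of \<open>x [^] (p ^ a)\<close> and so an element of
  \<open>K\<close>.\<close>

lemma p_element_part:
  fixes p :: nat
  assumes fin: "finite (carrier G)" and p: "prime p" and x: "x \<in> carrier G"
    and K: "subgroup K G" and pow: "x [^] (p ^ a) \<in> K"
  shows "\<exists>k\<in>K. \<exists>i b. x = k \<otimes> x [^] (i::nat) \<and> (x [^] i) [^] (p ^ b) = \<one>"
proof -
  define n where "n = ord x"
  have n: "n > 0" "x [^] n = \<one>" unfolding n_def using fin x ord_ge_1 pow_ord_eq_1 by (auto simp: Suc_le_eq)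
  obtain b r where r: "n = p ^ b * r" "\<not> p dvd r"
    using multiplicity_decompose'[of n p] p n by (metis less_irrefl not_prime_unit)
  have "coprime r (p ^ a)" using r p by (metis coprime_commute coprime_power_left_iff prime_imp_coprime)
  then obtain v where v: "[r * v = 1] (mod p ^ a)" using cong_solve_coprime_nat by (metis One_nat_def)
  define i where "i = r * v"
  have "(x [^] i) [^] (p ^ b) = (x [^] n) [^] v"
    unfolding i_def r(1) using x by (simp add: nat_pow_pow ac_simps)
  then have 1: "(x [^] i) [^] (p ^ b) = \<one>" using n by simp
  \<comment> \<open>The exponent \<open>1 - i\<close> need not be a natural number, hence the
    passage to integers.\<close>
  have "int (p ^ a) dvd 1 - int i"
    using v unfolding i_def by (metis cong_iff_dvd_diff cong_int_iff cong_sym of_nat_1)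
  then obtain q where q: "1 - int i = int (p ^ a) * q" by auto
  have "x [^] (1 - int i) = (x [^] (p ^ a)) [^] q"
    unfolding q using x by (metis int_pow_int int_pow_pow)
  then have 2: "x [^] (1 - int i) \<in> K" using subgroup_int_pow_closed[OF K pow] by simp
  have "x [^] (1 - int i) \<otimes> x [^] i = x"
    using x int_pow_mult[OF x, of "1 - int i" "int i"] by (simp add: int_pow_int)
  with 1 2 show ?thesis by metis
qed

end

section \<open>Partial groups\<close>

context partial_group
begin

abbreviation mul (infixl "\<cdot>" 70) where "x \<cdot> y \<equiv> pg_prod L [x, y]"
abbreviation ivs ("_\<acute>" [1000] 999) where "x\<acute> \<equiv> pg_inv L x"
abbreviation one ("\<epsilon>") where "\<epsilon> \<equiv> pg_prod L []"

lemma dom_carrier: "w \<in> pg_dom L \<Longrightarrow> x \<in> set w \<Longrightarrow> x \<in> carrier L"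
  using dom_words by blast

lemma Nil_dom: "[] \<in> pg_dom L"
  using carrier_nonempty singleton_dom append_dom[of "[]"] by (metis all_not_in_conv append_Nil)

lemma one_closed: "\<epsilon> \<in> carrier L"
  using Nil_dom prod_closed by blast

lemma contract:
  assumes "u @ v @ w \<in> pg_dom L"
  shows "u @ pg_prod L v # w \<in> pg_dom L" "pg_prod L (u @ v @ w) = pg_prod L (u @ pg_prod L v # w)"
  using contract_dom[OF assms] contract_prod[OF assms] by auto

lemma prod_append:
  assumes "u @ v \<in> pg_dom L"
  shows "[pg_prod L u, pg_prod L v] \<in> pg_dom L" "pg_prod L (u @ v) = pg_prod L u \<cdot> pg_prod L v"
proof -
  have 1: "u @ [pg_prod L v] \<in> pg_dom L" "pg_prod L (u @ v) = pg_prod L (u @ [pg_prod L v])"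
    using contract[of u v "[]"] assms by auto
  then show "[pg_prod L u, pg_prod L v] \<in> pg_dom L" "pg_prod L (u @ v) = pg_prod L u \<cdot> pg_prod L v"
    using contract[of "[]" u "[pg_prod L v]"] by auto
qed

lemma prod_Cons:
  assumes "x # v \<in> pg_dom L"
  shows "[x, pg_prod L v] \<in> pg_dom L" "pg_prod L (x # v) = x \<cdot> pg_prod L v"
  using contract[of "[x]" v "[]"] assms by auto

lemma sublist_dom: "u @ v @ w \<in> pg_dom L \<Longrightarrow> v \<in> pg_dom L"
  using append_dom by blast

text \<open>Contracting an empty subword inserts its product, the unit.\<close>

lemma one_ins: assumes "u @ w \<in> pg_dom L"
  shows "u @ \<epsilon> # w \<in> pg_dom L" "pg_prod L (u @ w) = pg_prod L (u @ \<epsilon> # w)"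
  using contract[of u "[]" w] assms by auto

lemma one_l: "x \<in> carrier L \<Longrightarrow> \<epsilon> \<cdot> x = x" and one_r: "x \<in> carrier L \<Longrightarrow> x \<cdot> \<epsilon> = x"
  using one_ins(2)[of "[]" "[x]"] one_ins(2)[of "[x]" "[]"] singleton_dom prod_singleton by auto

lemma word_inv_inv: "w \<in> lists (carrier L) \<Longrightarrow> word_inv L (word_inv L w) = w"
  by (induction w) (auto simp: word_inv_def inv_inv)

lemma word_inv_dom: "w \<in> pg_dom L \<Longrightarrow> word_inv L w \<in> pg_dom L"
  using inv_append_dom append_dom by blast

lemma append_inv_dom: "w \<in> pg_dom L \<Longrightarrow> w @ word_inv L w \<in> pg_dom L"
  and append_inv_prod: "w \<in> pg_dom L \<Longrightarrow> pg_prod L (w @ word_inv L w) = \<epsilon>"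
  using inv_append_dom[of "word_inv L w"] inv_append_prod[of "word_inv L w"] word_inv_dom[of w]
    word_inv_inv dom_words by (metis subsetD)+

lemma inv_l: "x \<in> carrier L \<Longrightarrow> x\<acute> \<cdot> x = \<epsilon>" and inv_r: "x \<in> carrier L \<Longrightarrow> x \<cdot> x\<acute> = \<epsilon>"
  and inv_l_dom: "x \<in> carrier L \<Longrightarrow> [x\<acute>, x] \<in> pg_dom L" and inv_r_dom: "x \<in> carrier L \<Longrightarrow> [x, x\<acute>] \<in> pg_dom L"
  using inv_append_prod[of "[x]"] append_inv_prod[of "[x]"] inv_append_dom[of "[x]"] append_inv_dom[of "[x]"] singleton_dom[of x]
  by (auto simp: word_inv_def)

lemma assoc:
  assumes "[a, b, c] \<in> pg_dom L"
  shows "a \<cdot> b \<cdot> c = a \<cdot> (b \<cdot> c)" "pg_prod L [a, b, c] = a \<cdot> (b \<cdot> c)"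
  using contract[of "[a]" "[b, c]" "[]"] contract[of "[]" "[a, b]" "[c]"] assms by auto

lemma cancel_l:
  assumes "[a, b] \<in> pg_dom L"
  shows "a\<acute> \<cdot> (a \<cdot> b) = b" "[a\<acute>, a, b] \<in> pg_dom L" "[a\<acute>, a \<cdot> b] \<in> pg_dom L"
proof -
  have c: "a \<in> carrier L" "b \<in> carrier L" using dom_carrier[OF assms] by auto
  show 1: "[a\<acute>, a, b] \<in> pg_dom L"
    using inv_append_dom[OF assms] append_dom[of "[b\<acute>]"] by (auto simp: word_inv_def)
  show "[a\<acute>, a \<cdot> b] \<in> pg_dom L" using prod_Cons(1)[OF 1] .
  show "a\<acute> \<cdot> (a \<cdot> b) = b" using assoc[OF 1] inv_l c one_l by simp
qed

lemma cancel_r: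
  assumes "[a, b] \<in> pg_dom L"
  shows "a \<cdot> b \<cdot> b\<acute> = a" "[a, b, b\<acute>] \<in> pg_dom L" "[a \<cdot> b, b\<acute>] \<in> pg_dom L"
proof -
  have c: "a \<in> carrier L" "b \<in> carrier L" using dom_carrier[OF assms] by auto
  show 1: "[a, b, b\<acute>] \<in> pg_dom L"
    using append_inv_dom[OF assms] append_dom[of "[a, b, b\<acute>]"] by (auto simp: word_inv_def)
  show "[a \<cdot> b, b\<acute>] \<in> pg_dom L" using contract(1)[of "[]" "[a,b]" "[b\<acute>]"] 1 by simp
  show "a \<cdot> b \<cdot> b\<acute> = a" using assoc[OF 1] inv_r c one_r by simp
qed

lemma inv_mul:
  assumes "[a, b] \<in> pg_dom L"
  shows "(a \<cdot> b)\<acute> = b\<acute> \<cdot> a\<acute>" "[b\<acute>, a\<acute>] \<in> pg_dom L"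
proof -
  have c: "a \<in> carrier L" "b \<in> carrier L" "a \<cdot> b \<in> carrier L"
    using dom_carrier[OF assms] prod_closed assms by auto
  show "[b\<acute>, a\<acute>] \<in> pg_dom L" using word_inv_dom[OF assms] by (simp add: word_inv_def)
  have "word_inv L [a, b] @ [a, b] \<in> pg_dom L" "pg_prod L (word_inv L [a, b] @ [a, b]) = \<epsilon>"
    using inv_append_dom[OF assms] inv_append_prod[OF assms] by auto
  then have 1: "[b\<acute> \<cdot> a\<acute>, a \<cdot> b] \<in> pg_dom L" "b\<acute> \<cdot> a\<acute> \<cdot> (a \<cdot> b) = \<epsilon>"
    using prod_append[of "[b\<acute>, a\<acute>]" "[a, b]"] by (auto simp: word_inv_def)
  have "b\<acute> \<cdot> a\<acute> = b\<acute> \<cdot> a\<acute> \<cdot> (a \<cdot> b) \<cdot> (a \<cdot> b)\<acute>" using cancel_r[OF 1(1)] by simp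
  also have "\<dots> = (a \<cdot> b)\<acute>" using 1(2) c one_l inv_closed by simp
  finally show "(a \<cdot> b)\<acute> = b\<acute> \<cdot> a\<acute>" by simp
qed

lemma inv_one: "\<epsilon>\<acute> = \<epsilon>"
  using one_closed inv_l one_r inv_closed by metis

lemma conj_dom_iff: "x \<in> conj_dom L g \<longleftrightarrow> [g\<acute>, x, g] \<in> pg_dom L"
  unfolding conj_dom_def using dom_carrier by auto

lemma conj_facts:
  assumes g: "g \<in> carrier L" and x: "x \<in> conj_dom L g"
  shows "[g, g\<acute>, x, g, g\<acute>] \<in> pg_dom L" "conj_elem L x g \<in> conj_dom L (g\<acute>)"
    "conj_elem L (conj_elem L x g) (g\<acute>) = x" "conj_elem L x g = g\<acute> \<cdot> (x \<cdot> g)" "g \<cdot> conj_elem L x g = x \<cdot> g"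
    "[x, g] \<in> pg_dom L" "[g, conj_elem L x g] \<in> pg_dom L" "conj_elem L x g \<in> carrier L"
proof -
  let ?w = "[g\<acute>, x, g]"
  have w: "?w \<in> pg_dom L" using x conj_dom_iff by auto
  have c: "x \<in> carrier L" "g\<acute> \<in> carrier L" using dom_carrier[OF w] by auto
  have "word_inv L ?w @ ?w \<in> pg_dom L" using inv_append_dom[OF w] .
  then have u: "[g, g\<acute>, x, g] \<in> pg_dom L"
    using g append_dom[of "[g\<acute>, x\<acute>]" "[g, g\<acute>, x, g]"] by (simp add: word_inv_def inv_inv)
  have "[g, g\<acute>, x, g] @ word_inv L [g, g\<acute>, x, g] \<in> pg_dom L" using append_inv_dom[OF u] .
  then show v: "[g, g\<acute>, x, g, g\<acute>] \<in> pg_dom L"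
    using g append_dom[of "[g, g\<acute>, x, g, g\<acute>]"] by (simp add: word_inv_def inv_inv)
  have v': "[g, conj_elem L x g, g\<acute>] \<in> pg_dom L"
      "pg_prod L [g, g\<acute>, x, g, g\<acute>] = pg_prod L [g, conj_elem L x g, g\<acute>]"
    using contract[of "[g]" ?w "[g\<acute>]"] v by (auto simp: conj_elem_def)
  then show "conj_elem L x g \<in> conj_dom L (g\<acute>)" using g by (simp add: conj_dom_iff inv_inv)
  have "pg_prod L [g, g\<acute>, x, g, g\<acute>] = pg_prod L [\<epsilon>, x, g, g\<acute>]"  "[\<epsilon>, x, g, g\<acute>] \<in> pg_dom L"
    using contract[of "[]" "[g, g\<acute>]" "[x, g, g\<acute>]"] v inv_r[OF g] by auto
  then have "pg_prod L [g, g\<acute>, x, g, g\<acute>] = pg_prod L [\<epsilon>, x, \<epsilon>]" "[\<epsilon>, x, \<epsilon>] \<in> pg_dom L"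
    using contract[of "[\<epsilon>, x]" "[g, g\<acute>]" "[]"] inv_r[OF g] by auto
  then have "pg_prod L [g, g\<acute>, x, g, g\<acute>] = x" using assoc one_l one_r c by simp
  then show "conj_elem L (conj_elem L x g) (g\<acute>) = x" using v' g by (simp add: conj_elem_def inv_inv)
  show xg: "[x, g] \<in> pg_dom L" using w append_dom[of "[g\<acute>]"] by auto
  show ce: "conj_elem L x g = g\<acute> \<cdot> (x \<cdot> g)" using assoc w by (simp add: conj_elem_def)
  show "[g, conj_elem L x g] \<in> pg_dom L" using v' append_dom[of "[g, conj_elem L x g]"] by auto
  have "[g\<acute>, x \<cdot> g] \<in> pg_dom L" using prod_Cons(1)[OF w] .
  from cancel_l(1)[OF this] show "g \<cdot> conj_elem L x g = x \<cdot> g" using g by (simp add: ce inv_inv)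
  show "conj_elem L x g \<in> carrier L" using w prod_closed by (simp add: conj_elem_def)
qed

text \<open>Membership of \<open>[x, y]\<close> in the domain would not suffice: the six-letter word
  witnesses both that the two conjugates can be multiplied and that the inner pair
  \<open>g, g\<acute>\<close> can be cancelled.\<close>

lemma conj_mult:
  assumes g: "g \<in> carrier L" and d: "[g\<acute>, x, g, g\<acute>, y, g] \<in> pg_dom L"
  shows "x \<cdot> y \<in> conj_dom L g" "conj_elem L (x \<cdot> y) g = conj_elem L x g \<cdot> conj_elem L y g"
proof -
  have c: "y \<in> carrier L" using dom_carrier[OF d] by auto
  have 1: "[g\<acute>, x, \<epsilon>, y, g] \<in> pg_dom L" "pg_prod L [g\<acute>, x, g, g\<acute>, y, g] = pg_prod L [g\<acute>, x, \<epsilon>, y, g]"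
    using contract[of "[g\<acute>, x]" "[g, g\<acute>]" "[y, g]"] d inv_r[OF g] by auto
  then have "[g\<acute>, x, y, g] \<in> pg_dom L" "pg_prod L [g\<acute>, x, g, g\<acute>, y, g] = pg_prod L [g\<acute>, x, y, g]"
    using contract[of "[g\<acute>, x]" "[\<epsilon>, y]" "[g]"] one_l c by auto
  then have 2: "[g\<acute>, x \<cdot> y, g] \<in> pg_dom L" "pg_prod L [g\<acute>, x, g, g\<acute>, y, g] = pg_prod L [g\<acute>, x \<cdot> y, g]"
    using contract[of "[g\<acute>]" "[x, y]" "[g]"] by auto
  then show "x \<cdot> y \<in> conj_dom L g" by (simp add: conj_dom_iff)
  show "conj_elem L (x \<cdot> y) g = conj_elem L x g \<cdot> conj_elem L y g"
    using 2 prod_append(2)[of "[g\<acute>, x, g]" "[g\<acute>, y, g]"] d by (simp add: conj_elem_def)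
qed

lemma conj_inv:
  assumes g: "g \<in> carrier L" and x: "x \<in> conj_dom L g"
  shows "x\<acute> \<in> conj_dom L g" "conj_elem L (x\<acute>) g = (conj_elem L x g)\<acute>"
proof -
  note f = conj_facts[OF g x]
  have w: "[g\<acute>, x, g] \<in> pg_dom L" using x conj_dom_iff by auto
  have wi: "[g\<acute>, x\<acute>, g] \<in> pg_dom L" using word_inv_dom[OF w] g by (simp add: word_inv_def inv_inv)
  then show "x\<acute> \<in> conj_dom L g" by (simp add: conj_dom_iff)
  have "conj_elem L (x\<acute>) g = g\<acute> \<cdot> x\<acute> \<cdot> g" using assoc[OF wi] by (simp add: conj_elem_def)
  also have "\<dots> = (x \<cdot> g)\<acute> \<cdot> g" using inv_mul[OF f(6)] by simp
  also have "\<dots> = (g\<acute> \<cdot> (x \<cdot> g))\<acute>"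
    using inv_mul[OF prod_Cons(1)[OF w]] g inv_inv by simp
  finally show "conj_elem L (x\<acute>) g = (conj_elem L x g)\<acute>" using f(4) by simp
qed

section \<open>Subgroups of a partial group and the groups they carry\<close>

lemma subgroupD:
  assumes "pg_subgroup L H"
  shows "H \<subseteq> carrier L" "\<epsilon> \<in> H" "x \<in> H \<Longrightarrow> x\<acute> \<in> H" "x \<in> H \<Longrightarrow> y \<in> H \<Longrightarrow> x \<cdot> y \<in> H"
    "set w \<subseteq> H \<Longrightarrow> w \<in> pg_dom L" "set w \<subseteq> H \<Longrightarrow> pg_prod L w \<in> H" "H \<noteq> {}"
proof -
  have H: "H \<subseteq> carrier L" "\<forall>h\<in>H. h\<acute> \<in> H" "\<forall>v\<in>lists H \<inter> pg_dom L. pg_prod L v \<in> H" "lists H \<subseteq> pg_dom L" "H \<noteq> {}"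
    using assms unfolding pg_subgroup_def partial_subgroup_def by auto
  have "lists H \<inter> pg_dom L = lists H" using H(4) by auto
  with H(3) have p: "pg_prod L v \<in> H" if "v \<in> lists H" for v using that by auto
  show "H \<subseteq> carrier L" "\<epsilon> \<in> H" "x \<in> H \<Longrightarrow> x\<acute> \<in> H" "x \<in> H \<Longrightarrow> y \<in> H \<Longrightarrow> x \<cdot> y \<in> H" "H \<noteq> {}"
    using H p[of "[]"] p[of "[x, y]"] by auto
  show "set w \<subseteq> H \<Longrightarrow> w \<in> pg_dom L" "set w \<subseteq> H \<Longrightarrow> pg_prod L w \<in> H"
    using H(4) p[of w] by (auto simp: lists_eq_set)
qed

text \<open>Peeling off first letters turns the product of a word into nested products of two
  letters, so partial subgroups can be recognized by binary closure.\<close>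

lemma prod_in:
  assumes "w \<in> pg_dom L" "set w \<subseteq> H" "\<epsilon> \<in> H" "\<And>x y. x \<in> H \<Longrightarrow> y \<in> H \<Longrightarrow> [x, y] \<in> pg_dom L \<Longrightarrow> x \<cdot> y \<in> H"
  shows "pg_prod L w \<in> H"
  using assms(1,2)
proof (induction w)
  case (Cons x w)
  then have "pg_prod L w \<in> H" using append_dom[of "[x]" w] by auto
  then show ?case using prod_Cons[OF Cons.prems(1)] assms(4) Cons.prems(2) by auto
qed (use assms in simp)

lemma partial_subgroupI:
  assumes "H \<subseteq> carrier L" "\<epsilon> \<in> H" "\<And>x. x \<in> H \<Longrightarrow> x\<acute> \<in> H"
    "\<And>x y. x \<in> H \<Longrightarrow> y \<in> H \<Longrightarrow> [x, y] \<in> pg_dom L \<Longrightarrow> x \<cdot> y \<in> H"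
  shows "partial_subgroup L H"
proof -
  have "pg_prod L v \<in> H" if "v \<in> lists H \<inter> pg_dom L" for v
    by (rule prod_in) (use that assms in \<open>simp_all add: lists_eq_set\<close>)
  then show ?thesis unfolding partial_subgroup_def using assms(1-3) by blast
qed

lemma subgroupI:
  assumes "H \<subseteq> carrier L" "\<epsilon> \<in> H" "\<And>x. x \<in> H \<Longrightarrow> x\<acute> \<in> H"
    "\<And>x y. x \<in> H \<Longrightarrow> y \<in> H \<Longrightarrow> x \<cdot> y \<in> H" "\<And>w. set w \<subseteq> H \<Longrightarrow> w \<in> pg_dom L"
  shows "pg_subgroup L H"
  unfolding pg_subgroup_def using partial_subgroupI[of H] assms by (simp add: lists_eq_set subset_iff)

lemma subgroup_subset:
  assumes "pg_subgroup L H" "K \<subseteq> H" "\<epsilon> \<in> K" "\<And>x. x \<in> K \<Longrightarrow> x\<acute> \<in> K"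
    "\<And>x y. x \<in> K \<Longrightarrow> y \<in> K \<Longrightarrow> x \<cdot> y \<in> K"
  shows "pg_subgroup L K"
proof (rule subgroupI)
  show "w \<in> pg_dom L" if "set w \<subseteq> K" for w using that assms(2) subgroupD(5)[OF assms(1), of w] by blast
  show "K \<subseteq> carrier L" using assms(2) subgroupD(1)[OF assms(1)] by blast
qed (use assms(3-5) in simp_all)

text \<open>Bridge to the group theory of the library. Product and unit are those of
  \<open>L\<close> and do not depend on \<open>H\<close>, so powers of an element agree in all these
  groups.\<close>

definition grp :: "'a set \<Rightarrow> 'a monoid" where
  "grp H = \<lparr>carrier = H, mult = (\<cdot>), one = \<epsilon>\<rparr>"

lemma grp_simps [simp]: "carrier (grp H) = H" "x \<otimes>\<^bsub>grp H\<^esub> y = x \<cdot> y" "\<one>\<^bsub>grp H\<^esub> = \<epsilon>"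
  by (auto simp: grp_def)

lemma group_grp:
  assumes "pg_subgroup L H" shows "group (grp H)"
proof (rule groupI)
  fix x y z assume "x \<in> carrier (grp H)" "y \<in> carrier (grp H)" "z \<in> carrier (grp H)"
  then have "[x, y, z] \<in> pg_dom L" using subgroupD(5)[OF assms] by auto
  then show "x \<otimes>\<^bsub>grp H\<^esub> y \<otimes>\<^bsub>grp H\<^esub> z = x \<otimes>\<^bsub>grp H\<^esub> (y \<otimes>\<^bsub>grp H\<^esub> z)" using assoc by simp
next
  fix x assume x: "x \<in> carrier (grp H)"
  have "x\<acute> \<in> carrier (grp H)" "x\<acute> \<otimes>\<^bsub>grp H\<^esub> x = \<one>\<^bsub>grp H\<^esub>"
    using x subgroupD(1,3)[OF assms] by (simp_all add: inv_l subset_iff)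
  then show "\<exists>y\<in>carrier (grp H). y \<otimes>\<^bsub>grp H\<^esub> x = \<one>\<^bsub>grp H\<^esub>" by blast
  have "x \<in> carrier L" using x subgroupD(1)[OF assms] by auto
  then show "\<one>\<^bsub>grp H\<^esub> \<otimes>\<^bsub>grp H\<^esub> x = x" by (simp add: one_l)
qed (use subgroupD(2,4)[OF assms] in auto)

lemma grp_inv:
  assumes "pg_subgroup L H" "x \<in> H" shows "inv\<^bsub>grp H\<^esub> x = x\<acute>"
proof (rule group.inv_equality[OF group_grp[OF assms(1)]])
  show "x\<acute> \<otimes>\<^bsub>grp H\<^esub> x = \<one>\<^bsub>grp H\<^esub>" using assms subgroupD(1) by (simp add: inv_l subset_iff)
qed (use assms subgroupD(3) in simp_all)

lemma subgroup_grp_iff: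
  assumes H: "pg_subgroup L H"
  shows "subgroup K (grp H) \<longleftrightarrow> K \<subseteq> H \<and> pg_subgroup L K"
proof
  assume K: "subgroup K (grp H)"
  have KH: "K \<subseteq> H" using subgroup.subset[OF K] by simp
  have "x\<acute> \<in> K" if "x \<in> K" for x
    using subgroup.m_inv_closed[OF K that] grp_inv[OF H, of x] KH that by auto
  then show "K \<subseteq> H \<and> pg_subgroup L K"
    using KH subgroup_subset[OF H KH] subgroup.one_closed[OF K] subgroup.m_closed[OF K] by simp
next
  assume K: "K \<subseteq> H \<and> pg_subgroup L K"
  show "subgroup K (grp H)"
  proof (rule group.subgroupI[OF group_grp[OF H]])
    show "inv\<^bsub>grp H\<^esub> x \<in> K" if "x \<in> K" for x
      using that K grp_inv[OF H, of x] subgroupD(3)[of K x] by auto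
    show "x \<otimes>\<^bsub>grp H\<^esub> y \<in> K" if "x \<in> K" "y \<in> K" for x y
      using that K subgroupD(4)[of K x y] by simp
    show "K \<noteq> {}" using K subgroupD(7) by blast
  qed (use K in simp)
qed

lemma conj_mul:
  assumes "[b\<acute>, a\<acute>, x, a, b] \<in> pg_dom L"
  shows "x \<in> conj_dom L (a \<cdot> b)" "x \<in> conj_dom L a" "conj_elem L x a \<in> conj_dom L b"
    "conj_elem L x (a \<cdot> b) = conj_elem L (conj_elem L x a) b"
proof -
  have ab: "[a, b] \<in> pg_dom L" using sublist_dom[of "[b\<acute>, a\<acute>, x]" "[a, b]" "[]"] assms by simp
  have 1: "[b\<acute> \<cdot> a\<acute>, x, a, b] \<in> pg_dom L" "pg_prod L [b\<acute>, a\<acute>, x, a, b] = pg_prod L [b\<acute> \<cdot> a\<acute>, x, a, b]"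
    using contract[of "[]" "[b\<acute>, a\<acute>]" "[x, a, b]"] assms by auto
  have 2: "[b\<acute> \<cdot> a\<acute>, x, a \<cdot> b] \<in> pg_dom L" "pg_prod L [b\<acute> \<cdot> a\<acute>, x, a, b] = pg_prod L [b\<acute> \<cdot> a\<acute>, x, a \<cdot> b]"
    using contract[of "[b\<acute> \<cdot> a\<acute>, x]" "[a, b]" "[]"] 1 by auto
  show "x \<in> conj_dom L a" using sublist_dom[of "[b\<acute>]" "[a\<acute>, x, a]" "[b]"] assms by (simp add: conj_dom_iff)
  have 3: "[b\<acute>, conj_elem L x a, b] \<in> pg_dom L"
    "pg_prod L [b\<acute>, a\<acute>, x, a, b] = pg_prod L [b\<acute>, conj_elem L x a, b]"
    using contract[of "[b\<acute>]" "[a\<acute>, x, a]" "[b]"] assms by (auto simp: conj_elem_def)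
  show "x \<in> conj_dom L (a \<cdot> b)" "conj_elem L x a \<in> conj_dom L b"
    "conj_elem L x (a \<cdot> b) = conj_elem L (conj_elem L x a) b"
    using 1 2 3 inv_mul[OF ab] by (auto simp: conj_dom_iff conj_elem_def)
qed

end

section \<open>Conjugation of objects in a locality\<close>

context locality
begin

abbreviation cj (infixl "\<up>" 75) where "x \<up> g \<equiv> conj_elem L x g"
abbreviation Sg where "Sg g \<equiv> S_elem L S g"

lemma S_subgroup: "pg_subgroup L S"
  using S_p_subgroup by (simp add: pg_p_subgroup_def)

lemmas S_simps = subgroupD[OF S_subgroup]

lemma DeltaD: assumes "P \<in> \<Delta>" shows "pg_subgroup L P" "P \<subseteq> S" "P \<subseteq> carrier L"
  using assms Delta_subgroups subgroupD(1) by auto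

text \<open>The morphisms \<open>P \<rightarrow> Q\<close> of the groupoid of objects; a word is in the domain of the product iff
  it is a composable path.\<close>

definition mor :: "'a set \<Rightarrow> 'a \<Rightarrow> 'a set \<Rightarrow> bool" where
  "mor P g Q \<longleftrightarrow> P \<in> \<Delta> \<and> Q \<in> \<Delta> \<and> g \<in> carrier L \<and> P \<subseteq> conj_dom L g \<and> conj_set L P g = Q"

fun mors :: "'a set \<Rightarrow> 'a list \<Rightarrow> 'a set \<Rightarrow> bool" where
  "mors P [] Q \<longleftrightarrow> P \<in> \<Delta> \<and> P = Q"
| "mors P (g # w) Q \<longleftrightarrow> (\<exists>R. mor P g R \<and> mors R w Q)"

lemma morD: "mor P g Q \<Longrightarrow> P \<in> \<Delta>" "mor P g Q \<Longrightarrow> Q \<in> \<Delta>" "mor P g Q \<Longrightarrow> g \<in> carrier L"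
  "mor P g Q \<Longrightarrow> x \<in> P \<Longrightarrow> x \<in> conj_dom L g" "mor P g Q \<Longrightarrow> x \<in> P \<Longrightarrow> x \<up> g \<in> Q"
  "mor P g Q \<Longrightarrow> Q = (\<lambda>x. x \<up> g) ` P"
  by (auto simp: mor_def conj_set_def)

lemma mor_unique: "mor P g Q \<Longrightarrow> mor P g Q' \<Longrightarrow> Q = Q'"
  by (auto simp: mor_def)

definition chain :: "'a list \<Rightarrow> (nat \<Rightarrow> 'a set) \<Rightarrow> bool" where
  "chain w X \<longleftrightarrow> (\<forall>i \<le> length w. X i \<in> \<Delta>) \<and>
     (\<forall>i < length w. X i \<subseteq> conj_dom L (w ! i) \<and> conj_set L (X i) (w ! i) = X (Suc i))"

lemma dom_chain: "w \<in> lists (carrier L) \<Longrightarrow> w \<in> pg_dom L \<longleftrightarrow> (\<exists>X. chain w X)"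
  unfolding chain_def by (rule dom_iff)

lemma chain_Nil: "chain [] X \<longleftrightarrow> X 0 \<in> \<Delta>"
  by (simp add: chain_def)

lemma chain_Cons:
  assumes "g \<in> carrier L"
  shows "chain (g # w) X \<longleftrightarrow> mor (X 0) g (X (Suc 0)) \<and> chain w (X \<circ> Suc)"
proof
  assume c: "chain (g # w) X"
  have 1: "X i \<in> \<Delta>" if "i \<le> Suc (length w)" for i using c that by (simp add: chain_def)
  have 2: "X i \<subseteq> conj_dom L ((g # w) ! i) \<and> conj_set L (X i) ((g # w) ! i) = X (Suc i)"
    if "i < Suc (length w)" for i using c that by (simp add: chain_def)
  have "mor (X 0) g (X (Suc 0))" using 1[of 0] 1[of "Suc 0"] 2[of 0] assms by (simp add: mor_def)
  moreover have "chain w (X \<circ> Suc)" using 1[of "Suc _"] 2[of "Suc _"] by (simp add: chain_def)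
  ultimately show "mor (X 0) g (X (Suc 0)) \<and> chain w (X \<circ> Suc)" ..
next
  assume c: "mor (X 0) g (X (Suc 0)) \<and> chain w (X \<circ> Suc)"
  have 1: "X i \<in> \<Delta>" if "i \<le> Suc (length w)" for i
    using c that by (cases i) (simp_all add: chain_def mor_def)
  have 2: "X i \<subseteq> conj_dom L ((g # w) ! i) \<and> conj_set L (X i) ((g # w) ! i) = X (Suc i)"
    if "i < Suc (length w)" for i
    using c that by (cases i) (simp_all add: chain_def mor_def)
  show "chain (g # w) X" using 1 2 by (simp add: chain_def)
qed

lemma mors_chain:
  assumes "w \<in> lists (carrier L)" "chain w X"
  shows "mors (X 0) w (X (length w))"
  using assms
proof (induction w arbitrary: X)
  case (Cons g w)
  then have "mor (X 0) g (X (Suc 0))" "chain w (X \<circ> Suc)" using chain_Cons by auto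
  moreover have "mors (X (Suc 0)) w (X (Suc (length w)))"
    using Cons.IH[of "X \<circ> Suc"] Cons.prems(1) \<open>chain w (X \<circ> Suc)\<close> by (simp add: comp_def)
  ultimately show ?case by auto
qed (simp add: chain_Nil)

lemma mors_dom:
  assumes "mors P w Q" shows "w \<in> pg_dom L"
proof -
  have "w \<in> lists (carrier L) \<and> (\<exists>X. X 0 = P \<and> chain w X)"
    using assms
  proof (induction w arbitrary: P)
    case Nil
    then have "P \<in> \<Delta>" unfolding mors.simps by blast
    then show ?case by (intro conjI exI[of _ "\<lambda>_. P"]) (simp_all add: chain_Nil)
  next
    case (Cons g w)
    then obtain R where R: "mor P g R" "mors R w Q" by auto
    obtain X where X: "w \<in> lists (carrier L)" "X 0 = R" "chain w X" using Cons.IH[OF R(2)] by blast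
    have g: "g \<in> carrier L" using morD(3)[OF R(1)] .
    have "case_nat P X \<circ> Suc = X" by (simp add: fun_eq_iff)
    then have "chain (g # w) (case_nat P X)" using R(1) X chain_Cons[OF g, of w "case_nat P X"] by simp
    then show ?case using X(1) g by (intro conjI exI[of _ "case_nat P X"]) simp_all
  qed
  then show ?thesis using dom_chain by blast
qed

lemma dom_mors:
  assumes "w \<in> pg_dom L" obtains P Q where "mors P w Q"
proof -
  have "w \<in> lists (carrier L)" using assms dom_words by auto
  then show ?thesis using that mors_chain dom_chain assms by blast
qed

lemma conj_one: "x \<in> carrier L \<Longrightarrow> x \<in> conj_dom L \<epsilon> \<and> x \<up> \<epsilon> = x"
proof -
  assume x: "x \<in> carrier L"
  have "[\<epsilon>, x] \<in> pg_dom L" using one_ins[of "[]" "[x]"] singleton_dom[OF x] by simp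
  then have "[\<epsilon>, x, \<epsilon>] \<in> pg_dom L" using one_ins[of "[\<epsilon>, x]" "[]"] by simp
  then show ?thesis using assoc[of \<epsilon> x \<epsilon>] x one_l one_r by (simp add: conj_dom_iff inv_one conj_elem_def)
qed

text \<open>Axiom (L3) speaks of overgroups of conjugates; conjugation by the unit turns it into
  closure under overgroups within \<open>S\<close>.\<close>

lemma Delta_up:
  assumes "P \<in> \<Delta>" "pg_subgroup L Q" "P \<subseteq> Q" "Q \<subseteq> S"
  shows "Q \<in> \<Delta>"
  using Delta_closed[OF assms(2,4,1) one_closed] assms DeltaD[OF assms(1)] conj_one
  by (auto simp: conj_set_def subset_iff)

lemma mor_one: "P \<in> \<Delta> \<Longrightarrow> mor P \<epsilon> P"
  using DeltaD[of P] conj_one one_closed unfolding mor_def conj_set_def by force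

lemma mor_inv: assumes "mor P g Q" shows "mor Q (g\<acute>) P"
proof -
  have g: "g \<in> carrier L" using morD assms by auto
  have 1: "x \<up> g \<in> conj_dom L (g\<acute>)" "x \<up> g \<up> g\<acute> = x" if "x \<in> P" for x
    using conj_facts[OF g morD(4)[OF assms that]] by auto
  have Q: "Q = (\<lambda>x. x \<up> g) ` P" using morD(6) assms .
  have "Q \<subseteq> conj_dom L (g\<acute>)" using 1 Q by auto
  moreover have "conj_set L Q (g\<acute>) = P" using 1 Q by (force simp: conj_set_def)
  ultimately show ?thesis using assms g inv_closed unfolding mor_def by auto
qed

lemma S_conj: assumes "s \<in> S" "x \<in> S" shows "x \<in> conj_dom L s" "x \<up> s \<in> S" "x \<up> s = s\<acute> \<cdot> (x \<cdot> s)"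
proof -
  have "[s\<acute>, x, s] \<in> pg_dom L" using S_simps(3,5) assms by auto
  then show "x \<in> conj_dom L s" "x \<up> s = s\<acute> \<cdot> (x \<cdot> s)"  using assoc by (auto simp: conj_dom_iff conj_elem_def)
  then show "x \<up> s \<in> S" using S_simps assms by auto
qed

lemma conj_image_subgroup:
  assumes H: "pg_subgroup L H" and g: "g \<in> carrier L" and Hg: "\<And>x. x \<in> H \<Longrightarrow> x \<in> conj_dom L g" "\<And>x. x \<in> H \<Longrightarrow> x \<up> g \<in> K"
    and w: "\<And>x y. x \<in> H \<Longrightarrow> y \<in> H \<Longrightarrow> [g\<acute>, x, g, g\<acute>, y, g] \<in> pg_dom L" and K: "pg_subgroup L K"
  shows "pg_subgroup L (conj_set L H g)"
  unfolding conj_set_def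
proof (rule subgroup_subset[OF K])
  have m: "x \<up> g \<cdot> y \<up> g = (x \<cdot> y) \<up> g" if "x \<in> H" "y \<in> H" for x y
    using conj_mult(2)[OF g w[OF that]] by simp
  show 1: "\<epsilon> \<in> (\<lambda>x. x \<up> g) ` H"
  proof -
    obtain x where x: "x \<in> H" using subgroupD(7)[OF H] by auto
    have "[g\<acute>, \<epsilon>, g] \<in> pg_dom L" using one_ins[of "[g\<acute>]" "[g]"] inv_l_dom[OF g] by simp
    then have "\<epsilon> \<up> g = \<epsilon>" using assoc one_l one_closed g inv_l by (simp add: conj_elem_def)
    then show ?thesis using subgroupD(2)[OF H] by (metis image_eqI)
  qed
  show "x\<acute> \<in> (\<lambda>x. x \<up> g) ` H" if "x \<in> (\<lambda>x. x \<up> g) ` H" for x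
    using that conj_inv(2)[OF g Hg(1)] subgroupD(3)[OF H] by force
  show "x \<cdot> y \<in> (\<lambda>x. x \<up> g) ` H" if "x \<in> (\<lambda>x. x \<up> g) ` H" "y \<in> (\<lambda>x. x \<up> g) ` H" for x y
    using that m subgroupD(4)[OF H] by auto
qed (use Hg in auto)

lemma mor_S: assumes P: "P \<in> \<Delta>" and s: "s \<in> S" shows "mor P s (conj_set L P s)"
proof -
  have Pc: "P \<subseteq> conj_dom L s" using S_conj(1)[OF s] DeltaD(2)[OF P] by blast
  have sc: "s \<in> carrier L" using s S_simps(1) by blast
  have sub: "pg_subgroup L (conj_set L P s)"
  proof (rule conj_image_subgroup[OF DeltaD(1)[OF P] _ _ _ _ S_subgroup])
    show "[s\<acute>, x, s, s\<acute>, y, s] \<in> pg_dom L" if "x \<in> P" "y \<in> P" for x y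
      by (rule S_simps(5)) (use that DeltaD(2)[OF P] S_simps(3)[OF s] s in auto)
  qed (use DeltaD(2)[OF P] S_conj[OF s] S_simps(1) s in blast)+
  moreover have "conj_set L P s \<subseteq> S" using S_conj[OF s] DeltaD[OF P] by (auto simp: conj_set_def)
  ultimately have "conj_set L P s \<in> \<Delta>"
    using Delta_closed[OF _ _ P, of "conj_set L P s" s] Pc sc by simp
  then show ?thesis unfolding mor_def using P sc Pc by simp
qed

lemma mor_self: assumes P: "P \<in> \<Delta>" and s: "s \<in> P" shows "mor P s P"
proof -
  note D = subgroupD[OF DeltaD(1)[OF P]]
  have cl: "x \<up> s \<in> P" if "x \<in> P" "s \<in> P" for x s
  proof -
    have "s \<in> S" "x \<in> S" using that DeltaD(2)[OF P] by auto
    then show ?thesis using S_conj(3) D(3)[OF that(2)] D(4)[OF that] D(4) by simp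
  qed
  have "x \<in> conj_set L P s" if x: "x \<in> P" for x
  proof -
    have "x \<in> conj_dom L (s\<acute>)" using S_conj(1)[of "s\<acute>" x] x D(3)[OF s] DeltaD(2)[OF P] by blast
    from conj_facts(3)[OF _ this] have "x \<up> s\<acute> \<up> s = x" using s D(1) inv_inv inv_closed by (metis subsetD)
    then show ?thesis using cl[OF x, of "s\<acute>"] D(3)[OF s] unfolding conj_set_def by force
  qed
  then have "conj_set L P s = P" using cl s by (auto simp: conj_set_def)
  then show ?thesis using mor_S[OF P, of s] s DeltaD[OF P] by auto
qed

text \<open>The iterated conjugate is available once \<open>[b\<acute>, a\<acute>, x, a, b]\<close>
  is in the domain. The path \<open>R, Q, P, P, Q, R\<close> shows this, its middle step being
  \<open>mor_self\<close> for \<open>x \<in> P\<close>.\<close>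

lemma mor_comp: assumes "mor P a Q" "mor Q b R"
  shows "mor P (a \<cdot> b) R" "[a, b] \<in> pg_dom L" "x \<in> P \<Longrightarrow> x \<up> (a \<cdot> b) = x \<up> a \<up> b"
proof -
  have P: "P \<in> \<Delta>" "R \<in> \<Delta>" using morD assms by auto
  have "mors P [a, b] R" using assms P by auto
  then show ab: "[a, b] \<in> pg_dom L" by (rule mors_dom)
  have "mors R [b\<acute>, a\<acute>, x, a, b] R" if "x \<in> P" for x
    using mor_inv[OF assms(1)] mor_inv[OF assms(2)] assms mor_self[OF P(1) that] P unfolding mors.simps by blast
  then have w: "[b\<acute>, a\<acute>, x, a, b] \<in> pg_dom L" if "x \<in> P" for x using mors_dom that by blast
  show "x \<up> (a \<cdot> b) = x \<up> a \<up> b" if "x \<in> P" for x using conj_mul[OF w[OF that]] by auto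
  then have "conj_set L P (a \<cdot> b) = (\<lambda>x. x \<up> b) ` ((\<lambda>x. x \<up> a) ` P)" by (auto simp: conj_set_def)
  also have "\<dots> = R" using morD(6) assms by metis
  finally show "mor P (a \<cdot> b) R" unfolding mor_def using P conj_mul(1)[OF w] prod_closed[OF ab] by auto
qed

section \<open>The subgroups S_g and S_(a,b)\<close>

lemma Sg_iff: "s \<in> Sg g \<longleftrightarrow> s \<in> S \<and> s \<in> conj_dom L g \<and> s \<up> g \<in> S"
  by (auto simp: S_elem_def)

lemma mor_sub_Sg: assumes m: "mor P g Q" shows "P \<subseteq> Sg g"
proof
  fix x assume x: "x \<in> P"
  have "x \<in> S" using x DeltaD(2)[OF morD(1)[OF m]] by blast
  moreover have "x \<up> g \<in> S" using morD(5)[OF m x] DeltaD(2)[OF morD(2)[OF m]] by blast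
  ultimately show "x \<in> Sg g" using morD(4)[OF m x] by (simp add: Sg_iff)
qed

text \<open>The word \<open>(a\<acute>, g, a \<up> g)\<close> has product \<open>g\<close>. This is what makes \<open>Sg g\<close> a subgroup.\<close>

lemma mor_translate:
  assumes m: "mor P g Q" and a: "a \<in> Sg g"
  shows "mor (conj_set L P a) g (conj_set L Q (a \<up> g))"
proof -
  have g: "g \<in> carrier L" using m morD by auto
  have aS: "a \<in> S" "a \<up> g \<in> S" "a \<in> conj_dom L g" using a Sg_iff by auto
  note f = conj_facts[OF g aS(3)]
  have "mor (conj_set L P a) (a\<acute>) P" using mor_inv mor_S aS m morD by auto
  moreover have "mor P (g \<cdot> a \<up> g) (conj_set L Q (a \<up> g))" using mor_comp(1)[OF m] mor_S aS m morD by auto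
  ultimately have "mor (conj_set L P a) (a\<acute> \<cdot> (g \<cdot> a \<up> g)) (conj_set L Q (a \<up> g))" by (rule mor_comp)
  moreover have "a\<acute> \<cdot> (g \<cdot> a \<up> g) = g" using f(5) cancel_l(1)[OF f(6)] by simp
  ultimately show ?thesis by simp
qed

lemma obtain_mor: assumes "g \<in> carrier L" obtains P Q where "mor P g Q"
  using dom_mors[OF singleton_dom[OF assms]] by (metis mors.simps(2))

text \<open>Conjugation by \<open>x\<close> or \<open>y\<close> need not fix the object
  \<open>P\<close> on which \<open>g\<close> is defined, so the path runs through translates: from
  \<open>Q\<close> to \<open>P\<close>, on to the translate of \<open>P\<close> by \<open>x\<close>,
  over to the translate of \<open>Q\<close> by \<open>x \<up> g\<close> and back, then likewise with
  \<open>y\<close>.\<close>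

lemma Sg_word:
  assumes g: "g \<in> carrier L" and x: "x \<in> Sg g" and y: "y \<in> Sg g"
  shows "[g\<acute>, x, g, g\<acute>, y, g] \<in> pg_dom L"
proof -
  obtain P Q where PQ: "mor P g Q" using obtain_mor[OF g] .
  let ?P1 = "conj_set L P x" and ?Q1 = "conj_set L Q (x \<up> g)"
  have 1: "mor ?P1 g ?Q1" using mor_translate[OF PQ x] .
  have 2: "mor (conj_set L ?P1 y) g (conj_set L ?Q1 (y \<up> g))" using mor_translate[OF 1 y] .
  have "mors Q [g\<acute>, x, g, g\<acute>, y, g] (conj_set L ?Q1 (y \<up> g))"
    using mor_inv[OF PQ] mor_inv[OF 1] mor_S[of P x] mor_S[of ?P1 y] x y 1 2 PQ morD
    unfolding mors.simps Sg_iff by blast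
  then show ?thesis by (rule mors_dom)
qed

lemma Sg_conj_mult:
  assumes g: "g \<in> carrier L" and x: "x \<in> Sg g" and y: "y \<in> Sg g"
  shows "(x \<cdot> y) \<up> g = x \<up> g \<cdot> y \<up> g" "x \<cdot> y \<in> conj_dom L g"
  using conj_mult[OF g Sg_word[OF assms]] by auto

lemma conj_one_elem: assumes "g \<in> carrier L" shows "\<epsilon> \<in> conj_dom L g" "\<epsilon> \<up> g = \<epsilon>"
proof -
  have "[g\<acute>, \<epsilon>, g] \<in> pg_dom L" using one_ins[of "[g\<acute>]" "[g]"] inv_l_dom[OF assms] by simp
  then show "\<epsilon> \<in> conj_dom L g" "\<epsilon> \<up> g = \<epsilon>"
    using assoc one_l one_closed assms inv_l by (auto simp add: conj_elem_def conj_dom_iff)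
qed

lemma Sg_subgroup: assumes g: "g \<in> carrier L" shows "pg_subgroup L (Sg g)"
  by (rule subgroup_subset[OF S_subgroup])
    (use Sg_conj_mult[OF g] conj_one_elem[OF g] conj_inv[OF g] S_simps in \<open>auto simp: Sg_iff\<close>)

lemma Sg_S: "Sg g \<subseteq> S" by (auto simp: Sg_iff)

lemma Sg_Delta: assumes g: "g \<in> carrier L" shows "Sg g \<in> \<Delta>"
proof -
  obtain P Q where PQ: "mor P g Q" using obtain_mor[OF g] .
  show ?thesis using Delta_up[OF morD(1)[OF PQ] Sg_subgroup[OF g] mor_sub_Sg[OF PQ] Sg_S] .
qed

text \<open>The largest morphism labelled \<open>g\<close>: by \<open>mor_sub_Sg\<close> every other
  one is a restriction of it.\<close>

lemma mor_Sg: assumes g: "g \<in> carrier L" shows "mor (Sg g) g (Sg (g\<acute>))"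
proof -
  have "conj_set L (Sg g) g = Sg (g\<acute>)"
  proof
    show "conj_set L (Sg g) g \<subseteq> Sg (g\<acute>)" using conj_facts(2,3)[OF g] by (auto simp: conj_set_def Sg_iff)
    have "x \<up> g\<acute> \<in> Sg g \<and> x \<up> g\<acute> \<up> g = x" if "x \<in> Sg (g\<acute>)" for x
      using that conj_facts(2,3)[OF inv_closed[OF g], of x] inv_inv[OF g] by (auto simp: Sg_iff)
    then show "Sg (g\<acute>) \<subseteq> conj_set L (Sg g) g" by (force simp: conj_set_def)
  qed
  then show ?thesis unfolding mor_def using Sg_Delta g inv_closed by (auto simp: Sg_iff)
qed

lemma mor_restrict: assumes "g \<in> carrier L" "P \<in> \<Delta>" "P \<subseteq> Sg g" shows "mor P g (conj_set L P g)"
proof -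
  have *: "x \<in> S \<and> x \<in> conj_dom L g \<and> x \<up> g \<in> S" if "x \<in> P" for x using assms(3) that Sg_iff by blast
  have sub: "pg_subgroup L (conj_set L P g)"
    by (rule conj_image_subgroup[OF DeltaD(1)[OF assms(2)] assms(1) _ _ _ S_subgroup])
      (use Sg_word[OF assms(1)] assms(3) * in auto)
  moreover have "conj_set L P g \<subseteq> S" using * by (auto simp: conj_set_def)
  ultimately have "conj_set L P g \<in> \<Delta>"
    using Delta_closed[OF _ _ assms(2,1), of "conj_set L P g"] * by auto
  then show ?thesis unfolding mor_def using assms * by auto
qed

lemma mor_sub: assumes "mor P g Q" "R \<in> \<Delta>" "R \<subseteq> P"
  obtains U where "mor R g U" "U \<subseteq> Q" "U = conj_set L R g"
proof -
  have "R \<subseteq> Sg g" using mor_sub_Sg[OF assms(1)] assms(3) by simp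
  then have "mor R g (conj_set L R g)" using mor_restrict assms morD by blast
  moreover have "conj_set L R g \<subseteq> Q" using assms morD(5) by (auto simp: conj_set_def)
  ultimately show ?thesis using that by blast
qed

text \<open>The set \<open>S_word L S [a, b]\<close>, written through \<open>Sg\<close> so that no
  sequence of intermediate elements has to be handled.\<close>

definition S_pair where "S_pair a b = {s \<in> Sg a. s \<up> a \<in> Sg b}"

lemma S_pair: assumes ab: "[a, b] \<in> pg_dom L"
  shows "S_pair a b \<in> \<Delta>" "\<exists>R U. mor (S_pair a b) a R \<and> mor R b U" "S_pair a b \<subseteq> Sg (a \<cdot> b)"
    "s \<in> S_pair a b \<Longrightarrow> s \<up> (a \<cdot> b) = s \<up> a \<up> b"
proof -
  have c: "a \<in> carrier L" "b \<in> carrier L" using ab dom_carrier by auto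
  obtain P Q where "mors P [a, b] Q" using dom_mors[OF ab] .
  then obtain R where R: "mor P a R" "mor R b Q" by auto
  have sub: "pg_subgroup L (S_pair a b)" unfolding S_pair_def
    by (rule subgroup_subset[OF Sg_subgroup[OF c(1)]])
      (use Sg_conj_mult[OF c(1)] conj_one_elem[OF c(1)] conj_inv[OF c(1)]
         subgroupD[OF Sg_subgroup[OF c(1)]] subgroupD[OF Sg_subgroup[OF c(2)]]
         in \<open>auto simp: Sg_iff\<close>)
  have "P \<subseteq> S_pair a b" unfolding S_pair_def using mor_sub_Sg[OF R(1)] mor_sub_Sg[OF R(2)] morD(5)[OF R(1)] by auto
  then show D: "S_pair a b \<in> \<Delta>" using Delta_up[OF _ sub] morD(1)[OF R(1)] by (auto simp: S_pair_def Sg_iff)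
  then have 1: "mor (S_pair a b) a (conj_set L (S_pair a b) a)" using mor_restrict[OF c(1)] by (auto simp: S_pair_def)
  moreover have 2: "mor (conj_set L (S_pair a b) a) b (conj_set L (conj_set L (S_pair a b) a) b)"
    using mor_restrict[OF c(2) morD(2)[OF 1]] by (auto simp: S_pair_def conj_set_def)
  ultimately show "\<exists>R U. mor (S_pair a b) a R \<and> mor R b U" by blast
  show "S_pair a b \<subseteq> Sg (a \<cdot> b)" using mor_sub_Sg[OF mor_comp(1)[OF 1 2]] .
  show "s \<in> S_pair a b \<Longrightarrow> s \<up> (a \<cdot> b) = s \<up> a \<up> b" using mor_comp(3)[OF 1 2] .
qed

lemma S_pair_mor_iff: "mor P a R \<Longrightarrow> mor R b U \<Longrightarrow> P \<subseteq> S_pair a b"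
  using mor_sub_Sg[of P a R] mor_sub_Sg[of R b U] morD(5)[of P a R] by (auto simp: S_pair_def)

text \<open>If both \<open>a\<close> and \<open>a \<cdot> b\<close> conjugate \<open>s\<close> into
  \<open>S\<close>, then \<open>s \<up> a\<close> lies in
  \<open>S_pair (a\<acute>) (a \<cdot> b)\<close>, hence in \<open>Sg\<close> of the product
  \<open>a\<acute> \<cdot> (a \<cdot> b) = b\<close>. So only \<open>Sg a\<close> decides whether a
  factorization loses part of \<open>Sg (a \<cdot> b)\<close>.\<close>

lemma S_pair_Int: assumes ab: "[a, b] \<in> pg_dom L" shows "S_pair a b = Sg a \<inter> Sg (a \<cdot> b)"
proof
  show "S_pair a b \<subseteq> Sg a \<inter> Sg (a \<cdot> b)" using S_pair(3)[OF ab] by (auto simp: S_pair_def)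
  have c: "a \<in> carrier L" using ab dom_carrier by auto
  show "Sg a \<inter> Sg (a \<cdot> b) \<subseteq> S_pair a b"
  proof
    fix s assume s: "s \<in> Sg a \<inter> Sg (a \<cdot> b)"
    then have "s \<up> a \<in> Sg (a\<acute>)" "s \<up> a \<up> a\<acute> = s"
      using mor_Sg[OF c] morD(5) conj_facts(3)[OF c] Sg_iff by blast+
    then have "s \<up> a \<in> S_pair (a\<acute>) (a \<cdot> b)" using s by (simp add: S_pair_def)
    then have "s \<up> a \<in> Sg (a\<acute> \<cdot> (a \<cdot> b))" using S_pair(3) cancel_l(3)[OF ab] by blast
    then show "s \<in> S_pair a b" using s cancel_l(1)[OF ab] by (simp add: S_pair_def)
  qed
qed

section \<open>Conjugates of morphisms and normalizers of objects\<close>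

lemma mor_conj:
  assumes "mor P x P'" "mor P f Q" "mor P' f Q'"
  shows "x \<in> conj_dom L f" "mor Q (x \<up> f) Q'" "x \<up> f = f\<acute> \<cdot> (x \<cdot> f)"
proof -
  have "mors Q [f\<acute>, x, f] Q'" using mor_inv[OF assms(2)] assms morD(2)[OF assms(3)] by auto
  then have d: "[f\<acute>, x, f] \<in> pg_dom L" by (rule mors_dom)
  then show 1: "x \<in> conj_dom L f" "x \<up> f = f\<acute> \<cdot> (x \<cdot> f)" using assoc[OF d] by (auto simp: conj_dom_iff conj_elem_def)
  show "mor Q (x \<up> f) Q'" using mor_comp(1)[OF mor_inv[OF assms(2)] mor_comp(1)[OF assms(1,3)]] 1 by simp
qed

lemma mor_conj_comp:
  assumes "mor P x P'" "mor P f Q" "mor P' f Q'" "mor Q g R" "mor Q' g R'"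
  shows "x \<up> (f \<cdot> g) = x \<up> f \<up> g" "x \<in> conj_dom L (f \<cdot> g)"
proof -
  have "mors R [g\<acute>, f\<acute>, x, f, g] R'"
    using mor_inv[OF assms(2)] mor_inv[OF assms(4)] assms morD(2)[OF assms(5)] unfolding mors.simps by blast
  from conj_mul[OF mors_dom[OF this]] show "x \<up> (f \<cdot> g) = x \<up> f \<up> g" "x \<in> conj_dom L (f \<cdot> g)" by auto
qed

lemma mor_conj_mult:
  assumes "mor P x P'" "mor P' y P''" "mor P f Q" "mor P' f Q'" "mor P'' f Q''"
  shows "(x \<cdot> y) \<up> f = x \<up> f \<cdot> y \<up> f"
proof -
  have "mors Q [f\<acute>, x, f, f\<acute>, y, f] Q''"
    using mor_inv[OF assms(3)] mor_inv[OF assms(4)] assms morD(2)[OF assms(5)] unfolding mors.simps by blast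
  from conj_mult[OF morD(3)[OF assms(3)] mors_dom[OF this]] show ?thesis by auto
qed

lemma mor_assoc:
  assumes "mor P a Q" "mor Q b R" "mor R c U"
  shows "a \<cdot> b \<cdot> c = a \<cdot> (b \<cdot> c)"
  by (rule assoc, rule mors_dom[of P _ U]) (use assms morD in auto)

text \<open>The automorphism group of \<open>P\<close> in the groupoid of objects. Every word in it
  is a path from \<open>P\<close> to \<open>P\<close>, so it is a subgroup and ordinary finite group
  theory applies to it.\<close>

definition Norm where "Norm P = {g. mor P g P}"

lemma Norm_subgroup: assumes P: "P \<in> \<Delta>" shows "pg_subgroup L (Norm P)"
  unfolding Norm_def
proof (rule subgroupI, unfold mem_Collect_eq)
  show "w \<in> pg_dom L" if "set w \<subseteq> {g. mor P g P}" for w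
  proof -
    have "mors P w P" using that by (induction w) (auto simp: P)
    then show ?thesis by (rule mors_dom)
  qed
  show "{g. mor P g P} \<subseteq> carrier L" using morD(3) by blast
qed (rule mor_one[OF P] mor_inv mor_comp(1); assumption)+

lemma Norm_conj:
  assumes "x \<in> Norm P" "mor P f Q"
  shows "x \<in> conj_dom L f" "x \<up> f \<in> Norm Q" "x \<up> f = f\<acute> \<cdot> (x \<cdot> f)"
  using mor_conj[of P x P f Q Q] assms by (auto simp: Norm_def)

lemma Norm_conj_mult:
  assumes "x \<in> Norm P" "y \<in> Norm P" "mor P f Q"
  shows "(x \<cdot> y) \<up> f = x \<up> f \<cdot> y \<up> f"
  using mor_conj_mult[of P x P y P] assms by (auto simp: Norm_def)

lemma Norm_conj_comp:
  assumes "x \<in> Norm P" "mor P f Q" "mor Q g R"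
  shows "x \<up> (f \<cdot> g) = x \<up> f \<up> g"
  using mor_conj_comp[of P x P f Q Q g R R] assms by (auto simp: Norm_def)

lemma Norm_conj_inv:
  assumes "x \<in> Norm P" "mor P f Q" shows "x \<up> f \<up> f\<acute> = x"
  using conj_facts(3)[OF morD(3)[OF assms(2)] Norm_conj(1)[OF assms]] .

lemma Delta_Norm: "P \<in> \<Delta> \<Longrightarrow> P \<subseteq> Norm P" using mor_self by (auto simp: Norm_def)

lemma Norm_Sg: "x \<in> Norm P \<Longrightarrow> mor P f Q \<Longrightarrow> x \<in> Sg f \<longleftrightarrow> x \<in> S \<and> x \<up> f \<in> S"
  using Norm_conj(1) by (auto simp: Sg_iff)

lemma Norm_conj_subgroup:
  assumes X: "pg_subgroup L X" "X \<subseteq> Norm P" and f: "mor P f Q"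
  shows "pg_subgroup L ((\<lambda>x. x \<up> f) ` X)" "(\<lambda>x. x \<up> f) ` X \<subseteq> Norm Q" "card ((\<lambda>x. x \<up> f) ` X) = card X"
proof -
  show 1: "(\<lambda>x. x \<up> f) ` X \<subseteq> Norm Q" using Norm_conj[OF _ f] X by auto
  show "card ((\<lambda>x. x \<up> f) ` X) = card X"
    by (rule card_image, rule inj_on_inverseI[of _ "\<lambda>x. x \<up> f\<acute>"]) (use Norm_conj_inv[OF _ f] X in auto)
  have fc: "f \<in> carrier L" using f morD by auto
  show "pg_subgroup L ((\<lambda>x. x \<up> f) ` X)"
  proof (rule subgroup_subset[OF Norm_subgroup[OF morD(2)[OF f]] 1])
    show "\<epsilon> \<in> (\<lambda>x. x \<up> f) ` X" using subgroupD(2)[OF X(1)] conj_one_elem(2)[OF fc] by (metis image_eqI)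
    show "x\<acute> \<in> (\<lambda>x. x \<up> f) ` X" if "x \<in> (\<lambda>x. x \<up> f) ` X" for x
      using that subgroupD(3)[OF X(1)] conj_inv(2)[OF fc] Norm_conj(1)[OF _ f] X(2) by force
    show "x \<cdot> y \<in> (\<lambda>x. x \<up> f) ` X" if "x \<in> (\<lambda>x. x \<up> f) ` X" "y \<in> (\<lambda>x. x \<up> f) ` X" for x y
      using that subgroupD(4)[OF X(1)] Norm_conj_mult[OF _ _ f] X(2) by force
  qed
qed

lemma mor_card: assumes "mor P f Q" shows "card Q = card P"
  using Norm_conj_subgroup(3)[OF DeltaD(1) Delta_Norm assms] morD(1,6)[OF assms] by simp

lemma finite_S: "finite S" using finite_subset[OF S_simps(1) finite_carrier] .
lemma finite_Delta: "P \<in> \<Delta> \<Longrightarrow> finite P" using finite_subset[OF DeltaD(2) finite_S] .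
lemma finite_subgroup: "pg_subgroup L P \<Longrightarrow> finite P" using finite_subset[OF subgroupD(1) finite_carrier] .

section \<open>p-subgroups and partial normal subgroups\<close>

abbreviation p_subgroup where "p_subgroup X \<equiv> pg_p_subgroup p L X"

lemma p_subgroupD: "p_subgroup X \<Longrightarrow> pg_subgroup L X"
  by (simp add: pg_p_subgroup_def)

lemma p_subgroup_subset:
  assumes Y: "p_subgroup Y" and X: "pg_subgroup L X" "X \<subseteq> Y"
  shows "p_subgroup X"
proof -
  obtain n where n: "card Y = p ^ n" using Y by (auto simp: pg_p_subgroup_def)
  interpret Y: group "grp Y" by (rule group_grp[OF p_subgroupD[OF Y]])
  have "subgroup X (grp Y)" using subgroup_grp_iff[OF p_subgroupD[OF Y]] X by simp
  from Y.lagrange[OF this] have "card X dvd p ^ n" using n by (metis dvd_triv_right grp_simps(1) order_def)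
  then show ?thesis unfolding pg_p_subgroup_def using X(1) divides_primepow_nat[OF prime_p] by blast
qed

lemma p_subgroup_S: "pg_subgroup L X \<Longrightarrow> X \<subseteq> S \<Longrightarrow> p_subgroup X"
  using p_subgroup_subset[OF S_p_subgroup] .

lemma p_subgroup_conj:
  assumes "p_subgroup X" "X \<subseteq> Norm P" "mor P f Q" shows "p_subgroup ((\<lambda>x. x \<up> f) ` X)"
  using Norm_conj_subgroup[OF p_subgroupD[OF assms(1)] assms(2,3)] assms(1) by (simp add: pg_p_subgroup_def)

lemma subgroup_Int:
  assumes "pg_subgroup L X" "pg_subgroup L Y" shows "pg_subgroup L (X \<inter> Y)"
  by (rule subgroup_subset[OF assms(1)])
    (use subgroupD(2-4)[OF assms(1)] subgroupD(2-4)[OF assms(2)] in blast)+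

definition max_p_subgroup where
  "max_p_subgroup Y G \<longleftrightarrow> p_subgroup Y \<and> Y \<subseteq> G \<and> (\<forall>Z. p_subgroup Z \<longrightarrow> Y \<subseteq> Z \<longrightarrow> Z \<subseteq> G \<longrightarrow> Z = Y)"

lemma max_p_subgroup_exists:
  assumes G: "pg_subgroup L G" and V: "p_subgroup V" "V \<subseteq> G"
  obtains Y where "max_p_subgroup Y G" "V \<subseteq> Y"
proof -
  have fin: "finite G" by (rule finite_subgroup[OF G])
  let ?P = "\<lambda>Y. p_subgroup Y \<and> V \<subseteq> Y \<and> Y \<subseteq> G"
  have "\<exists>Y. ?P Y \<and> (\<forall>Z. ?P Z \<longrightarrow> card Z \<le> card Y)"
    by (rule ex_has_greatest_nat[of ?P V _ "Suc (card G)"]) (use V card_mono[OF fin] in \<open>auto simp: less_Suc_eq_le\<close>)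
  then obtain Y where Y: "p_subgroup Y" "V \<subseteq> Y" "Y \<subseteq> G" "\<And>Z. ?P Z \<Longrightarrow> card Z \<le> card Y" by blast
  have "max_p_subgroup Y G"
    unfolding max_p_subgroup_def
  proof (intro conjI allI impI)
    fix Z assume Z: "p_subgroup Z" "Y \<subseteq> Z" "Z \<subseteq> G"
    then have "card Z \<le> card Y" using Y(2) Y(4)[of Z] by blast
    then show "Z = Y" using Z fin by (metis card_seteq finite_subset)
  qed (use Y in auto)
  then show ?thesis using that Y(2) by blast
qed

lemma subgroup_assoc:
  assumes "pg_subgroup L G" "a \<in> G" "b \<in> G" "c \<in> G" shows "a \<cdot> b \<cdot> c = a \<cdot> (b \<cdot> c)"
  by (rule assoc, rule subgroupD(5)[OF assms(1)]) (use assms in simp)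

lemma subgroup_conj:
  assumes "pg_subgroup L G" "a \<in> G" "b \<in> G" shows "a \<up> b = b\<acute> \<cdot> (a \<cdot> b)" "a \<in> conj_dom L b" "a \<up> b \<in> G"
proof -
  have "[b\<acute>, a, b] \<in> pg_dom L" by (rule subgroupD(5)[OF assms(1)]) (use assms subgroupD(3)[OF assms(1)] in simp)
  then show 1: "a \<up> b = b\<acute> \<cdot> (a \<cdot> b)" "a \<in> conj_dom L b" using assoc by (auto simp: conj_dom_iff conj_elem_def)
  show "a \<up> b \<in> G" unfolding 1 using assms subgroupD(3,4)[OF assms(1)] by simp
qed

lemma sylow_conj:
  assumes G: "pg_subgroup L G" and Y: "max_p_subgroup Y G" and X: "p_subgroup X" "X \<subseteq> G"
  obtains g where "g \<in> G" "\<And>x. x \<in> X \<Longrightarrow> x \<up> g \<in> Y"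
proof -
  interpret G: group "grp G" by (rule group_grp[OF G])
  obtain m n where mn: "card Y = p ^ m" "card X = p ^ n" using Y X unfolding max_p_subgroup_def pg_p_subgroup_def by auto
  have sY: "subgroup Y (grp G)" and sX: "subgroup X (grp G)"
    using Y X p_subgroupD subgroup_grp_iff[OF G] unfolding max_p_subgroup_def by blast+
  have "\<exists>g\<in>carrier (grp G). \<forall>x\<in>X. inv\<^bsub>grp G\<^esub> g \<otimes>\<^bsub>grp G\<^esub> x \<otimes>\<^bsub>grp G\<^esub> g \<in> Y"
  proof (rule G.sylow_conjugate_into[OF _ prime_p sY mn(1) _ sX mn(2)])
    show "finite (carrier (grp G))" using finite_subgroup[OF G] by simp
    fix Z j assume Z: "subgroup Z (grp G)" "card Z = p ^ j" "Y \<subseteq> Z"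
    then have "p_subgroup Z" "Z \<subseteq> G" using subgroup_grp_iff[OF G] unfolding pg_p_subgroup_def by blast+
    then show "Z = Y" using Z(3) Y unfolding max_p_subgroup_def by blast
  qed
  then obtain g where g: "g \<in> G" "\<And>x. x \<in> X \<Longrightarrow> g\<acute> \<cdot> x \<cdot> g \<in> Y" using grp_inv[OF G] by auto
  have "x \<up> g \<in> Y" if "x \<in> X" for x
  proof -
    have "x \<in> G" using that X by blast
    then show ?thesis using g(2)[OF that] subgroup_conj[OF G _ g(1)] subgroup_assoc[OF G subgroupD(3)[OF G g(1)] _ g(1)] by simp
  qed
  then show ?thesis using that g(1) by blast
qed

section \<open>Growth of normalizers in p-subgroups\<close>

lemma grows_conv:
  assumes G: "pg_subgroup L G" "pg_subgroup L X" "X \<subseteq> G" and g: "g \<in> G" "g \<notin> X" "\<And>x. x \<in> X \<Longrightarrow> g \<cdot> x \<cdot> g\<acute> \<in> X"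
  shows "g\<acute> \<notin> X" "\<And>x. x \<in> X \<Longrightarrow> x \<up> g\<acute> \<in> X"
proof -
  have gc: "g \<in> carrier L" using g subgroupD(1)[OF G(1)] by blast
  show "g\<acute> \<notin> X" using g(2) subgroupD(3)[OF G(2), of "g\<acute>"] inv_inv[OF gc] by auto
  show "x \<up> g\<acute> \<in> X" if "x \<in> X" for x
  proof -
    have "x \<in> G" "g\<acute> \<in> G" using that G(3) subgroupD(3)[OF G(1) g(1)] by auto
    then show ?thesis
      using g(3)[OF that] subgroup_conj(1)[OF G(1), of x "g\<acute>"] subgroup_assoc[OF G(1) g(1), of x "g\<acute>"] inv_inv[OF gc] by simp
  qed
qed

lemma grows:
  assumes Y: "p_subgroup Y" and X: "pg_subgroup L X" "X \<subseteq> Y" "X \<noteq> Y"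
  obtains g where "g \<in> Y" "g \<notin> X" "\<And>x. x \<in> X \<Longrightarrow> x \<up> g \<in> X"
proof -
  note sY = p_subgroupD[OF Y]
  interpret Y: group "grp Y" by (rule group_grp[OF sY])
  obtain n where n: "card Y = p ^ n" using Y by (auto simp: pg_p_subgroup_def)
  have "\<exists>g\<in>carrier (grp Y) - X. \<forall>h\<in>X. g \<otimes>\<^bsub>grp Y\<^esub> h \<otimes>\<^bsub>grp Y\<^esub> inv\<^bsub>grp Y\<^esub> g \<in> X"
    by (rule Y.p_group_normalizer_grows[OF _ prime_p])
      (use n X finite_subgroup[OF sY] subgroup_grp_iff[OF sY] in \<open>auto simp: order_def\<close>)
  then obtain g where g: "g \<in> Y" "g \<notin> X" "\<And>x. x \<in> X \<Longrightarrow> g \<cdot> x \<cdot> g\<acute> \<in> X" using grp_inv[OF sY] by auto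
  then show ?thesis using that[of "g\<acute>"] grows_conv[OF sY X(1,2) g] subgroupD(3)[OF sY g(1)] by blast
qed

text \<open>Conjugation by \<open>g\<close> preserves the size of \<open>P\<close>, so a conjugation
  of \<open>P\<close> into itself is onto.\<close>

lemma mor_into_self:
  assumes P: "P \<in> \<Delta>" and g: "g \<in> carrier L" and "\<And>x. x \<in> P \<Longrightarrow> x \<in> conj_dom L g" "\<And>x. x \<in> P \<Longrightarrow> x \<up> g \<in> P"
  shows "mor P g P"
proof -
  have "P \<subseteq> Sg g"
  proof
    fix x assume "x \<in> P" then show "x \<in> Sg g" unfolding Sg_iff using assms(3,4) DeltaD(2)[OF P] by blast
  qed
  then have m: "mor P g (conj_set L P g)" using mor_restrict[OF g P] by blast
  have "conj_set L P g \<subseteq> P" using assms(4) by (auto simp: conj_set_def)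
  then have "conj_set L P g = P" using mor_card[OF m] finite_Delta[OF P] card_subset_eq by blast
  then show ?thesis using m by simp
qed

lemma mor_S_self:
  assumes P: "P \<in> \<Delta>" and s: "s \<in> S" and "\<And>x. x \<in> P \<Longrightarrow> x \<up> s \<in> P" shows "mor P s P"
  by (rule mor_into_self[OF P]) (use s S_simps(1) S_conj(1)[OF s] DeltaD(2)[OF P] assms(3) in blast)+

lemma grows_S:
  assumes P: "P \<in> \<Delta>" and Q: "pg_subgroup L Q" "Q \<subseteq> S" "P \<subseteq> Q" "P \<noteq> Q"
  obtains s where "s \<in> Q" "s \<notin> P" "mor P s P"
proof -
  obtain s where s: "s \<in> Q" "s \<notin> P" "\<And>x. x \<in> P \<Longrightarrow> x \<up> s \<in> P"
    using grows[OF p_subgroup_S[OF Q(1,2)] DeltaD(1)[OF P] Q(3,4)] by blast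
  then show ?thesis using that mor_S_self[OF P _ s(3)] Q(2) by blast
qed

text \<open>The normal subgroups of \<open>S\<close>; the case of interest is
  \<open>K \<inter> S\<close> for a partial normal \<open>K\<close>.\<close>

definition S_inv where "S_inv T \<longleftrightarrow> pg_subgroup L T \<and> T \<subseteq> S \<and> (\<forall>t\<in>T. \<forall>s\<in>S. t \<up> s \<in> T)"

lemma S_inv_normal: assumes "S_inv T" shows "T \<lhd> grp S"
proof -
  interpret S: group "grp S" by (rule group_grp[OF S_subgroup])
  have T: "pg_subgroup L T" "T \<subseteq> S" "\<And>t s. t \<in> T \<Longrightarrow> s \<in> S \<Longrightarrow> t \<up> s \<in> T" using assms by (auto simp: S_inv_def)
  have "x \<cdot> h \<cdot> x\<acute> \<in> T" if "x \<in> S" "h \<in> T" for x h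
  proof -
    have xS: "x\<acute> \<in> S" "h \<in> S" using that S_simps(3) T(2) by auto
    have "h \<up> x\<acute> = x \<cdot> (h \<cdot> x\<acute>)" using subgroup_conj(1)[OF S_subgroup xS(2,1)] inv_inv that S_simps(1) by (metis subsetD)
    then show ?thesis using T(3)[OF that(2) xS(1)] subgroup_assoc[OF S_subgroup that(1) xS(2,1)] by simp
  qed
  then show ?thesis unfolding S.normal_inv_iff using subgroup_grp_iff[OF S_subgroup] T(1,2) grp_inv[OF S_subgroup] by simp
qed

text \<open>Used contrapositively: if all elements of \<open>T\<close> normalizing \<open>P\<close>
  already lie in \<open>P\<close>, then \<open>T \<subseteq> P\<close>. The element is inverted at
  the end because the group-theoretic lemma conjugates in the form
  \<open>g h g\<acute>\<close>.\<close>

lemma grows_normal_S: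
  assumes P: "P \<in> \<Delta>" and T: "S_inv T" "\<not> T \<subseteq> P"
  obtains t where "t \<in> T" "t \<notin> P" "mor P t P"
proof -
  interpret S: group "grp S" by (rule group_grp[OF S_subgroup])
  obtain n where n: "card S = p ^ n" using S_p_subgroup by (auto simp: pg_p_subgroup_def)
  have "\<exists>t\<in>T - P. \<forall>h\<in>P. t \<otimes>\<^bsub>grp S\<^esub> h \<otimes>\<^bsub>grp S\<^esub> inv\<^bsub>grp S\<^esub> t \<in> P"
    by (rule S.normalizer_grows_normal[OF _ prime_p _ _ S_inv_normal[OF T(1)] T(2)])
      (use n P DeltaD[OF P] finite_S subgroup_grp_iff[OF S_subgroup] in \<open>auto simp: order_def\<close>)
  moreover have TS: "T \<subseteq> S" "pg_subgroup L T" using T(1) by (auto simp: S_inv_def)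
  ultimately obtain g where g: "g \<in> T" "g \<notin> P" "\<And>x. x \<in> P \<Longrightarrow> g \<cdot> x \<cdot> g\<acute> \<in> P"
    using grp_inv[OF S_subgroup] by auto
  have gS: "g \<in> S" using g TS by blast
  have "mor P (g\<acute>) P" using mor_S_self[OF P S_simps(3)[OF gS]] grows_conv(2)[OF S_subgroup DeltaD(1,2)[OF P] gS g(2,3)] P by blast
  then show ?thesis using that subgroupD(3)[OF TS(2) g(1)] grows_conv(1)[OF S_subgroup DeltaD(1,2)[OF P] gS g(2,3)] P by blast
qed

text \<open>There is no domain condition here, so this is the usual product only when both factors
  lie in one subgroup of \<open>L\<close>.\<close>

definition elem_prod where "elem_prod P T = {a \<cdot> t | a t. a \<in> P \<and> t \<in> T}"

lemma elem_prod_subgroup: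
  assumes G: "pg_subgroup L G" "pg_subgroup L P" "P \<subseteq> G" "pg_subgroup L T" "T \<subseteq> G"
    and n: "\<And>a t. a \<in> P \<Longrightarrow> t \<in> T \<Longrightarrow> t \<up> a \<in> T"
  shows "pg_subgroup L (elem_prod P T)"
proof -
  have GG: "x \<in> P \<Longrightarrow> x \<in> G" "x \<in> T \<Longrightarrow> x \<in> G" for x using G by auto
  note as = subgroup_assoc[OF G(1)] and cl = subgroupD(3,4)[OF G(1)]
  have carr: "x \<in> G \<Longrightarrow> x \<in> carrier L" for x using subgroupD(1)[OF G(1)] by blast
  have sw: "t \<cdot> a = a \<cdot> t \<up> a" if "a \<in> P" "t \<in> T" for a t
    using conj_facts(5)[OF carr subgroup_conj(2)[OF G(1)]] GG that by simp
  show ?thesis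
  proof (rule subgroup_subset[OF G(1)])
    show "elem_prod P T \<subseteq> G" unfolding elem_prod_def using GG cl by auto
    show "\<epsilon> \<in> elem_prod P T" unfolding elem_prod_def using subgroupD(2)[OF G(2)] subgroupD(2)[OF G(4)] one_l[OF one_closed] by force
    fix x assume "x \<in> elem_prod P T" then obtain a t where x: "a \<in> P" "t \<in> T" "x = a \<cdot> t" by (auto simp: elem_prod_def)
    have d: "[a, t] \<in> pg_dom L" by (rule subgroupD(5)[OF G(1)]) (use x GG in simp)
    have i: "a\<acute> \<in> P" "t\<acute> \<in> T" using x subgroupD(3)[OF G(2)] subgroupD(3)[OF G(4)] by auto
    have "x\<acute> = t\<acute> \<cdot> a\<acute>" using inv_mul[OF d] x by simp
    then have "x\<acute> = a\<acute> \<cdot> t\<acute> \<up> a\<acute>" using sw[OF i] by simp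
    then show "x\<acute> \<in> elem_prod P T" using n i by (auto simp: elem_prod_def)
    fix y assume "y \<in> elem_prod P T" then obtain b u where y: "b \<in> P" "u \<in> T" "y = b \<cdot> u" by (auto simp: elem_prod_def)
    have "x \<cdot> y = a \<cdot> (t \<cdot> (b \<cdot> u))" unfolding x y using as x y GG cl by simp
    also have "t \<cdot> (b \<cdot> u) = t \<cdot> b \<cdot> u" using as x y GG cl by simp
    also have "\<dots> = b \<cdot> t \<up> b \<cdot> u" using sw[OF y(1) x(2)] by simp
    also have "\<dots> = b \<cdot> (t \<up> b \<cdot> u)" using as n[OF y(1) x(2)] x y GG by simp
    also have "a \<cdot> \<dots> = a \<cdot> b \<cdot> (t \<up> b \<cdot> u)" using as n[OF y(1) x(2)] x y GG cl by simp
    finally show "x \<cdot> y \<in> elem_prod P T" unfolding elem_prod_def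
      using subgroupD(4)[OF G(2) x(1) y(1)] subgroupD(4)[OF G(4) n[OF y(1) x(2)] y(2)] by blast
  qed
qed

lemma elem_prod_sup: assumes "pg_subgroup L P" "pg_subgroup L T" shows "P \<subseteq> elem_prod P T" "T \<subseteq> elem_prod P T"
proof -
  show "P \<subseteq> elem_prod P T"
  proof
    fix x assume "x \<in> P" then have "x = x \<cdot> \<epsilon>" using subgroupD(1)[OF assms(1)] one_r by force
    then show "x \<in> elem_prod P T" unfolding elem_prod_def using \<open>x \<in> P\<close> subgroupD(2)[OF assms(2)] by blast
  qed
  show "T \<subseteq> elem_prod P T"
  proof
    fix x assume "x \<in> T" then have "x = \<epsilon> \<cdot> x" using subgroupD(1)[OF assms(2)] one_l by force
    then show "x \<in> elem_prod P T" unfolding elem_prod_def using \<open>x \<in> T\<close> subgroupD(2)[OF assms(1)] by blast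
  qed
qed

lemma elem_prod_least: "pg_subgroup L U \<Longrightarrow> P \<subseteq> U \<Longrightarrow> T \<subseteq> U \<Longrightarrow> elem_prod P T \<subseteq> U"
  unfolding elem_prod_def using subgroupD(4) by blast

lemma elem_prod_Delta: assumes P: "P \<in> \<Delta>" and T: "S_inv T" shows "elem_prod P T \<in> \<Delta>"
proof -
  have T': "pg_subgroup L T" "T \<subseteq> S" "\<And>t s. t \<in> T \<Longrightarrow> s \<in> S \<Longrightarrow> t \<up> s \<in> T" using T by (auto simp: S_inv_def)
  have "pg_subgroup L (elem_prod P T)" by (rule elem_prod_subgroup[OF S_subgroup DeltaD(1,2) T'(1,2)]) (use P DeltaD(2)[OF P] T'(3) in blast)+
  then show ?thesis using Delta_up[OF P] elem_prod_sup[OF DeltaD(1)[OF P] T'(1)] elem_prod_least[OF S_subgroup DeltaD(2)[OF P] T'(2)] by blast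
qed

text \<open>Enlarges an object so that it contains \<open>T\<close> without losing a given
  normalizing element; the criterion for maximal elements accepts only objects containing
  \<open>K \<inter> S\<close>.\<close>

lemma elem_prod_normalized: assumes P: "mor P s P" and s: "s \<in> S" and T: "S_inv T" shows "mor (elem_prod P T) s (elem_prod P T)"
proof (rule mor_S_self[OF elem_prod_Delta[OF morD(1)[OF P] T] s])
  have T': "pg_subgroup L T" "T \<subseteq> S" "\<And>t s. t \<in> T \<Longrightarrow> s \<in> S \<Longrightarrow> t \<up> s \<in> T" using T by (auto simp: S_inv_def)
  fix x assume "x \<in> elem_prod P T" then obtain a t where x: "a \<in> P" "t \<in> T" "x = a \<cdot> t" by (auto simp: elem_prod_def)
  have "a \<in> S" "t \<in> S" using x DeltaD(2)[OF morD(1)[OF P]] T'(2) by auto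
  then have "x \<up> s = a \<up> s \<cdot> t \<up> s"
    using conj_mult(2)[of s a t] S_simps(1,3,5) s x(3) by (metis (no_types, lifting) empty_subsetI empty_set insert_subset list.simps(15) subsetD)
  then show "x \<up> s \<in> elem_prod P T" unfolding elem_prod_def using morD(5)[OF P x(1)] T'(3)[OF x(2) s] by blast
qed

section \<open>Partial normal subgroups and their intersections with S\<close>

lemma pnsD:
  assumes "partial_normal_subgroup L K"
  shows "K \<subseteq> carrier L" "\<epsilon> \<in> K" "x \<in> K \<Longrightarrow> x\<acute> \<in> K" "x \<in> K \<Longrightarrow> y \<in> K \<Longrightarrow> [x, y] \<in> pg_dom L \<Longrightarrow> x \<cdot> y \<in> K"
    "f \<in> carrier L \<Longrightarrow> x \<in> K \<Longrightarrow> x \<in> conj_dom L f \<Longrightarrow> x \<up> f \<in> K"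
    "x \<in> K \<Longrightarrow> mor P x P' \<Longrightarrow> mor P f Q \<Longrightarrow> mor P' f Q' \<Longrightarrow> x \<up> f \<in> K"
proof -
  have s: "partial_subgroup L K" and n: "\<forall>f \<in> carrier L. \<forall>x \<in> K \<inter> conj_dom L f. conj_elem L x f \<in> K"
    using assms by (auto simp: partial_normal_subgroup_def)
  have prod: "pg_prod L v \<in> K" if "v \<in> lists K" "v \<in> pg_dom L" for v using s that unfolding partial_subgroup_def by blast
  show "K \<subseteq> carrier L" "x \<in> K \<Longrightarrow> x\<acute> \<in> K" using s unfolding partial_subgroup_def by auto
  show "\<epsilon> \<in> K" "x \<in> K \<Longrightarrow> y \<in> K \<Longrightarrow> [x, y] \<in> pg_dom L \<Longrightarrow> x \<cdot> y \<in> K"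
    using prod[of "[]"] prod[of "[x, y]"] Nil_dom by auto
  show *: "f \<in> carrier L \<Longrightarrow> x \<in> K \<Longrightarrow> x \<in> conj_dom L f \<Longrightarrow> x \<up> f \<in> K" using n by blast
  show "x \<in> K \<Longrightarrow> mor P x P' \<Longrightarrow> mor P f Q \<Longrightarrow> mor P' f Q' \<Longrightarrow> x \<up> f \<in> K"
    using * mor_conj(1)[of P x P' f Q Q'] morD(3)[of P f Q] by blast
qed

lemma pns_carrier: "partial_normal_subgroup L (carrier L)"
  unfolding partial_normal_subgroup_def
proof
  show "partial_subgroup L (carrier L)"
    by (rule partial_subgroupI) (use one_closed inv_closed prod_closed in auto)
  show "\<forall>f\<in>carrier L. \<forall>x\<in>carrier L \<inter> conj_dom L f. x \<up> f \<in> carrier L" using conj_facts(8) by blast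
qed

lemma pns_Norm: assumes K: "partial_normal_subgroup L K" and P: "P \<in> \<Delta>" shows "pg_subgroup L (Norm P \<inter> K)"
proof (rule subgroup_subset[OF Norm_subgroup[OF P]])
  note N = subgroupD[OF Norm_subgroup[OF P]]
  show "x \<cdot> y \<in> Norm P \<inter> K" if "x \<in> Norm P \<inter> K" "y \<in> Norm P \<inter> K" for x y
    using that N(4)[of x y] N(5)[of "[x, y]"] pnsD(4)[OF K, of x y] by simp
qed (use pnsD(2,3)[OF K] subgroupD(2,3)[OF Norm_subgroup[OF P]] in auto)

lemma pns_Int_S: assumes K: "partial_normal_subgroup L K" shows "S_inv (K \<inter> S)"
  unfolding S_inv_def
proof (intro conjI ballI)
  show "pg_subgroup L (K \<inter> S)"
  proof (rule subgroup_subset[OF S_subgroup])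
    show "x \<cdot> y \<in> K \<inter> S" if "x \<in> K \<inter> S" "y \<in> K \<inter> S" for x y
      using that S_simps(4)[of x y] S_simps(5)[of "[x, y]"] pnsD(4)[OF K, of x y] by simp
  qed (use pnsD(2,3)[OF K] S_simps(2,3) in auto)
  show "t \<up> s \<in> K \<inter> S" if "t \<in> K \<inter> S" "s \<in> S" for t s
    using that pnsD(5)[OF K, of s t] S_conj[of s t] S_simps(1) by blast
qed simp

lemma pns_Int: assumes "partial_normal_subgroup L M" "partial_normal_subgroup L N"
  shows "partial_normal_subgroup L (M \<inter> N)"
  unfolding partial_normal_subgroup_def
proof
  show "partial_subgroup L (M \<inter> N)"
    by (rule partial_subgroupI) (use pnsD(1-4)[OF assms(1)] pnsD(1-4)[OF assms(2)] in blast)+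
  show "\<forall>f\<in>carrier L. \<forall>x\<in>M \<inter> N \<inter> conj_dom L f. x \<up> f \<in> M \<inter> N"
    using pnsD(5)[OF assms(1)] pnsD(5)[OF assms(2)] by blast
qed

lemma S_back: assumes "P \<in> \<Delta>" "s \<in> S" obtains Q where "mor Q s P"
proof -
  have "mor P (s\<acute>) (conj_set L P (s\<acute>))" using mor_S[OF assms(1) S_simps(3)[OF assms(2)]] .
  from mor_inv[OF this] show ?thesis using that inv_inv S_simps(1) assms(2) by (metis subsetD)
qed

lemma S_fwd: assumes "P \<in> \<Delta>" "s \<in> S" obtains Q where "mor P s Q"
  using mor_S[OF assms] by blast

text \<open>The commutator of \<open>s\<close> and \<open>k\<close> reads both as
  \<open>s\<acute> \<cdot> s \<up> k\<close> and as \<open>k\<acute> \<up> s \<cdot> k\<close>; the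
  second form puts it in \<open>K\<close>. The recorded path from \<open>Q\<close> through
  \<open>U\<close> back to \<open>Q\<close> keeps later products defined.\<close>

lemma commutator:
  assumes K: "partial_normal_subgroup L K" and s: "s \<in> S" "mor P s P" and k: "k \<in> K" "mor P k Q"
  obtains k' U where "k' \<in> K" "s \<up> k = s \<cdot> k'" "mor Q s U" "mor U k' Q" "k' = s\<acute> \<cdot> s \<up> k"
proof -
  obtain U where U: "mor Q s U" using S_fwd[OF morD(2)[OF k(2)] s(1)] .
  have ki: "mor Q (k\<acute>) P" using mor_inv[OF k(2)] .
  note c = mor_conj[OF ki U s(2)]
  have c1: "k\<acute> \<up> s \<in> K" using pnsD(6)[OF K pnsD(3)[OF K k(1)] ki U s(2)] .
  have c2: "mor U (k\<acute> \<up> s \<cdot> k) Q" "[k\<acute> \<up> s, k] \<in> pg_dom L" using mor_comp[OF c(2) k(2)] by auto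
  have c3: "k\<acute> \<up> s \<cdot> k \<in> K" using pnsD(4)[OF K c1 k(1) c2(2)] .
  have "k\<acute> \<up> s \<cdot> k = s\<acute> \<cdot> (k\<acute> \<cdot> s) \<cdot> k" using c(3) by simp
  also have "\<dots> = s\<acute> \<cdot> (k\<acute> \<cdot> s \<cdot> k)" by (rule mor_assoc[OF mor_inv[OF U] mor_comp(1)[OF ki s(2)] k(2)])
  also have "k\<acute> \<cdot> s \<cdot> k = k\<acute> \<cdot> (s \<cdot> k)" by (rule mor_assoc[OF ki s(2) k(2)])
  also have "\<dots> = s \<up> k" using mor_conj(3)[OF s(2) k(2) k(2)] by simp
  finally have e: "k\<acute> \<up> s \<cdot> k = s\<acute> \<cdot> s \<up> k" .
  have "mor Q (s \<up> k) Q" using mor_conj(2)[OF s(2) k(2) k(2)] .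
  then have "[s\<acute>, s \<up> k] \<in> pg_dom L" using mor_comp(2)[OF mor_inv[OF U]] by blast
  from cancel_l(1)[OF this] have "s \<cdot> (s\<acute> \<cdot> s \<up> k) = s \<up> k" using inv_inv S_simps(1) s(1) by (metis subsetD)
  then show ?thesis using that[OF c3 _ U c2(1)] e by simp
qed

text \<open>An element \<open>a \<up> k\<close> of the image is \<open>a\<close> times a commutator
  that lies in \<open>K\<close> and in \<open>S\<close>. So elements of \<open>K\<close> move an
  object only inside the subgroup it generates together with \<open>K \<inter> S\<close>.\<close>

lemma conj_subset_overgroup:
  assumes K: "partial_normal_subgroup L K" and k: "k \<in> K" "mor P k Q"
    and U: "pg_subgroup L U" "P \<subseteq> U" "K \<inter> S \<subseteq> U"
  shows "Q \<subseteq> U"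
proof
  fix x assume "x \<in> Q"
  then obtain a where a: "a \<in> P" "x = a \<up> k" using morD(6)[OF k(2)] by blast
  have aS: "a \<in> S" using a DeltaD(2)[OF morD(1)[OF k(2)]] by blast
  obtain k' where k': "k' \<in> K" "a \<up> k = a \<cdot> k'" "k' = a\<acute> \<cdot> a \<up> k"
    using commutator[OF K aS mor_self[OF morD(1)[OF k(2)] a(1)] k] by metis
  have "a \<up> k \<in> S" using \<open>x \<in> Q\<close> a(2) DeltaD(2)[OF morD(2)[OF k(2)]] by blast
  then have "k' \<in> S" using k'(3) S_simps(4)[OF S_simps(3)[OF aS]] by simp
  then show "x \<in> U" using a k'(1,2) U subgroupD(4)[OF U(1)] by auto
qed

text \<open>The induction starts at objects containing \<open>K \<inter> S\<close>. It is run first with \<open>K\<close> the whole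
  carrier, which then supplies the start for arbitrary \<open>K\<close>.\<close>

definition S_controlled where
  "S_controlled K \<longleftrightarrow> (\<forall>Q\<in>\<Delta>. \<forall>X. p_subgroup X \<longrightarrow> X \<subseteq> Norm Q \<inter> K \<longrightarrow>
     (\<exists>y\<in>K. (\<exists>R. mor Q y R) \<and> (\<forall>x\<in>X. x \<up> y \<in> S)))"

text \<open>Downward induction on the size of \<open>Q\<close>. Replace \<open>Q\<close> by a
  conjugate \<open>R\<close> under \<open>K\<close> for which \<open>V\<close>, its normalizer in
  \<open>K \<inter> S\<close>, is as large as possible, and show that \<open>V\<close> is a maximal
  p-subgroup of \<open>Norm R \<inter> K\<close>; Sylow conjugacy in that group then moves the image
  of \<open>X\<close> into \<open>V\<close>.\<close>

lemma S_controlledI: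
  assumes K: "partial_normal_subgroup L K"
    and base: "\<And>Q Y. Q \<in> \<Delta> \<Longrightarrow> K \<inter> S \<subseteq> Q \<Longrightarrow> p_subgroup Y \<Longrightarrow> K \<inter> S \<subseteq> Y \<Longrightarrow> Y \<subseteq> Norm Q \<inter> K \<Longrightarrow> Y \<subseteq> S"
  shows "S_controlled K"
proof -
  let ?T = "K \<inter> S"
  have T: "S_inv ?T" by (rule pns_Int_S[OF K])
  have Tsub: "pg_subgroup L ?T" using T by (simp add: S_inv_def)
  have "\<exists>y\<in>K. (\<exists>R. mor Q y R) \<and> (\<forall>x\<in>X. x \<up> y \<in> S)"
    if "Q \<in> \<Delta>" "p_subgroup X" "X \<subseteq> Norm Q \<inter> K" for Q X
    using that
  proof (induction "card S - card Q" arbitrary: Q X rule: less_induct)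
    case less
    note Q = less.prems(1) and X = less.prems(2,3)
    let ?cand = "\<lambda>y. y \<in> K \<and> (\<exists>R. mor Q y R)"
    let ?val = "\<lambda>y. card (Norm (conj_set L Q y) \<inter> ?T)"
    have "\<exists>y. ?cand y \<and> (\<forall>z. ?cand z \<longrightarrow> ?val z \<le> ?val y)"
    proof (rule ex_has_greatest_nat[of ?cand \<epsilon> ?val "Suc (card S)"])
      show "?cand \<epsilon>" using pnsD(2)[OF K] mor_one[OF Q] by blast
      show "\<forall>y. ?cand y \<longrightarrow> ?val y < Suc (card S)"
        by (auto simp: less_Suc_eq_le intro!: card_mono[OF finite_S])
    qed
    then obtain y R where y: "y \<in> K" "mor Q y R" and max: "\<And>z. ?cand z \<Longrightarrow> ?val z \<le> ?val y" by blast
    have R: "R = conj_set L Q y" using y(2) by (simp add: mor_def)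
    have RD: "R \<in> \<Delta>" using morD(2)[OF y(2)] .
    define V where "V = Norm R \<inter> ?T"
    have VG: "pg_subgroup L V" unfolding V_def by (rule subgroup_Int[OF Norm_subgroup[OF RD] Tsub])
    have VS: "V \<subseteq> S" unfolding V_def by blast
    let ?G = "Norm R \<inter> K"
    have G: "pg_subgroup L ?G" by (rule pns_Norm[OF K RD])
    obtain Y where Y: "max_p_subgroup Y ?G" "V \<subseteq> Y"
      using max_p_subgroup_exists[OF G p_subgroup_S[OF VG VS]] unfolding V_def by blast
    have Yp: "p_subgroup Y" "Y \<subseteq> Norm R" "Y \<subseteq> K" using Y(1) by (auto simp: max_p_subgroup_def)
    have YV: "Y = V"
    proof (rule ccontr)
      assume "Y \<noteq> V"
      then obtain u where u: "u \<in> Y" "u \<notin> V" "\<And>x. x \<in> V \<Longrightarrow> x \<up> u \<in> V"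
        using grows[OF Yp(1) VG Y(2)] by blast
      show False
      proof (cases "V \<subseteq> R")
        case True
        have "?T \<subseteq> R"
        proof (rule ccontr)
          assume "\<not> ?T \<subseteq> R"
          then obtain t where "t \<in> ?T" "t \<notin> R" "mor R t R" using grows_normal_S[OF RD T] by blast
          then show False using True by (auto simp: V_def Norm_def)
        qed
        moreover have "?T \<subseteq> V" unfolding V_def using \<open>?T \<subseteq> R\<close> Delta_Norm[OF RD] by blast
        ultimately have "Y \<subseteq> S" using base[OF RD _ Yp(1)] Y(2) Yp by blast
        then have "Y \<subseteq> V" using Yp by (auto simp: V_def)
        then show False using u by blast
      next
        case False
        have VN: "V \<subseteq> Norm R" by (auto simp: V_def)
        define E where "E = elem_prod R V"
        \<comment> \<open>Only in the order \<open>V\<close>, \<open>R\<close> is the second factor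
          normalized by the first, as \<open>elem_prod_subgroup\<close> requires.\<close>
        have RV: "elem_prod V R = E"
        proof -
          note N = Norm_subgroup[OF RD]
          have RN: "x \<in> Norm R" if "x \<in> R" for x using that Delta_Norm[OF RD] by blast
          have c: "x \<in> carrier L" if "x \<in> Norm R" for x using that subgroupD(1)[OF N] by blast
          have 1: "v \<cdot> r = r \<up> v\<acute> \<cdot> v \<and> r \<up> v\<acute> \<in> R" if v: "v \<in> V" and r: "r \<in> R" for v r
          proof -
            have vN: "v \<in> Norm R" "v\<acute> \<in> Norm R" using v VN subgroupD(3)[OF N] by auto
            have "r \<up> v\<acute> = v \<cdot> (r \<cdot> v\<acute>)" using subgroup_conj(1)[OF N RN[OF r] vN(2)] inv_inv[OF c[OF vN(1)]] by simp
            then have "r \<up> v\<acute> \<cdot> v = v \<cdot> (r \<cdot> v\<acute> \<cdot> v)"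
              using subgroup_assoc[OF N] vN RN[OF r] subgroupD(4)[OF N] by simp
            also have "r \<cdot> v\<acute> \<cdot> v = r" using subgroup_assoc[OF N RN[OF r] vN(2,1)] inv_l[OF c[OF vN(1)]] one_r c[OF RN[OF r]] by simp
            finally have "v \<cdot> r = r \<up> v\<acute> \<cdot> v" by simp
            moreover have "mor R (v\<acute>) R" using vN by (simp add: Norm_def)
            ultimately show ?thesis using morD(5) r by blast
          qed
          have 2: "r \<cdot> v = v \<cdot> r \<up> v \<and> r \<up> v \<in> R" if v: "v \<in> V" and r: "r \<in> R" for v r
          proof -
            have vN: "v \<in> Norm R" using v VN by auto
            then have m: "mor R v R" by (simp add: Norm_def)
            show ?thesis using conj_facts(5)[OF c[OF vN] morD(4)[OF m r]] morD(5)[OF m r] by simp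
          qed
          show ?thesis unfolding E_def elem_prod_def using 1 2 by blast
        qed
        have ES: "pg_subgroup L E" unfolding RV[symmetric]
          by (rule elem_prod_subgroup[OF Norm_subgroup[OF RD] VG VN DeltaD(1)[OF RD] Delta_Norm[OF RD]])
            (use VN morD(5) in \<open>auto simp: Norm_def\<close>)
        have RE: "R \<subseteq> E" "V \<subseteq> E" unfolding E_def using elem_prod_sup[OF DeltaD(1)[OF RD] VG] by auto
        have E_S: "E \<subseteq> S" unfolding E_def using elem_prod_least[OF S_subgroup DeltaD(2)[OF RD] VS] .
        have ED: "E \<in> \<Delta>" using Delta_up[OF RD ES RE(1) E_S] .
        have EN: "E \<subseteq> Norm R" unfolding E_def using elem_prod_least[OF Norm_subgroup[OF RD] Delta_Norm[OF RD] VN] .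
        have uN: "u \<in> Norm R" using u(1) Yp(2) by blast
        then have um: "mor R u R" by (simp add: Norm_def)
        have uE: "mor E u E"
        proof (rule mor_into_self[OF ED morD(3)[OF um]])
          fix x assume x: "x \<in> E"
          then show "x \<in> conj_dom L u" using Norm_conj(1)[OF _ um] EN by blast
          obtain r v where rv: "r \<in> R" "v \<in> V" "x = r \<cdot> v" using x unfolding E_def elem_prod_def by blast
          have "x \<up> u = r \<up> u \<cdot> v \<up> u" unfolding rv(3)
            by (rule Norm_conj_mult[OF _ _ um]) (use rv Delta_Norm[OF RD] VN in auto)
          then show "x \<up> u \<in> E" unfolding E_def elem_prod_def using morD(5)[OF um rv(1)] u(3)[OF rv(2)] by blast
        qed
        \<comment> \<open>\<open>Z\<close> contains \<open>V\<close> and \<open>u\<close>, so it is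
          strictly larger than \<open>V\<close>; it normalizes the larger object \<open>E\<close>,
          so the induction hypothesis covers it.\<close>
        define Z where "Z = Y \<inter> Norm E"
        have Zs: "pg_subgroup L Z" unfolding Z_def by (rule subgroup_Int[OF p_subgroupD[OF Yp(1)] Norm_subgroup[OF ED]])
        have Zp: "p_subgroup Z" by (rule p_subgroup_subset[OF Yp(1) Zs]) (simp add: Z_def)
        have ZK: "Z \<subseteq> Norm E \<inter> K" using Yp(3) by (auto simp: Z_def)
        have "insert u V \<subseteq> Z" unfolding Z_def using u(1) uE Y(2) RE(2) Delta_Norm[OF ED] by (auto simp: Norm_def)
        then have "card (insert u V) \<le> card Z" using finite_subgroup[OF Zs] card_mono by blast
        then have cZ: "card V < card Z" using u(2) finite_subgroup[OF VG] by simp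
        have "R \<noteq> E" using False RE(2) by blast
        then have "card R < card E" using RE(1) finite_Delta[OF ED] by (simp add: psubset_card_mono psubset_eq)
        moreover have "card E \<le> card S" using E_S finite_S card_mono by blast
        ultimately have "card S - card E < card S - card Q" using mor_card[OF y(2)] by simp
        from less.hyps[OF this ED Zp ZK] obtain y' R' where y': "y' \<in> K" "mor E y' R'" "\<And>z. z \<in> Z \<Longrightarrow> z \<up> y' \<in> S" by blast
        obtain R2 where R2: "mor R y' R2" using mor_sub[OF y'(2) RD RE(1)] by blast
        have ZR: "Z \<subseteq> Norm R" using Yp(2) by (auto simp: Z_def)
        have "(\<lambda>z. z \<up> y') ` Z \<subseteq> Norm R2 \<inter> ?T"
        proof
          fix x assume "x \<in> (\<lambda>z. z \<up> y') ` Z"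
          then obtain z where z: "z \<in> Z" "x = z \<up> y'" by blast
          have zN: "z \<in> Norm R" using z ZR by blast
          have "z \<up> y' \<in> K" using pnsD(5)[OF K morD(3)[OF R2] _ Norm_conj(1)[OF zN R2]] z ZK by blast
          then show "x \<in> Norm R2 \<inter> ?T" using z y'(3)[OF z(1)] Norm_conj(2)[OF zN R2] by simp
        qed
        then have "card ((\<lambda>z. z \<up> y') ` Z) \<le> card (Norm R2 \<inter> ?T)" using finite_S by (intro card_mono) auto
        then have 3: "card Z \<le> card (Norm R2 \<inter> ?T)" using Norm_conj_subgroup(3)[OF Zs ZR R2] by simp
        \<comment> \<open>As \<open>y'\<close> carries \<open>Z\<close> into the normalizer of
          \<open>R2\<close> in \<open>K \<inter> S\<close>, the element \<open>y \<cdot> y'\<close>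
          beats the choice of \<open>y\<close>.\<close>
        have m2: "mor Q (y \<cdot> y') R2" "[y, y'] \<in> pg_dom L" using mor_comp[OF y(2) R2] by auto
        have "?cand (y \<cdot> y')" using pnsD(4)[OF K y(1) y'(1) m2(2)] m2(1) by blast
        from max[OF this] have "card (Norm R2 \<inter> ?T) \<le> card V" using m2(1) R by (simp add: mor_def V_def)
        then show False using cZ 3 by simp
      qed
    qed
    have XN: "X \<subseteq> Norm Q" using X by blast
    have X1: "p_subgroup ((\<lambda>x. x \<up> y) ` X)" by (rule p_subgroup_conj[OF X(1) XN y(2)])
    have X2: "(\<lambda>x. x \<up> y) ` X \<subseteq> ?G"
    proof
      fix x assume "x \<in> (\<lambda>x. x \<up> y) ` X"
      then obtain z where z: "z \<in> X" "x = z \<up> y" by blast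
      then have zN: "z \<in> Norm Q" "z \<in> K" using X by auto
      show "x \<in> ?G" using Norm_conj(2)[OF zN(1) y(2)] pnsD(5)[OF K morD(3)[OF y(2)] zN(2) Norm_conj(1)[OF zN(1) y(2)]] z(2) by simp
    qed
    obtain g where g: "g \<in> ?G" "\<And>x. x \<in> (\<lambda>x. x \<up> y) ` X \<Longrightarrow> x \<up> g \<in> Y" using sylow_conj[OF G Y(1) X1 X2] by blast
    have gm: "mor R g R" using g(1) by (simp add: Norm_def)
    have m2: "mor Q (y \<cdot> g) R" "[y, g] \<in> pg_dom L" using mor_comp[OF y(2) gm] by auto
    have "x \<up> (y \<cdot> g) \<in> S" if "x \<in> X" for x
    proof -
      have "x \<in> Norm Q" using that XN by blast
      from Norm_conj_comp[OF this y(2) gm] show ?thesis using g(2)[of "x \<up> y"] that YV VS by auto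
    qed
    then show ?case using pnsD(4)[OF K y(1) _ m2(2)] g(1) m2(1) by blast
  qed
  then show ?thesis unfolding S_controlled_def by blast
qed

text \<open>Here \<open>K \<inter> S\<close> is \<open>S\<close>, and the base case is the
  maximality of \<open>S\<close> among the p-subgroups.\<close>

lemma carrier_controlled: "S_controlled (carrier L)"
proof (rule S_controlledI[OF pns_carrier])
  fix Q Y assume "p_subgroup Y" "carrier L \<inter> S \<subseteq> Y"
  then show "Y \<subseteq> S" using S_maximal[of Y] S_simps(1) by (simp add: inf.absorb2)
qed

text \<open>Some \<open>g\<close> defined on \<open>Q\<close> carries \<open>Y\<close> into
  \<open>K \<inter> S\<close>. Since \<open>K \<inter> S \<subseteq> Q\<close>, the same
  \<open>g\<close> maps \<open>K \<inter> S\<close> into itself, by counting onto itself, and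
  injectivity forces \<open>Y\<close> to lie in \<open>K \<inter> S\<close> from the start.\<close>

lemma p_subgroup_in_S:
  assumes K: "partial_normal_subgroup L K" and Q: "Q \<in> \<Delta>" "K \<inter> S \<subseteq> Q" and Y: "p_subgroup Y" "Y \<subseteq> Norm Q \<inter> K"
  shows "Y \<subseteq> S"
proof
  fix x assume x: "x \<in> Y"
  have "Y \<subseteq> Norm Q \<inter> carrier L" using Y(2) pnsD(1)[OF K] by blast
  then obtain g R where g: "mor Q g R" "\<And>x. x \<in> Y \<Longrightarrow> x \<up> g \<in> S"
    using carrier_controlled Q(1) Y(1) unfolding S_controlled_def by blast
  let ?T = "K \<inter> S"
  have TN: "?T \<subseteq> Norm Q" using Q Delta_Norm by blast
  have T: "pg_subgroup L ?T" using pns_Int_S[OF K] by (simp add: S_inv_def)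
  have inK: "z \<up> g \<in> K" if "z \<in> Norm Q" "z \<in> K" for z
    using pnsD(5)[OF K morD(3)[OF g(1)] that(2) Norm_conj(1)[OF that(1) g(1)]] .
  have "(\<lambda>x. x \<up> g) ` ?T \<subseteq> ?T"
  proof
    fix z assume "z \<in> (\<lambda>x. x \<up> g) ` ?T"
    then obtain t where t: "t \<in> ?T" "z = t \<up> g" by blast
    have "t \<up> g \<in> S" using morD(5)[OF g(1)] t(1) Q(2) DeltaD(2)[OF morD(2)[OF g(1)]] by blast
    then show "z \<in> ?T" using inK[of t] t TN by blast
  qed
  then have img: "(\<lambda>x. x \<up> g) ` ?T = ?T"
    using Norm_conj_subgroup(3)[OF T TN g(1)] finite_subgroup[OF T] card_subset_eq by metis
  have xN: "x \<in> Norm Q" "x \<in> K" using x Y(2) by auto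
  have "x \<up> g \<in> ?T" using g(2)[OF x] inK[OF xN] by blast
  then obtain t where t: "t \<in> ?T" "x \<up> g = t \<up> g" using img by (metis imageE)
  have "x = t" using Norm_conj_inv[OF xN(1) g(1)] Norm_conj_inv[OF _ g(1), of t] t TN by auto
  then show "x \<in> S" using t by blast
qed

lemma pns_controlled: assumes K: "partial_normal_subgroup L K" shows "S_controlled K"
  by (rule S_controlledI[OF K]) (rule p_subgroup_in_S[OF K])

text \<open>A larger p-subgroup \<open>Z\<close> contains, with \<open>s \<cdot> k\<close> and
  \<open>s\<close>, also the factor \<open>k\<close>; but p-subgroups of
  \<open>Norm Q \<inter> K\<close> lie in \<open>S\<close> because \<open>Q\<close> contains
  \<open>K \<inter> S\<close>.\<close>

lemma max_p_subgroup_NS: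
  assumes K: "partial_normal_subgroup L K" and Q: "Q \<in> \<Delta>" "K \<inter> S \<subseteq> Q"
  shows "pg_subgroup L (elem_prod (Norm Q \<inter> S) (Norm Q \<inter> K))" "max_p_subgroup (Norm Q \<inter> S) (elem_prod (Norm Q \<inter> S) (Norm Q \<inter> K))"
    "elem_prod (Norm Q \<inter> S) (Norm Q \<inter> K) \<subseteq> Norm Q"
proof -
  note N = Norm_subgroup[OF Q(1)]
  note NS = subgroup_Int[OF N S_subgroup] and NK = pns_Norm[OF K Q(1)]
  let ?G = "elem_prod (Norm Q \<inter> S) (Norm Q \<inter> K)"
  show G: "pg_subgroup L ?G"
  proof (rule elem_prod_subgroup[OF N NS _ NK])
    show "t \<up> a \<in> Norm Q \<inter> K" if "a \<in> Norm Q \<inter> S" "t \<in> Norm Q \<inter> K" for a t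
      using that subgroup_conj[OF N, of t a] pnsD(5)[OF K, of a t] subgroupD(1)[OF N] by blast
  qed auto
  show GN: "?G \<subseteq> Norm Q" using elem_prod_least[OF N] by simp
  show "max_p_subgroup (Norm Q \<inter> S) ?G"
    unfolding max_p_subgroup_def
  proof (intro conjI allI impI)
    show "p_subgroup (Norm Q \<inter> S)" using p_subgroup_S[OF NS] by simp
    show "Norm Q \<inter> S \<subseteq> ?G" using elem_prod_sup(1)[OF NS NK] .
    fix Z assume Z: "p_subgroup Z" "Norm Q \<inter> S \<subseteq> Z" "Z \<subseteq> ?G"
    have ZK: "Z \<inter> (Norm Q \<inter> K) \<subseteq> S"
      by (rule p_subgroup_in_S[OF K Q p_subgroup_subset[OF Z(1) subgroup_Int[OF p_subgroupD[OF Z(1)] NK]]]) auto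
    have "Z \<subseteq> Norm Q \<inter> S"
    proof
      fix z assume z: "z \<in> Z"
      then obtain s k where sk: "s \<in> Norm Q \<inter> S" "k \<in> Norm Q \<inter> K" "z = s \<cdot> k" using Z(3) by (auto simp: elem_prod_def)
      have d: "[s, k] \<in> pg_dom L" by (rule subgroupD(5)[OF N]) (use sk in simp)
      have "s\<acute> \<in> Z" using sk(1) Z(2) subgroupD(3)[OF NS] by blast
      then have "k \<in> Z" using subgroupD(4)[OF p_subgroupD[OF Z(1)] _ z] cancel_l(1)[OF d] sk(3) by force
      then have "k \<in> Norm Q \<inter> S" using ZK sk(2) by blast
      then show "z \<in> Norm Q \<inter> S" using sk subgroupD(4)[OF NS] by blast
    qed
    then show "Z = Norm Q \<inter> S" using Z(2) by blast
  qed
qed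

text \<open>Sylow conjugacy supplies \<open>g = s \<cdot> k0\<close>. Following it by
  \<open>s\<acute>\<close> does not leave \<open>S\<close>, and \<open>g \<cdot> s\<acute>\<close>
  is the conjugate \<open>k0 \<up> s\<acute>\<close>, an element of \<open>K\<close>.\<close>

lemma sylow_NSK:
  assumes K: "partial_normal_subgroup L K" and Q: "Q \<in> \<Delta>" "K \<inter> S \<subseteq> Q"
    and X: "p_subgroup X" "X \<subseteq> elem_prod (Norm Q \<inter> S) (Norm Q \<inter> K)"
  obtains k where "k \<in> K" "mor Q k Q" "\<And>x. x \<in> X \<Longrightarrow> x \<up> k \<in> S"
proof -
  note N = Norm_subgroup[OF Q(1)]
  note NS = subgroup_Int[OF N S_subgroup] and NK = pns_Norm[OF K Q(1)]
  let ?G = "elem_prod (Norm Q \<inter> S) (Norm Q \<inter> K)"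
  note G = max_p_subgroup_NS[OF K Q]
  obtain g where g: "g \<in> ?G" "\<And>x. x \<in> X \<Longrightarrow> x \<up> g \<in> Norm Q \<inter> S" using sylow_conj[OF G(1,2) X] by blast
  obtain s k0 where sk: "s \<in> Norm Q \<inter> S" "k0 \<in> Norm Q \<inter> K" "g = s \<cdot> k0" using g(1) by (auto simp: elem_prod_def)
  have ms: "mor Q s Q" "mor Q k0 Q" using sk by (auto simp: Norm_def)
  have msi: "mor Q (s\<acute>) Q" using mor_inv[OF ms(1)] .
  have mg: "mor Q g Q" using mor_comp(1)[OF ms] sk(3) by simp
  have sc: "s\<acute> \<in> carrier L" using morD(3)[OF msi] .
  let ?k = "k0 \<up> s\<acute>"
  have kK: "?k \<in> K" using pnsD(6)[OF K _ ms(2) msi msi] sk(2) by blast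
  have km: "mor Q ?k Q" using mor_conj(2)[OF ms(2) msi msi] .
  have "?k = s \<cdot> (k0 \<cdot> s\<acute>)" using mor_conj(3)[OF ms(2) msi msi] inv_inv[OF morD(3)[OF ms(1)]] by simp
  also have "\<dots> = g \<cdot> s\<acute>" using mor_assoc[OF ms msi] sk(3) by simp
  finally have kg: "?k = g \<cdot> s\<acute>" .
  have "x \<up> ?k \<in> S" if "x \<in> X" for x
  proof -
    have xN: "x \<in> Norm Q" using that X(2) G(3) by blast
    have "x \<up> ?k = x \<up> g \<up> s\<acute>" unfolding kg by (rule Norm_conj_comp[OF xN mg msi])
    then show ?thesis using S_conj(2)[of "s\<acute>" "x \<up> g"] g(2)[OF that] sk(1) S_simps(3) by simp
  qed
  then show ?thesis using that kK km by blast
qed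

lemma T_conj:
  assumes K: "partial_normal_subgroup L K" and Q: "K \<inter> S \<subseteq> Q" and g: "mor Q g R"
  shows "(\<lambda>x. x \<up> g) ` (K \<inter> S) = K \<inter> S" "K \<inter> S \<subseteq> R"
proof -
  let ?T = "K \<inter> S"
  have T: "pg_subgroup L ?T" using pns_Int_S[OF K] by (simp add: S_inv_def)
  have TN: "?T \<subseteq> Norm Q" using Q Delta_Norm[OF morD(1)[OF g]] by blast
  have R: "(\<lambda>x. x \<up> g) ` ?T \<subseteq> R" using morD(5)[OF g] Q by blast
  have "(\<lambda>x. x \<up> g) ` ?T \<subseteq> ?T"
  proof
    fix z assume z: "z \<in> (\<lambda>x. x \<up> g) ` ?T"
    then obtain t where t: "t \<in> ?T" "z = t \<up> g" by blast
    have "z \<in> S" using z R DeltaD(2)[OF morD(2)[OF g]] by blast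
    moreover have "t \<up> g \<in> K" using pnsD(5)[OF K morD(3)[OF g] _ morD(4)[OF g]] t Q by blast
    ultimately show "z \<in> ?T" using t by blast
  qed
  then show 1: "(\<lambda>x. x \<up> g) ` ?T = ?T"
    using Norm_conj_subgroup(3)[OF T TN g] finite_subgroup[OF T] by (metis card_subset_eq)
  show "?T \<subseteq> R" using R 1 by simp
qed

section \<open>Maximal elements of cosets\<close>

text \<open>Only those \<open>y\<close> are tested that are defined on the whole image
  \<open>Sg (f\<acute>)\<close> of \<open>Sg f\<close>; for them
  \<open>Sg f \<subseteq> Sg (f \<cdot> y)\<close> holds anyway, so the inclusion demanded amounts
  to equality.\<close>

definition coset_max where
  "coset_max K f \<longleftrightarrow> f \<in> carrier L \<and> (\<forall>y\<in>K. \<forall>R. mor (Sg (f\<acute>)) y R \<longrightarrow> Sg (f \<cdot> y) \<subseteq> Sg f)"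

text \<open>Among the \<open>y \<in> K\<close> defined on the image of \<open>Sg g\<close>, take one
  with \<open>Sg (g \<cdot> y)\<close> of largest size and put \<open>f = g \<cdot> y\<close>. A
  multiplier \<open>z\<close> competing at \<open>f\<close> yields the competitor
  \<open>y \<cdot> z\<close> at \<open>g\<close>. The \<open>y\<close> of the conclusion is the
  inverse of the chosen one.\<close>

lemma coset_max_exists:
  assumes K: "partial_normal_subgroup L K" and g: "g \<in> carrier L"
  obtains f y where "coset_max K f" "y \<in> K" "[f, y] \<in> pg_dom L" "g = f \<cdot> y" "Sg g \<subseteq> S_pair f y"
proof -
  let ?cand = "\<lambda>y. y \<in> K \<and> (\<exists>R. mor (Sg (g\<acute>)) y R)"
  let ?val = "\<lambda>y. card (Sg (g \<cdot> y))"
  have mg: "mor (Sg g) g (Sg (g\<acute>))" by (rule mor_Sg[OF g])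
  have "\<exists>y. ?cand y \<and> (\<forall>z. ?cand z \<longrightarrow> ?val z \<le> ?val y)"
  proof (rule ex_has_greatest_nat[of ?cand \<epsilon> ?val "Suc (card S)"])
    show "?cand \<epsilon>" using pnsD(2)[OF K] mor_one[OF morD(2)[OF mg]] by blast
    show "\<forall>y. ?cand y \<longrightarrow> ?val y < Suc (card S)"
      by (auto simp: less_Suc_eq_le intro!: card_mono[OF finite_S] subsetD[OF Sg_S])
  qed
  then obtain y R where y: "y \<in> K" "mor (Sg (g\<acute>)) y R" and max: "\<And>z. ?cand z \<Longrightarrow> ?val z \<le> ?val y" by blast
  let ?f = "g \<cdot> y"
  have mf: "mor (Sg g) ?f R" and d: "[g, y] \<in> pg_dom L" using mor_comp[OF mg y(2)] by auto
  have fc: "?f \<in> carrier L" using morD(3)[OF mf] .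
  have sub: "R \<subseteq> Sg (?f\<acute>)" using mor_sub_Sg[OF mor_inv[OF mf]] .
  have "coset_max K ?f"
    unfolding coset_max_def
  proof (intro conjI ballI allI impI)
    show "?f \<in> carrier L" by (rule fc)
    fix z R' assume z: "z \<in> K" "mor (Sg (?f\<acute>)) z R'"
    obtain R2 where R2: "mor R z R2" using mor_sub[OF z(2) morD(2)[OF mf] sub] .
    have m: "mor (Sg (g\<acute>)) (y \<cdot> z) R2" "[y, z] \<in> pg_dom L" using mor_comp[OF y(2) R2] by auto
    have "?f \<cdot> z = g \<cdot> (y \<cdot> z)" by (rule mor_assoc[OF mg y(2) R2])
    then have c: "card (Sg (?f \<cdot> z)) \<le> card (Sg ?f)" using max[of "y \<cdot> z"] pnsD(4)[OF K y(1) z(1) m(2)] m(1) by auto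
    have "Sg ?f \<subseteq> Sg (?f \<cdot> z)" using mor_sub_Sg[OF mor_comp(1)[OF mor_Sg[OF fc] z(2)]] .
    moreover have "finite (Sg (?f \<cdot> z))" using finite_subset[OF Sg_S finite_S] .
    ultimately show "Sg (?f \<cdot> z) \<subseteq> Sg ?f" using c card_seteq by blast
  qed
  moreover have "mor R (y\<acute>) (Sg (g\<acute>))" using mor_inv[OF y(2)] .
  then have "[?f, y\<acute>] \<in> pg_dom L" "Sg g \<subseteq> S_pair ?f (y\<acute>)" using mor_comp(2)[OF mf] S_pair_mor_iff[OF mf] by auto
  moreover have "g = ?f \<cdot> y\<acute>" using cancel_r(1)[OF d] by simp
  ultimately show ?thesis using that pnsD(3)[OF K y(1)] by blast
qed

text \<open>Otherwise some \<open>t\<close> in \<open>K \<inter> S\<close> outside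
  \<open>Sg f\<close> normalizes \<open>Sg f\<close>. By \<open>pns_controlled\<close> there is
  \<open>y \<in> K\<close> such that \<open>f \<cdot> y\<close> conjugates the whole normalizer of
  \<open>Sg f\<close> in \<open>K \<inter> S\<close>, and with it \<open>t\<close>, into
  \<open>S\<close>, against maximality.\<close>

lemma coset_max_T:
  assumes K: "partial_normal_subgroup L K" and f: "coset_max K f"
  shows "K \<inter> S \<subseteq> Sg f"
proof (rule ccontr)
  assume n: "\<not> K \<inter> S \<subseteq> Sg f"
  let ?R = "Sg f" and ?Q = "Sg (f\<acute>)" and ?T = "K \<inter> S"
  have fc: "f \<in> carrier L" using f by (simp add: coset_max_def)
  have m: "mor ?R f ?Q" by (rule mor_Sg[OF fc])
  have T: "S_inv ?T" "pg_subgroup L ?T" using pns_Int_S[OF K] by (simp_all add: S_inv_def)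
  let ?X = "Norm ?R \<inter> ?T"
  have X: "pg_subgroup L ?X" by (rule subgroup_Int[OF Norm_subgroup[OF morD(1)[OF m]] T(2)])
  have Xp: "p_subgroup ((\<lambda>x. x \<up> f) ` ?X)" by (rule p_subgroup_conj[OF p_subgroup_S[OF X] _ m]) auto
  have XK: "(\<lambda>x. x \<up> f) ` ?X \<subseteq> Norm ?Q \<inter> K"
    using Norm_conj(2)[OF _ m] pnsD(5)[OF K fc _ Norm_conj(1)[OF _ m]] by blast
  obtain y R where y: "y \<in> K" "mor ?Q y R" "\<And>x. x \<in> (\<lambda>x. x \<up> f) ` ?X \<Longrightarrow> x \<up> y \<in> S"
    using pns_controlled[OF K] morD(2)[OF m] Xp XK unfolding S_controlled_def by meson
  have sub: "Sg (f \<cdot> y) \<subseteq> ?R" using f y(1,2) unfolding coset_max_def by blast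
  obtain t where t: "t \<in> ?T" "t \<notin> ?R" "mor ?R t ?R" using grows_normal_S[OF morD(1)[OF m] T(1) n] .
  have tN: "t \<in> Norm ?R" using t(3) by (simp add: Norm_def)
  have "t \<up> (f \<cdot> y) = t \<up> f \<up> y" by (rule Norm_conj_comp[OF tN m y(2)])
  also have "\<dots> \<in> S" using y(3) tN t(1) by blast
  finally have "t \<in> Sg (f \<cdot> y)" using Norm_Sg[OF tN mor_comp(1)[OF m y(2)]] t(1) by blast
  then show False using sub t(2) by blast
qed

text \<open>Conjugating \<open>x\<close> by \<open>f\<close> needs \<open>f\<close> on the source of
  \<open>x\<close> as well as on its target. The source is the conjugate of the target by
  \<open>x\<acute> \<in> K\<close>, and \<open>Sg f\<close> contains the target and
  \<open>K \<inter> S\<close>, hence also the source.\<close>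

lemma swap_left:
  assumes K: "partial_normal_subgroup L K" and T: "K \<inter> S \<subseteq> Sg f" and x: "x \<in> K" "[x, f] \<in> pg_dom L"
  shows "x \<up> f \<in> K" "[f, x \<up> f] \<in> pg_dom L" "f \<cdot> x \<up> f = x \<cdot> f" "S_pair x f \<subseteq> S_pair f (x \<up> f)" "x \<in> conj_dom L f"
proof -
  have fc: "f \<in> carrier L" using dom_carrier[OF x(2)] by simp
  obtain P1 P2 where m: "mor (S_pair x f) x P1" "mor P1 f P2" using S_pair(2)[OF x(2)] by blast
  have "S_pair x f \<subseteq> Sg f" by (rule conj_subset_overgroup[OF K pnsD(3)[OF K x(1)] mor_inv[OF m(1)] Sg_subgroup[OF fc] mor_sub_Sg[OF m(2)] T])
  then obtain P3 where P3: "mor (S_pair x f) f P3" using mor_restrict[OF fc morD(1)[OF m(1)]] by blast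
  note c = mor_conj[OF m(1) P3 m(2)]
  show "x \<up> f \<in> K" by (rule pnsD(5)[OF K fc x(1) c(1)])
  show "[f, x \<up> f] \<in> pg_dom L" using mor_comp(2)[OF P3 c(2)] .
  show "f \<cdot> x \<up> f = x \<cdot> f" by (rule conj_facts(5)[OF fc c(1)])
  show "S_pair x f \<subseteq> S_pair f (x \<up> f)" by (rule S_pair_mor_iff[OF P3 c(2)])
  show "x \<in> conj_dom L f" by (rule c(1))
qed

lemma swap_right:
  assumes K: "partial_normal_subgroup L K" and T: "K \<inter> S \<subseteq> Sg f" and y: "y \<in> K" "[f, y] \<in> pg_dom L"
  obtains x where "x \<in> K" "[x, f] \<in> pg_dom L" "x \<cdot> f = f \<cdot> y" "S_pair f y \<subseteq> S_pair x f"
proof -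
  have fc: "f \<in> carrier L" using dom_carrier[OF y(2)] by simp
  note fi = inv_closed[OF fc]
  obtain P1 P2 where m: "mor (S_pair f y) f P1" "mor P1 y P2" using S_pair(2)[OF y(2)] by blast
  have "K \<inter> S \<subseteq> Sg (f\<acute>)" by (rule T_conj(2)[OF K T mor_Sg[OF fc]])
  then have "P2 \<subseteq> Sg (f\<acute>)" by (intro conj_subset_overgroup[OF K y(1) m(2) Sg_subgroup[OF fi] mor_sub_Sg[OF mor_inv[OF m(1)]]])
  then obtain P3 where P3: "mor P2 (f\<acute>) P3" using mor_restrict[OF fi morD(2)[OF m(2)]] by blast
  note c = mor_conj[OF m(2) mor_inv[OF m(1)] P3]
  have m3: "mor P3 f P2" using mor_inv[OF P3] inv_inv[OF fc] by simp
  show ?thesis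
  proof (rule that)
    show "y \<up> f\<acute> \<in> K" by (rule pnsD(5)[OF K fi y(1) c(1)])
    show "[y \<up> f\<acute>, f] \<in> pg_dom L" by (rule mor_comp(2)[OF c(2) m3])
    show "S_pair f y \<subseteq> S_pair (y \<up> f\<acute>) f" by (rule S_pair_mor_iff[OF c(2) m3])
    have "y \<up> f\<acute> = f \<cdot> (y \<cdot> f\<acute>)" using c(3) inv_inv[OF fc] by simp
    then have "y \<up> f\<acute> \<cdot> f = f \<cdot> (y \<cdot> f\<acute> \<cdot> f)" using mor_assoc[OF m(1) mor_comp(1)[OF m(2) P3] m3] by simp
    also have "y \<cdot> f\<acute> \<cdot> f = y" using cancel_r(1)[OF mor_comp(2)[OF m(2) P3]] inv_inv[OF fc] by simp
    finally show "y \<up> f\<acute> \<cdot> f = f \<cdot> y" .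
  qed
qed

text \<open>Stands for the statement that the image of \<open>x\<close> modulo \<open>K\<close> lies
  in the image of \<open>S\<close>.\<close>

definition in_SK where "in_SK K x \<longleftrightarrow> (\<exists>s\<in>S. \<exists>k\<in>K. [s, k] \<in> pg_dom L \<and> x = s \<cdot> k)"

text \<open>Splitting and the criterion below depend on each other; the common induction runs downwards over
  the size of the object \<open>P\<close>.\<close>

lemma splitting_step:
  assumes K: "partial_normal_subgroup L K" and T: "K \<inter> S \<subseteq> Sg f"
    and k: "k \<in> K" "[f, k] \<in> pg_dom L"
    and CA: "\<And>P t. P \<in> \<Delta> \<Longrightarrow> card (S_pair f k) \<le> card P \<Longrightarrow> K \<inter> S \<subseteq> P \<Longrightarrow> P \<subseteq> Sg f \<Longrightarrow> t \<in> S \<Longrightarrow> mor P t P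
      \<Longrightarrow> in_SK K (t \<up> f) \<Longrightarrow> t \<in> Sg f"
  shows "Sg (f \<cdot> k) \<subseteq> Sg f"
proof (rule ccontr)
  assume n: "\<not> Sg (f \<cdot> k) \<subseteq> Sg f"
  let ?P = "S_pair f k" and ?Q = "Sg (f \<cdot> k)" and ?T = "K \<inter> S"
  have fc: "f \<in> carrier L" "f \<cdot> k \<in> carrier L" using dom_carrier[OF k(2)] prod_closed[OF k(2)] by auto
  have P: "?P = Sg f \<inter> ?Q" by (rule S_pair_Int[OF k(2)])
  obtain P1 P2 where m: "mor ?P f P1" "mor P1 k P2" using S_pair(2)[OF k(2)] by blast
  obtain s where s: "s \<in> ?Q" "s \<notin> ?P" "mor ?P s ?P"
    using grows_S[OF morD(1)[OF m(1)] Sg_subgroup[OF fc(2)] Sg_S] P n by blast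
  have sS: "s \<in> S" using s(1) Sg_S by blast
  have T': "S_inv ?T" "pg_subgroup L ?T" using pns_Int_S[OF K] by (simp_all add: S_inv_def)
  note sup = elem_prod_sup[OF DeltaD(1)[OF morD(1)[OF m(1)]] T'(2)]
  have PTD: "elem_prod ?P ?T \<in> \<Delta>" by (rule elem_prod_Delta[OF morD(1)[OF m(1)] T'(1)])
  have sN: "s \<in> Norm ?P" using s(3) by (simp add: Norm_def)
  have fN: "s \<up> f \<in> Norm P1" by (rule Norm_conj(2)[OF sN m(1)])
  \<comment> \<open>Conjugation by \<open>k\<acute>\<close> takes \<open>?u \<in> S\<close> to
    \<open>s \<up> f\<close>, so the two differ only by a commutator, which lies in
    \<open>K\<close>.\<close>
  let ?u = "s \<up> (f \<cdot> k)"
  have u: "?u = s \<up> f \<up> k" by (rule Norm_conj_comp[OF sN m])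
  have uS: "?u \<in> S" using s(1) Sg_iff by blast
  have um: "mor P2 ?u P2" using Norm_conj(2)[OF fN m(2)] u by (simp add: Norm_def)
  have sf: "s \<up> f = ?u \<up> k\<acute>" using Norm_conj_inv[OF fN m(2)] u by simp
  obtain k' U where k': "k' \<in> K" "?u \<up> k\<acute> = ?u \<cdot> k'" "mor P1 ?u U" "mor U k' P1"
    using commutator[OF K uS um pnsD(3)[OF K k(1)] mor_inv[OF m(2)]] by metis
  have SK: "in_SK K (s \<up> f)" unfolding in_SK_def sf k'(2) using uS k'(1) mor_comp(2)[OF k'(3,4)] by blast
  \<comment> \<open>The hypothesis wants an object containing \<open>K \<inter> S\<close>, hence
    \<open>?P\<close> is enlarged by it; \<open>s\<close> still normalizes the result.\<close>
  have "s \<in> Sg f"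
  proof (rule CA[OF PTD _ sup(2) _ sS elem_prod_normalized[OF s(3) sS T'(1)] SK])
    show "card ?P \<le> card (elem_prod ?P ?T)" using sup(1) finite_Delta[OF PTD] card_mono by blast
    show "elem_prod ?P ?T \<subseteq> Sg f" using elem_prod_least[OF Sg_subgroup[OF fc(1)] _ T] P by blast
  qed
  then show False using s P by blast
qed

text \<open>Let \<open>Q\<close> be the image of \<open>P\<close>. The elements of
  \<open>Norm P \<inter> S\<close> whose images under \<open>f\<close> lie in the product of
  \<open>Norm Q \<inter> S\<close> and \<open>Norm Q \<inter> K\<close> are brought into
  \<open>S\<close> simultaneously by one further \<open>k \<in> K\<close>. So
  \<open>t \<in> Sg (f \<cdot> k)\<close>, and \<open>Sg (f \<cdot> k) \<subseteq> Sg f\<close>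
  remains.\<close>

lemma coset_max_criterion:
  assumes K: "partial_normal_subgroup L K" and f: "coset_max K f"
    and "P \<in> \<Delta>" "K \<inter> S \<subseteq> P" "P \<subseteq> Sg f" "t \<in> S" "mor P t P" "in_SK K (t \<up> f)"
  shows "t \<in> Sg f"
  using assms(3-)
proof (induction "card S - card P" arbitrary: P t rule: less_induct)
  case less
  note P = less.prems(1-3) and t = less.prems(4-6)
  let ?T = "K \<inter> S"
  have fc: "f \<in> carrier L" using f by (simp add: coset_max_def)
  obtain Q where m: "mor P f Q" using mor_restrict[OF fc P(1,3)] by blast
  note QD = morD(2)[OF m]
  have TQ: "?T \<subseteq> Q" by (rule T_conj(2)[OF K P(2) m])
  note NP = Norm_subgroup[OF P(1)] and NQ = Norm_subgroup[OF QD]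
  let ?G = "elem_prod (Norm Q \<inter> S) (Norm Q \<inter> K)"
  note G = max_p_subgroup_NS[OF K QD TQ]
  have NSG: "Norm Q \<inter> S \<subseteq> ?G" using G(2) by (simp add: max_p_subgroup_def)
  define A where "A = {t \<in> Norm P \<inter> S. t \<up> f \<in> ?G}"
  have A: "pg_subgroup L A" unfolding A_def
  proof (rule subgroup_subset[OF subgroup_Int[OF NP S_subgroup]])
    note X = subgroupD[OF subgroup_Int[OF NP S_subgroup]]
    show "\<epsilon> \<in> {t \<in> Norm P \<inter> S. t \<up> f \<in> ?G}" using X(2) conj_one_elem(2)[OF fc] subgroupD(2)[OF G(1)] by simp
    show "x\<acute> \<in> {t \<in> Norm P \<inter> S. t \<up> f \<in> ?G}" if "x \<in> {t \<in> Norm P \<inter> S. t \<up> f \<in> ?G}" for x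
      using that X(3)[of x] conj_inv(2)[OF fc Norm_conj(1)[OF _ m], of x] subgroupD(3)[OF G(1), of "x \<up> f"] by simp
    show "x \<cdot> y \<in> {t \<in> Norm P \<inter> S. t \<up> f \<in> ?G}"
      if "x \<in> {t \<in> Norm P \<inter> S. t \<up> f \<in> ?G}" "y \<in> {t \<in> Norm P \<inter> S. t \<up> f \<in> ?G}" for x y
      using that X(4)[of x y] Norm_conj_mult[OF _ _ m, of x y] subgroupD(4)[OF G(1), of "x \<up> f" "y \<up> f"] by simp
  qed auto
  have AN: "A \<subseteq> Norm P" "A \<subseteq> S" by (auto simp: A_def)
  have "(\<lambda>x. x \<up> f) ` A \<subseteq> ?G" by (auto simp: A_def)
  then obtain k where k: "k \<in> K" "mor Q k Q" "\<And>x. x \<in> (\<lambda>x. x \<up> f) ` A \<Longrightarrow> x \<up> k \<in> S"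
    using sylow_NSK[OF K QD TQ p_subgroup_conj[OF p_subgroup_S[OF A AN(2)] AN(1) m]] by blast
  have fk: "mor P (f \<cdot> k) Q" "[f, k] \<in> pg_dom L" using mor_comp[OF m k(2)] by auto
  have Afk: "A \<subseteq> Sg (f \<cdot> k)"
  proof
    fix x assume x: "x \<in> A"
    then have xN: "x \<in> Norm P" "x \<in> S" using AN by auto
    have "x \<up> (f \<cdot> k) = x \<up> f \<up> k" by (rule Norm_conj_comp[OF xN(1) m k(2)])
    then show "x \<in> Sg (f \<cdot> k)" using Norm_Sg[OF xN(1) fk(1)] xN(2) k(3) x by simp
  qed
  \<comment> \<open>\<open>s\<close> and \<open>k1\<close> are not known to normalize
    \<open>Q\<close>. But \<open>k1\<close> maps the conjugate \<open>U\<close> of \<open>Q\<close>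
    to \<open>Q\<close>, and \<open>U\<close> contains \<open>K \<inter> S\<close>, so
    \<open>Q \<subseteq> U\<close>; equal sizes give \<open>Q = U\<close>.\<close>
  have tA: "t \<in> A"
  proof -
    have tN: "t \<in> Norm P" using t(2) by (simp add: Norm_def)
    have tf: "mor Q (t \<up> f) Q" using Norm_conj(2)[OF tN m] by (simp add: Norm_def)
    obtain s k1 where sk: "s \<in> S" "k1 \<in> K" "[s, k1] \<in> pg_dom L" "t \<up> f = s \<cdot> k1" using t(3) by (auto simp: in_SK_def)
    obtain U where U: "mor Q s U" using S_fwd[OF QD sk(1)] .
    have "k1 = s\<acute> \<cdot> t \<up> f" using cancel_l(1)[OF sk(3)] sk(4) by simp
    then have k1: "mor U k1 Q" using mor_comp(1)[OF mor_inv[OF U] tf] by simp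
    have "Q \<subseteq> U" by (rule conj_subset_overgroup[OF K sk(2) k1 DeltaD(1)[OF morD(2)[OF U]] subset_refl T_conj(2)[OF K TQ U]])
    then have "Q = U" using mor_card[OF U] finite_Delta[OF morD(2)[OF U]] by (metis card_subset_eq)
    then have "s \<in> Norm Q \<inter> S" "k1 \<in> Norm Q \<inter> K" using U k1 sk by (auto simp: Norm_def)
    then have "t \<up> f \<in> ?G" using sk(4) by (auto simp: elem_prod_def)
    then show ?thesis using tN t(1) by (simp add: A_def)
  qed
  show ?case
  \<comment> \<open>If \<open>P\<close> is all of \<open>Sg f\<close>, maximality applies to
    \<open>k\<close> directly. Otherwise \<open>S_pair f k\<close> contains the normalizer of
    \<open>P\<close> in \<open>Sg f\<close>, which is larger than \<open>P\<close>, so the induction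
    hypothesis covers every object that \<open>splitting_step\<close> asks about.\<close>
  proof (cases "P = Sg f")
    case True
    then have "Q = Sg (f\<acute>)" using mor_unique[OF m] mor_Sg[OF fc] by blast
    then have "Sg (f \<cdot> k) \<subseteq> Sg f" using f k(1,2) unfolding coset_max_def by blast
    then show ?thesis using tA Afk by blast
  next
    case False
    obtain s where s: "s \<in> Sg f" "s \<notin> P" "mor P s P" using grows_S[OF P(1) Sg_subgroup[OF fc] Sg_S P(3) False] .
    let ?P2 = "Sg f \<inter> Norm P"
    have "?P2 \<subseteq> A"
    proof
      fix x assume x: "x \<in> ?P2"
      have "x \<up> f \<in> Norm Q \<inter> S" "x \<in> S" using x Norm_conj(2)[OF _ m] Sg_iff by blast+
      then show "x \<in> A" using NSG x by (auto simp: A_def)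
    qed
    then have P2: "?P2 \<subseteq> S_pair f k" using Afk S_pair_Int[OF fk(2)] by blast
    have "insert s P \<subseteq> ?P2" using P(3) s Delta_Norm[OF P(1)] by (auto simp: Norm_def)
    then have "card (insert s P) \<le> card (S_pair f k)"
      using card_mono[OF finite_Delta[OF S_pair(1)[OF fk(2)]]] P2 by (meson order_trans)
    then have c: "card P < card (S_pair f k)" using s(2) finite_Delta[OF P(1)] by simp
    have "Sg (f \<cdot> k) \<subseteq> Sg f"
    proof (rule splitting_step[OF K coset_max_T[OF K f] k(1) fk(2)])
      fix P' t' assume P': "P' \<in> \<Delta>" "card (S_pair f k) \<le> card P'" "K \<inter> S \<subseteq> P'" "P' \<subseteq> Sg f"
         "t' \<in> S" "mor P' t' P'" "in_SK K (t' \<up> f)"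
      have "card P' \<le> card S" using card_mono[OF finite_S DeltaD(2)[OF P'(1)]] .
      then have "card S - card P' < card S - card P" using c P'(2) by simp
      from less.hyps[OF this P'(1,3-7)] show "t' \<in> Sg f" .
    qed
    then show ?thesis using tA Afk by blast
  qed
qed

section \<open>Products of two partial normal subgroups\<close>

definition prod2 where "prod2 M N = {m \<cdot> n | m n. m \<in> M \<and> n \<in> N \<and> [m, n] \<in> pg_dom L}"

lemma prod2I: "m \<in> M \<Longrightarrow> n \<in> N \<Longrightarrow> [m, n] \<in> pg_dom L \<Longrightarrow> m \<cdot> n \<in> prod2 M N"
  by (auto simp: prod2_def)

lemma S_pair_mor:
  assumes ab: "[a, b] \<in> pg_dom L" and P: "P \<in> \<Delta>" "P \<subseteq> S_pair a b"
  obtains R U where "mor P a R" "mor R b U"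
proof -
  obtain R' U' where m: "mor (S_pair a b) a R'" "mor R' b U'" using S_pair(2)[OF ab] by blast
  obtain R where R: "mor P a R" "R \<subseteq> R'" using mor_sub[OF m(1) P] by blast
  obtain U where "mor R b U" using mor_sub[OF m(2) morD(2)[OF R(1)] R(2)] by blast
  then show ?thesis using that R(1) by blast
qed

text \<open>The criterion is applied with \<open>P = Sg f\<close> itself, since an element violating
  the inclusion may be taken to normalize \<open>Sg f\<close>.\<close>

lemma coset_max_Int_T:
  assumes M: "partial_normal_subgroup L M" and N: "partial_normal_subgroup L N"
    and f: "coset_max (M \<inter> N) f" "f \<in> N"
  shows "M \<inter> S \<subseteq> Sg f"
proof (rule ccontr)
  assume n: "\<not> M \<inter> S \<subseteq> Sg f"
  let ?P = "Sg f"
  have fc: "f \<in> carrier L" using f(1) by (simp add: coset_max_def)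
  note K = pns_Int[OF M N]
  have m: "mor ?P f (Sg (f\<acute>))" by (rule mor_Sg[OF fc])
  obtain t where t: "t \<in> M \<inter> S" "t \<notin> ?P" "mor ?P t ?P" using grows_normal_S[OF morD(1)[OF m] pns_Int_S[OF M] n] .
  have tM: "t \<in> M" "t \<in> S" using t by auto
  obtain k U where k: "k \<in> N" "t \<up> f = t \<cdot> k" "mor (Sg (f\<acute>)) t U" "mor U k (Sg (f\<acute>))" "k = t\<acute> \<cdot> t \<up> f"
    using commutator[OF N tM(2) t(3) f(2) m] .
  have "t \<up> f \<in> M" by (rule pnsD(6)[OF M tM(1) t(3) m m])
  moreover have "[t\<acute>, t \<up> f] \<in> pg_dom L" by (rule mor_comp(2)[OF mor_inv[OF k(3)] mor_conj(2)[OF t(3) m m]])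
  ultimately have "k \<in> M" using pnsD(4)[OF M pnsD(3)[OF M tM(1)]] k(5) by simp
  then have "in_SK (M \<inter> N) (t \<up> f)" unfolding in_SK_def using tM(2) k(1,2) mor_comp(2)[OF k(3,4)] by blast
  from coset_max_criterion[OF K f(1) morD(1)[OF m] coset_max_T[OF K f(1)] subset_refl tM(2) t(3) this]
  show False using t(2) by simp
qed

text \<open>Write \<open>n = f \<cdot> y\<close> with \<open>y \<in> M \<inter> N\<close>, move
  \<open>y\<close> to the left of \<open>f\<close>, absorb it into \<open>m\<close>, and move the
  new factor from \<open>M\<close> to the right of \<open>f\<close>. The first move rests on
  \<open>M \<inter> N \<inter> S \<subseteq> Sg f\<close>, the second on
  \<open>M \<inter> S \<subseteq> Sg f\<close>. That \<open>S_pair\<close> does not shrink is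
  recorded for the sake of maximal choices.\<close>

lemma product_rewrite:
  assumes M: "partial_normal_subgroup L M" and N: "partial_normal_subgroup L N"
    and mn: "m \<in> M" "n \<in> N" "[m, n] \<in> pg_dom L"
  obtains f m' where "f \<in> N" "coset_max (M \<inter> N) f" "m' \<in> M" "[f, m'] \<in> pg_dom L" "f \<cdot> m' = m \<cdot> n" "S_pair m n \<subseteq> S_pair f m'"
proof -
  note K = pns_Int[OF M N]
  have nc: "n \<in> carrier L" using pnsD(1)[OF N] mn(2) by blast
  obtain f y where f: "coset_max (M \<inter> N) f" "y \<in> M \<inter> N" "[f, y] \<in> pg_dom L" "n = f \<cdot> y" "Sg n \<subseteq> S_pair f y"
    using coset_max_exists[OF K nc] .
  have yN: "y \<in> N" using f(2) by blast
  have "n \<cdot> y\<acute> \<in> N" using pnsD(4)[OF N mn(2) pnsD(3)[OF N yN]] cancel_r(3)[OF f(3)] f(4) by simp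
  then have fN: "f \<in> N" using cancel_r(1)[OF f(3)] f(4) by simp
  obtain k where k: "k \<in> M \<inter> N" "[k, f] \<in> pg_dom L" "k \<cdot> f = f \<cdot> y" "S_pair f y \<subseteq> S_pair k f"
    using swap_right[OF K coset_max_T[OF K f(1)] f(2,3)] .
  obtain P1 P2 where P: "mor (S_pair m n) m P1" "mor P1 n P2" using S_pair(2)[OF mn(3)] by blast
  have "P1 \<subseteq> S_pair k f" using mor_sub_Sg[OF P(2)] f(5) k(4) by blast
  then obtain P3 P4 where P3: "mor P1 k P3" "mor P3 f P4" using S_pair_mor[OF k(2) morD(2)[OF P(1)]] by blast
  have mk: "mor (S_pair m n) (m \<cdot> k) P3" "[m, k] \<in> pg_dom L" using mor_comp[OF P(1) P3(1)] by auto
  have mkM: "m \<cdot> k \<in> M" using pnsD(4)[OF M mn(1) _ mk(2)] k(1) by blast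
  have mkf: "[m \<cdot> k, f] \<in> pg_dom L" by (rule mor_comp(2)[OF mk(1) P3(2)])
  note sw = swap_left[OF M coset_max_Int_T[OF M N f(1) fN] mkM mkf]
  have "m \<cdot> k \<cdot> f = m \<cdot> n" using mor_assoc[OF P(1) P3] k(3) f(4) by simp
  then have "f \<cdot> (m \<cdot> k) \<up> f = m \<cdot> n" using sw(3) by simp
  moreover have "S_pair m n \<subseteq> S_pair f ((m \<cdot> k) \<up> f)" using S_pair_mor_iff[OF mk(1) P3(2)] sw(4) by blast
  ultimately show ?thesis using that fN f(1) sw(1,2) by blast
qed

lemma prod2_sub: "partial_normal_subgroup L M \<Longrightarrow> partial_normal_subgroup L N \<Longrightarrow> prod2 M N \<subseteq> prod2 N M"
  unfolding prod2_def using product_rewrite by (smt (verit, ccfv_threshold) mem_Collect_eq subsetI)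

lemma prod2_commute:
  assumes "partial_normal_subgroup L M" "partial_normal_subgroup L N" shows "prod2 M N = prod2 N M"
  using prod2_sub[OF assms] prod2_sub[OF assms(2,1)] by blast

text \<open>Start with \<open>S_pair m n\<close> as large as possible and exchange the factors
  twice. The domains can only grow, so they all coincide; the second exchange ends with a maximal
  first factor \<open>f2 \<in> M\<close>, whose inclusion
  \<open>N \<inter> S \<subseteq> Sg f2\<close> is thereby transferred to \<open>f1\<close> within
  \<open>Sg g\<close>.\<close>

lemma maximal_factorization:
  assumes M: "partial_normal_subgroup L M" and N: "partial_normal_subgroup L N" and g: "g \<in> prod2 M N"
  obtains f m where "f \<in> N" "coset_max (M \<inter> N) f" "m \<in> M" "[f, m] \<in> pg_dom L" "g = f \<cdot> m" "N \<inter> S \<inter> Sg g \<subseteq> Sg f"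
proof -
  let ?cand = "\<lambda>(m, n). m \<in> M \<and> n \<in> N \<and> [m, n] \<in> pg_dom L \<and> g = m \<cdot> n"
  let ?val = "\<lambda>(m, n). card (S_pair m n)"
  obtain m0 n0 where c0: "?cand (m0, n0)" using g by (auto simp: prod2_def)
  have S2S: "card (S_pair a b) < Suc (card S)" for a b
    by (auto simp: less_Suc_eq_le S_pair_def intro!: card_mono[OF finite_S] subsetD[OF Sg_S])
  have "\<exists>x. ?cand x \<and> (\<forall>y. ?cand y \<longrightarrow> ?val y \<le> ?val x)"
    by (rule ex_has_greatest_nat[of ?cand "(m0, n0)" ?val "Suc (card S)"]) (use c0 S2S in auto)
  then obtain m n where mn: "m \<in> M" "n \<in> N" "[m, n] \<in> pg_dom L" "g = m \<cdot> n"
    and max: "\<And>m' n'. ?cand (m', n') \<Longrightarrow> card (S_pair m' n') \<le> card (S_pair m n)" by force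
  obtain f1 m1 where 1: "f1 \<in> N" "coset_max (M \<inter> N) f1" "m1 \<in> M" "[f1, m1] \<in> pg_dom L" "f1 \<cdot> m1 = m \<cdot> n" "S_pair m n \<subseteq> S_pair f1 m1"
    using product_rewrite[OF M N mn(1-3)] .
  obtain f2 n2 where 2: "f2 \<in> M" "coset_max (N \<inter> M) f2" "n2 \<in> N" "[f2, n2] \<in> pg_dom L" "f2 \<cdot> n2 = f1 \<cdot> m1" "S_pair f1 m1 \<subseteq> S_pair f2 n2"
    using product_rewrite[OF N M 1(1,3,4)] .
  have g1: "g = f1 \<cdot> m1" "g = f2 \<cdot> n2" using 1 2 mn by auto
  have "card (S_pair f2 n2) \<le> card (S_pair m n)" using max[of f2 n2] 2(1,3,4) g1(2) by simp
  then have "S_pair m n = S_pair f2 n2" using 1(6) 2(6) finite_Delta[OF S_pair(1)[OF 2(4)]] by (metis card_seteq order_trans)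
  then have e: "S_pair f1 m1 = S_pair f2 n2" using 1(6) 2(6) by blast
  have "N \<inter> S \<subseteq> Sg f2" by (rule coset_max_Int_T[OF N M 2(2,1)])
  then have "N \<inter> S \<inter> Sg g \<subseteq> S_pair f2 n2" using S_pair_Int[OF 2(4)] g1 by auto
  then have "N \<inter> S \<inter> Sg g \<subseteq> Sg f1" unfolding e[symmetric] by (auto simp: S_pair_def)
  then show ?thesis using that 1 g1 by blast
qed

section \<open>Elements of S in a product of two partial normal subgroups\<close>

lemma grp_pow: "x [^]\<^bsub>grp G\<^esub> (n::nat) = x [^]\<^bsub>grp H\<^esub> n"
  by (induction n) (simp_all add: nat_pow_def)

lemma p_element_p_subgroup:
  assumes G: "pg_subgroup L G" and t: "t \<in> G" "t [^]\<^bsub>grp G\<^esub> (p ^ b) = \<epsilon>"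
  obtains X where "p_subgroup X" "t \<in> X" "X \<subseteq> G"
proof -
  interpret G: group "grp G" by (rule group_grp[OF G])
  let ?X = "generate (grp G) {t}"
  have X: "subgroup ?X (grp G)" by (rule G.generate_is_subgroup) (use t in simp)
  have "G.ord t dvd p ^ b" using G.pow_eq_id[of t "p ^ b"] t by simp
  moreover have "card ?X = G.ord t" using G.generate_pow_card t(1) by simp
  ultimately have "\<exists>n. card ?X = p ^ n" using divides_primepow_nat[OF prime_p] by auto
  then have "p_subgroup ?X" "?X \<subseteq> G" using X subgroup_grp_iff[OF G] unfolding pg_p_subgroup_def by auto
  then show ?thesis using that generate.incl[of t "{t}" "grp G"] by blast
qed

text \<open>Here \<open>f\<close> and \<open>m\<close> normalize the object \<open>Sg f\<close>. Modulo \<open>N\<close> the element \<open>m\<close> agrees with the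
  \<open>p\<close>-element \<open>g\<close>, so some \<open>p\<close>-power of \<open>m\<close> lies in \<open>M \<inter> N\<close>, and the \<open>p\<close>-part of \<open>m\<close>
  lies in \<open>S\<close>.\<close>

lemma prod2_S:
  assumes M: "partial_normal_subgroup L M" and N: "partial_normal_subgroup L N" and g: "g \<in> prod2 M N" "g \<in> S"
  obtains b a where "b \<in> N \<inter> S" "a \<in> M \<inter> S" "g = b \<cdot> a"
proof -
  obtain f m where fm: "f \<in> N" "coset_max (M \<inter> N) f" "m \<in> M" "[f, m] \<in> pg_dom L" "g = f \<cdot> m" "N \<inter> S \<inter> Sg g \<subseteq> Sg f"
    using maximal_factorization[OF M N g(1)] .
  have "Sg g = S" using S_conj[OF g(2)] by (auto simp: Sg_iff)
  let ?P = "Sg f"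
  have fc: "f \<in> carrier L" using fm(2) by (simp add: coset_max_def)
  have TN: "N \<inter> S \<subseteq> ?P" using fm(6) \<open>Sg g = S\<close> by blast
  have TM: "M \<inter> S \<subseteq> ?P" by (rule coset_max_Int_T[OF M N fm(2,1)])
  note Psub = Sg_subgroup[OF fc] and PD = Sg_Delta[OF fc]
  have "S_pair f m = ?P" using S_pair_Int[OF fm(4)] fm(5) \<open>Sg g = S\<close> Sg_S by blast
  then obtain P1 P2 where P: "mor ?P f P1" "mor P1 m P2" using S_pair(2)[OF fm(4)] by auto
  \<comment> \<open>\<open>f \<in> N\<close> and \<open>m \<in> M\<close> keep an object inside any
    overgroup that contains \<open>N \<inter> S\<close> and \<open>M \<inter> S\<close>
    respectively; \<open>?P\<close> contains both, so both elements normalize it.\<close>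
  have "P1 \<subseteq> ?P" by (rule conj_subset_overgroup[OF N fm(1) P(1) Psub subset_refl TN])
  then have P1: "P1 = ?P" using mor_card[OF P(1)] finite_Delta[OF PD] by (metis card_subset_eq)
  have "P2 \<subseteq> ?P" by (rule conj_subset_overgroup[OF M fm(3) P(2) Psub _ TM]) (simp add: P1)
  then have P2: "P2 = ?P" using mor_card[OF P(2)] P1 finite_Delta[OF PD] by (metis card_subset_eq)
  note G = Norm_subgroup[OF PD]
  let ?G = "Norm ?P"
  have inG: "f \<in> ?G" "m \<in> ?G" "g \<in> ?G"
    using P P1 P2 subgroupD(4)[OF G, of f m] fm(5) by (auto simp: Norm_def)
  have as: "a \<cdot> b \<cdot> c = a \<cdot> (b \<cdot> c)" if "a \<in> ?G" "b \<in> ?G" "c \<in> ?G" for a b c using subgroup_assoc[OF G that] .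
  note cl = subgroupD(3,4)[OF G]
  have d: "[a, b] \<in> pg_dom L" if "a \<in> ?G" "b \<in> ?G" for a b using subgroupD(5)[OF G, of "[a, b]"] that by simp
  note NG = pns_Norm[OF N PD] and MG = pns_Norm[OF M PD]
  interpret G: group "grp ?G" by (rule group_grp[OF G])
  \<comment> \<open>With \<open>m = f\<acute> \<cdot> g\<close> and \<open>h\<close> the current
    power of \<open>g\<close>, the factor \<open>f\<acute>\<close> passes to the left of
    \<open>h\<close> as the conjugate \<open>h \<cdot> (f\<acute> \<cdot> h\<acute>)\<close>, which
    is again in \<open>N\<close>.\<close>
  have pow: "\<exists>n\<in>?G \<inter> N. m [^]\<^bsub>grp ?G\<^esub> i = n \<cdot> g [^]\<^bsub>grp ?G\<^esub> i" for i :: nat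
  proof (induction i)
    case 0
    then show ?case using subgroupD(2)[OF NG] one_l[OF one_closed] by force
  next
    case (Suc i)
    then obtain n where n: "n \<in> ?G \<inter> N" "m [^]\<^bsub>grp ?G\<^esub> i = n \<cdot> g [^]\<^bsub>grp ?G\<^esub> i" by blast
    let ?h = "g [^]\<^bsub>grp ?G\<^esub> i"
    have h: "?h \<in> ?G" using G.nat_pow_closed[of g i] inG by simp
    have hc: "?h \<in> carrier L" using h subgroupD(1)[OF G] by blast
    have fi: "f\<acute> \<in> ?G" "?h\<acute> \<in> ?G" using cl(1) inG h by auto
    have "f\<acute> \<up> ?h\<acute> = ?h \<cdot> (f\<acute> \<cdot> ?h\<acute>)" using subgroup_conj(1)[OF G fi] inv_inv[OF hc] by simp
    moreover have "f\<acute> \<up> ?h\<acute> \<in> N" using pnsD(5)[OF N _ pnsD(3)[OF N fm(1)] subgroup_conj(2)[OF G fi]] inv_closed[OF hc] by simp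
    ultimately have c: "?h \<cdot> (f\<acute> \<cdot> ?h\<acute>) \<in> ?G \<inter> N" using cl h fi by simp
    have m: "m = f\<acute> \<cdot> g" using cancel_l(1)[OF fm(4)] fm(5) by simp
    have h1: "?h\<acute> \<cdot> (?h \<cdot> g) = g" using cancel_l(1)[OF d[OF h inG(3)]] .
    have "m [^]\<^bsub>grp ?G\<^esub> Suc i = n \<cdot> ?h \<cdot> (f\<acute> \<cdot> g)" using n(2) m by simp
    also have "\<dots> = n \<cdot> (?h \<cdot> (f\<acute> \<cdot> g))" using as n(1) h inG fi cl by simp
    also have "f\<acute> \<cdot> g = f\<acute> \<cdot> ?h\<acute> \<cdot> (?h \<cdot> g)" using as[OF fi(1,2) cl(2)[OF h inG(3)]] h1 by simp
    also have "?h \<cdot> \<dots> = ?h \<cdot> (f\<acute> \<cdot> ?h\<acute>) \<cdot> (?h \<cdot> g)" using as[OF h cl(2)[OF fi] cl(2)[OF h inG(3)]] by simp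
    also have "n \<cdot> \<dots> = n \<cdot> (?h \<cdot> (f\<acute> \<cdot> ?h\<acute>)) \<cdot> (?h \<cdot> g)" using as[of n "?h \<cdot> (f\<acute> \<cdot> ?h\<acute>)" "?h \<cdot> g"] n(1) c cl h inG(3) by simp
    finally have "m [^]\<^bsub>grp ?G\<^esub> Suc i = n \<cdot> (?h \<cdot> (f\<acute> \<cdot> ?h\<acute>)) \<cdot> g [^]\<^bsub>grp ?G\<^esub> Suc i" by simp
    then show ?case using subgroupD(4)[OF NG n(1) c] by blast
  qed
  obtain e where e: "card S = p ^ e" using S_p_subgroup by (auto simp: pg_p_subgroup_def)
  interpret S: group "grp S" by (rule group_grp[OF S_subgroup])
  have "g [^]\<^bsub>grp S\<^esub> (p ^ e) = \<epsilon>" using S.pow_order_eq_1[of g] g(2) e by (simp add: order_def)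
  then have "g [^]\<^bsub>grp ?G\<^esub> (p ^ e) = \<epsilon>" using grp_pow by metis
  then have "m [^]\<^bsub>grp ?G\<^esub> (p ^ e) \<in> N" using pow[of "p ^ e"] one_r subgroupD(1)[OF NG] by force
  moreover have powM: "m [^]\<^bsub>grp ?G\<^esub> i \<in> ?G \<inter> M" for i :: nat
    using monoid.nat_pow_closed[OF group.is_monoid[OF group_grp[OF MG]], of m i] fm(3) inG(2) grp_pow[where x = m and G = "?G \<inter> M" and n = i and H = ?G] by simp
  ultimately have pK: "m [^]\<^bsub>grp ?G\<^esub> (p ^ e) \<in> ?G \<inter> (M \<inter> N)" by blast
  note K = pns_Norm[OF pns_Int[OF M N] PD]
  have "subgroup (?G \<inter> (M \<inter> N)) (grp ?G)" using subgroup_grp_iff[OF G] K by blast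
  from G.p_element_part[OF _ prime_p _ this pK] obtain k i b where
    k: "k \<in> ?G \<inter> (M \<inter> N)" "m = k \<cdot> m [^]\<^bsub>grp ?G\<^esub> (i::nat)" "(m [^]\<^bsub>grp ?G\<^esub> i) [^]\<^bsub>grp ?G\<^esub> (p ^ b) = \<epsilon>"
    using finite_subgroup[OF G] inG(2) by auto
  define t where "t = m [^]\<^bsub>grp ?G\<^esub> i"
  have tM: "t \<in> ?G \<inter> M" unfolding t_def by (rule powM)
  have "t [^]\<^bsub>grp (?G \<inter> M)\<^esub> (p ^ b) = \<epsilon>" using k(3) grp_pow unfolding t_def by metis
  then obtain X where X: "p_subgroup X" "t \<in> X" "X \<subseteq> ?G \<inter> M" using p_element_p_subgroup[OF MG tM] by blast
  have tS: "t \<in> S" using p_subgroup_in_S[OF M PD TM X(1,3)] X(2) by blast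
  \<comment> \<open>The part \<open>k \<in> M \<inter> N\<close> of \<open>m\<close> is shifted to
    the other factor: \<open>f \<cdot> k\<close> is in \<open>N\<close>, and it is in
    \<open>S\<close> because \<open>g\<close> and \<open>t\<close> are.\<close>
  have gt: "g = f \<cdot> k \<cdot> t" using as[of f k t] k(1,2) inG tM fm(5) unfolding t_def by simp
  have fkN: "f \<cdot> k \<in> ?G \<inter> N" using subgroupD(4)[OF NG, of f k] fm(1) inG(1) k(1) by blast
  have "f \<cdot> k = g \<cdot> t\<acute>" using cancel_r(1)[of "f \<cdot> k" t] d fkN tM gt by simp
  then have "f \<cdot> k \<in> S" using S_simps(4)[OF g(2) S_simps(3)[OF tS]] by simp
  then show ?thesis using that[of "f \<cdot> k" t] fkN tM tS gt by blast
qed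

text \<open>A counterexample \<open>s\<close> lies in \<open>Sg (f \<cdot> m)\<close> but not in
  \<open>Sg f\<close>, and normalizes \<open>?P\<close>. By the criterion it is enough that
  \<open>s \<up> f\<close> is an element of \<open>S\<close> times one of
  \<open>M \<inter> N\<close>, which results from comparing its two expressions
  \<open>s \<cdot> n'\<close> and \<open>?u \<cdot> m'\<close>.\<close>

lemma Sg_product:
  assumes M: "partial_normal_subgroup L M" and N: "partial_normal_subgroup L N"
    and f: "coset_max (M \<inter> N) f" "f \<in> N" and m: "m \<in> M" "[f, m] \<in> pg_dom L"
  shows "Sg (f \<cdot> m) = S_pair f m"
proof (rule ccontr)
  assume ne: "Sg (f \<cdot> m) \<noteq> S_pair f m"
  note K = pns_Int[OF M N]
  let ?P = "S_pair f m" and ?g = "f \<cdot> m"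
  have fc: "f \<in> carrier L" "?g \<in> carrier L" using dom_carrier[OF m(2)] prod_closed[OF m(2)] by auto
  have TM: "M \<inter> S \<subseteq> Sg f" by (rule coset_max_Int_T[OF M N f])
  have Pg: "?P = Sg f \<inter> Sg ?g" by (rule S_pair_Int[OF m(2)])
  obtain Q R where mo: "mor ?P f Q" "mor Q m R" using S_pair(2)[OF m(2)] by blast
  obtain s where s: "s \<in> Sg ?g" "s \<notin> ?P" "mor ?P s ?P"
    using grows_S[OF morD(1)[OF mo(1)] Sg_subgroup[OF fc(2)] Sg_S] Pg ne by blast
  have sS: "s \<in> S" using s(1) Sg_S by blast
  have sN: "s \<in> Norm ?P" using s(3) by (simp add: Norm_def)
  have fN: "s \<up> f \<in> Norm Q" by (rule Norm_conj(2)[OF sN mo(1)])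
  let ?u = "s \<up> ?g"
  have u: "?u = s \<up> f \<up> m" by (rule Norm_conj_comp[OF sN mo])
  have uS: "?u \<in> S" using s(1) Sg_iff by blast
  have um: "mor R ?u R" using Norm_conj(2)[OF fN mo(2)] u by (simp add: Norm_def)
  have sf: "s \<up> f = ?u \<up> m\<acute>" using Norm_conj_inv[OF fN mo(2)] u by simp
  obtain n' U where n': "n' \<in> N" "s \<up> f = s \<cdot> n'" "mor Q s U" "mor U n' Q"
    using commutator[OF N sS s(3) f(2) mo(1)] by metis
  obtain m' W where m': "m' \<in> M" "?u \<up> m\<acute> = ?u \<cdot> m'" "mor Q ?u W" "mor W m' Q"
    using commutator[OF M uS um pnsD(3)[OF M m(1)] mor_inv[OF mo(2)]] by metis
  have e: "s \<cdot> n' = ?u \<cdot> m'" using sf n'(2) m'(2) by simp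
  have w: "mor U (n' \<cdot> m'\<acute>) W" "[n', m'\<acute>] \<in> pg_dom L" using mor_comp[OF n'(4) mor_inv[OF m'(4)]] by auto
  have ws: "n' \<cdot> m'\<acute> = s\<acute> \<cdot> ?u"
  proof -
    have "n' = s\<acute> \<cdot> (?u \<cdot> m')" using cancel_l(1)[OF mor_comp(2)[OF n'(3,4)]] e by simp
    then have "n' \<cdot> m'\<acute> = s\<acute> \<cdot> (?u \<cdot> m' \<cdot> m'\<acute>)"
      using mor_assoc[OF mor_inv[OF n'(3)] mor_comp(1)[OF m'(3,4)] mor_inv[OF m'(4)]] by simp
    then show ?thesis using cancel_r(1)[OF mor_comp(2)[OF m'(3,4)]] by simp
  qed
  have wS: "n' \<cdot> m'\<acute> \<in> S" unfolding ws using S_simps(4)[OF S_simps(3)[OF sS] uS] .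
  have "n' \<cdot> m'\<acute> \<in> prod2 M N" using prod2I[OF n'(1) pnsD(3)[OF M m'(1)] w(2)] prod2_commute[OF M N] by simp
  then obtain b a where ba: "b \<in> N \<inter> S" "a \<in> M \<inter> S" "n' \<cdot> m'\<acute> = b \<cdot> a" using prod2_S[OF M N _ wS] by blast
  \<comment> \<open>Objects are pulled back along \<open>a\<close>, \<open>b\<close> and
    \<open>s\<close> in turn; this path justifies the regroupings of
    \<open>s \<cdot> (b \<cdot> (a \<cdot> m'))\<close>.\<close>
  obtain W1 where W1: "mor W1 a W" using S_back[OF morD(1)[OF m'(4)], of a] ba(2) by blast
  obtain W2 where W2: "mor W2 b W1" using S_back[OF morD(1)[OF W1], of b] ba(1) by blast
  obtain W3 where W3: "mor W3 s W2" using S_back[OF morD(1)[OF W2] sS] .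
  have k: "mor W1 (a \<cdot> m') Q" "[a, m'] \<in> pg_dom L" using mor_comp[OF W1 m'(4)] by auto
  have "n' \<cdot> m'\<acute> \<cdot> m' = n'" using cancel_r(1)[OF w(2)] inv_inv[of m'] pnsD(1)[OF M] m'(1) by auto
  then have n2: "n' = b \<cdot> (a \<cdot> m')" using mor_assoc[OF W2 W1 m'(4)] ba(3) by simp
  have dbk: "[b, a \<cdot> m'] \<in> pg_dom L" by (rule mor_comp(2)[OF W2 k(1)])
  have "a \<cdot> m' = b\<acute> \<cdot> n'" using cancel_l(1)[OF dbk] n2 by simp
  moreover have "b\<acute> \<cdot> n' \<in> N" using pnsD(4)[OF N pnsD(3)[OF N, of b] n'(1)] cancel_l(3)[OF dbk] ba(1) n2 by blast
  moreover have "a \<cdot> m' \<in> M" using pnsD(4)[OF M _ m'(1) k(2)] ba(2) by blast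
  ultimately have kK: "a \<cdot> m' \<in> M \<inter> N" by simp
  have "s \<up> f = s \<cdot> b \<cdot> (a \<cdot> m')" using mor_assoc[OF W3 W2 k(1)] n'(2) n2 by simp
  moreover have "[s \<cdot> b, a \<cdot> m'] \<in> pg_dom L" by (rule mor_comp(2)[OF mor_comp(1)[OF W3 W2] k(1)])
  moreover have "s \<cdot> b \<in> S" using S_simps(4)[OF sS] ba(1) by blast
  ultimately have SK: "in_SK (M \<inter> N) (s \<up> f)" unfolding in_SK_def using kK by blast
  have T: "S_inv (M \<inter> S)" "pg_subgroup L (M \<inter> S)" using pns_Int_S[OF M] by (simp_all add: S_inv_def)
  note sup = elem_prod_sup[OF DeltaD(1)[OF morD(1)[OF mo(1)]] T(2)]
  have "s \<in> Sg f"
  proof (rule coset_max_criterion[OF K f(1) elem_prod_Delta[OF morD(1)[OF mo(1)] T(1)] _ _ sS elem_prod_normalized[OF s(3) sS T(1)] SK])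
    show "M \<inter> N \<inter> S \<subseteq> elem_prod ?P (M \<inter> S)" using sup(2) by blast
    show "elem_prod ?P (M \<inter> S) \<subseteq> Sg f" using elem_prod_least[OF Sg_subgroup[OF fc(1)] _ TM] Pg by blast
  qed
  then show False using s Pg by blast
qed

section \<open>Closure of the product of two under products and conjugation\<close>

lemma prod2_factorization:
  assumes M: "partial_normal_subgroup L M" and N: "partial_normal_subgroup L N" and g: "g \<in> prod2 M N"
  obtains m n where "m \<in> M" "n \<in> N" "[m, n] \<in> pg_dom L" "g = m \<cdot> n" "Sg g = S_pair m n"
proof -
  have "g \<in> prod2 N M" using g prod2_commute[OF M N] by simp
  then obtain n0 m0 where 0: "n0 \<in> N" "m0 \<in> M" "[n0, m0] \<in> pg_dom L" "g = n0 \<cdot> m0" by (auto simp: prod2_def)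
  obtain f n where f: "f \<in> M" "coset_max (N \<inter> M) f" "n \<in> N" "[f, n] \<in> pg_dom L" "f \<cdot> n = n0 \<cdot> m0"
    using product_rewrite[OF N M 0(1-3)] by metis
  then show ?thesis using that Sg_product[OF N M f(2,1,3,4)] 0(4) by metis
qed

text \<open>Regroup \<open>m1 n1 m2 n2\<close> by rewriting \<open>n1 \<cdot> m2\<close> as
  \<open>m3 \<cdot> n3\<close>. Each of the three factorizations has full domain, so the path of
  \<open>[g, h]\<close> refines through the factors, and \<open>mor_unique\<close> shows that the
  refined pieces end at the right objects.\<close>

lemma prod2_mult:
  assumes M: "partial_normal_subgroup L M" and N: "partial_normal_subgroup L N"
    and g: "g \<in> prod2 M N" and h: "h \<in> prod2 M N" and d: "[g, h] \<in> pg_dom L"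
  shows "g \<cdot> h \<in> prod2 M N"
proof -
  obtain m1 n1 where 1: "m1 \<in> M" "n1 \<in> N" "[m1, n1] \<in> pg_dom L" "g = m1 \<cdot> n1" "Sg g = S_pair m1 n1"
    using prod2_factorization[OF M N g] .
  obtain m2 n2 where 2: "m2 \<in> M" "n2 \<in> N" "[m2, n2] \<in> pg_dom L" "h = m2 \<cdot> n2" "Sg h = S_pair m2 n2"
    using prod2_factorization[OF M N h] .
  obtain R U where P: "mor (S_pair g h) g R" "mor R h U" using S_pair(2)[OF d] by blast
  let ?P = "S_pair g h"
  obtain R1 R' where R1: "mor ?P m1 R1" "mor R1 n1 R'" using S_pair_mor[OF 1(3) morD(1)[OF P(1)]] mor_sub_Sg[OF P(1)] 1(5) by metis
  have "R' = R" using mor_unique[OF mor_comp(1)[OF R1]] P(1) 1(4) by simp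
  then have R1': "mor R1 n1 R" using R1 by simp
  obtain U1 U' where U1: "mor R m2 U1" "mor U1 n2 U'" using S_pair_mor[OF 2(3) morD(1)[OF P(2)]] mor_sub_Sg[OF P(2)] 2(5) by metis
  have nm: "mor R1 (n1 \<cdot> m2) U1" "[n1, m2] \<in> pg_dom L" using mor_comp[OF R1' U1(1)] by auto
  have "n1 \<cdot> m2 \<in> prod2 M N" using prod2I[OF 1(2) 2(1) nm(2)] prod2_commute[OF M N] by simp
  then obtain m3 n3 where 3: "m3 \<in> M" "n3 \<in> N" "[m3, n3] \<in> pg_dom L" "n1 \<cdot> m2 = m3 \<cdot> n3" "Sg (n1 \<cdot> m2) = S_pair m3 n3"
    using prod2_factorization[OF M N] by metis
  obtain V V' where V: "mor R1 m3 V" "mor V n3 V'" using S_pair_mor[OF 3(3) morD(1)[OF nm(1)]] mor_sub_Sg[OF nm(1)] 3(5) by metis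
  have "V' = U1" using mor_unique[OF mor_comp(1)[OF V]] nm(1) 3(4) by simp
  then have V': "mor V n3 U1" using V by simp
  have a: "mor ?P (m1 \<cdot> m3) V" "[m1, m3] \<in> pg_dom L" using mor_comp[OF R1(1) V(1)] by auto
  have b: "mor V (n3 \<cdot> n2) U'" "[n3, n2] \<in> pg_dom L" using mor_comp[OF V' U1(2)] by auto
  have "g \<cdot> h = m1 \<cdot> (n1 \<cdot> (m2 \<cdot> n2))" using mor_assoc[OF R1(1) R1' mor_comp(1)[OF U1]] 1(4) 2(4) by simp
  also have "n1 \<cdot> (m2 \<cdot> n2) = m3 \<cdot> n3 \<cdot> n2" using mor_assoc[OF R1' U1] 3(4) by simp
  also have "\<dots> = m3 \<cdot> (n3 \<cdot> n2)" by (rule mor_assoc[OF V(1) V' U1(2)])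
  also have "m1 \<cdot> \<dots> = m1 \<cdot> m3 \<cdot> (n3 \<cdot> n2)" by (rule mor_assoc[OF R1(1) V(1) b(1), symmetric])
  finally show ?thesis
    using prod2I[OF pnsD(4)[OF M 1(1) 3(1) a(2)] pnsD(4)[OF N 3(2) 2(2) b(2)] mor_comp(2)[OF a(1) b(1)]] by simp
qed

lemma prod2_right: assumes "partial_normal_subgroup L M" "partial_normal_subgroup L N" "n \<in> N" shows "n \<in> prod2 M N"
proof -
  have n: "n \<in> carrier L" using pnsD(1)[OF assms(2)] assms(3) by blast
  have "[\<epsilon>, n] \<in> pg_dom L" using one_ins(1)[of "[]" "[n]"] singleton_dom[OF n] by simp
  from prod2I[OF pnsD(2)[OF assms(1)] assms(3) this] show ?thesis using one_l[OF n] by simp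
qed

text \<open>Split \<open>g = f \<cdot> y\<close> with \<open>y \<in> N\<close> and \<open>f\<close>
  maximal for \<open>N\<close>. Since \<open>N \<inter> S \<subseteq> Sg f\<close>, the intermediate
  object of \<open>x = m \<cdot> n\<close> lies in \<open>Sg f\<close>, so \<open>x \<up> f\<close>
  is the product of the conjugates of \<open>m\<close> and \<open>n\<close>. Conjugation by
  \<open>y\<close> is then multiplication inside the product.\<close>

lemma prod2_conj:
  assumes M: "partial_normal_subgroup L M" and N: "partial_normal_subgroup L N"
    and x: "x \<in> prod2 M N" and g: "g \<in> carrier L" "x \<in> conj_dom L g"
  shows "x \<up> g \<in> prod2 M N"
proof -
  obtain f y where f: "coset_max N f" "y \<in> N" "[f, y] \<in> pg_dom L" "g = f \<cdot> y" "Sg g \<subseteq> S_pair f y"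
    using coset_max_exists[OF N g(1)] .
  have fc: "f \<in> carrier L" using f(1) by (simp add: coset_max_def)
  have TN: "N \<inter> S \<subseteq> Sg f" by (rule coset_max_T[OF N f(1)])
  obtain m n where mn: "m \<in> M" "n \<in> N" "[m, n] \<in> pg_dom L" "x = m \<cdot> n" "Sg x = S_pair m n"
    using prod2_factorization[OF M N x] .
  have "[g\<acute>, x, g] \<in> pg_dom L" using g(2) conj_dom_iff by simp
  then obtain Q Q' where "mors Q [g\<acute>, x, g] Q'" using dom_mors by blast
  then obtain P P' where P: "mor Q (g\<acute>) P" "mor P x P'" "mor P' g Q'" by auto
  have Pg: "mor P g Q" using mor_inv[OF P(1)] inv_inv[OF g(1)] by simp
  obtain R Q1 where R: "mor P f R" "mor R y Q1" using S_pair_mor[OF f(3) morD(1)[OF Pg]] mor_sub_Sg[OF Pg] f(5) by blast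
  obtain R' Q2 where R': "mor P' f R'" "mor R' y Q2" using S_pair_mor[OF f(3) morD(1)[OF P(3)]] mor_sub_Sg[OF P(3)] f(5) by blast
  obtain P1 P2 where P1: "mor P m P1" "mor P1 n P2" using S_pair_mor[OF mn(3) morD(1)[OF P(2)]] mor_sub_Sg[OF P(2)] mn(5) by metis
  have "P2 = P'" using mor_unique[OF mor_comp(1)[OF P1]] P(2) mn(4) by simp
  then have P1': "mor P1 n P'" using P1 by simp
  have "P1 \<subseteq> Sg f" by (rule conj_subset_overgroup[OF N pnsD(3)[OF N mn(2)] mor_inv[OF P1'] Sg_subgroup[OF fc] mor_sub_Sg[OF R'(1)] TN])
  then obtain R1 where R1: "mor P1 f R1" using mor_restrict[OF fc morD(2)[OF P1(1)]] by blast
  have "x \<up> f = m \<up> f \<cdot> n \<up> f" using mor_conj_mult[OF P1(1) P1' R(1) R1 R'(1)] mn(4) by simp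
  moreover have "[m \<up> f, n \<up> f] \<in> pg_dom L" by (rule mor_comp(2)[OF mor_conj(2)[OF P1(1) R(1) R1] mor_conj(2)[OF P1' R1 R'(1)]])
  ultimately have xf: "x \<up> f \<in> prod2 M N"
    using prod2I[OF pnsD(6)[OF M mn(1) P1(1) R(1) R1] pnsD(6)[OF N mn(2) P1' R1 R'(1)]] by simp
  have mxf: "mor R (x \<up> f) R'" by (rule mor_conj(2)[OF P(2) R(1) R'(1)])
  have "x \<up> g = x \<up> f \<up> y" unfolding f(4) by (rule mor_conj_comp(1)[OF P(2) R(1) R'(1) R(2) R'(2)])
  also have "\<dots> = y\<acute> \<cdot> (x \<up> f \<cdot> y)" by (rule mor_conj(3)[OF mxf R(2) R'(2)])
  finally have e: "x \<up> g = y\<acute> \<cdot> (x \<up> f \<cdot> y)" .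
  have c: "mor R (x \<up> f \<cdot> y) Q2" "[x \<up> f, y] \<in> pg_dom L" using mor_comp[OF mxf R'(2)] by auto
  show ?thesis unfolding e
    by (rule prod2_mult[OF M N prod2_right[OF M N pnsD(3)[OF N f(2)]] prod2_mult[OF M N xf prod2_right[OF M N f(2)] c(2)] mor_comp(2)[OF mor_inv[OF R(2)] c(1)]])
qed

lemma prod2_normal:
  assumes M: "partial_normal_subgroup L M" and N: "partial_normal_subgroup L N"
  shows "partial_normal_subgroup L (prod2 M N)"
  unfolding partial_normal_subgroup_def
proof
  show "partial_subgroup L (prod2 M N)"
  proof (rule partial_subgroupI)
    show "prod2 M N \<subseteq> carrier L" using prod_closed by (auto simp: prod2_def)
    show "\<epsilon> \<in> prod2 M N" by (rule prod2_right[OF M N pnsD(2)[OF N]])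
    show "x\<acute> \<in> prod2 M N" if x: "x \<in> prod2 M N" for x
    proof -
      obtain m n where mn: "m \<in> M" "n \<in> N" "[m, n] \<in> pg_dom L" "x = m \<cdot> n" using x by (auto simp: prod2_def)
      show ?thesis using prod2I[OF pnsD(3)[OF N mn(2)] pnsD(3)[OF M mn(1)] inv_mul(2)[OF mn(3)]] inv_mul(1)[OF mn(3)]
          prod2_commute[OF M N] mn(4) by simp
    qed
  qed (rule prod2_mult[OF M N])
  show "\<forall>f\<in>carrier L. \<forall>x\<in>prod2 M N \<inter> conj_dom L f. x \<up> f \<in> prod2 M N" using prod2_conj[OF M N] by blast
qed

section \<open>Products of several partial normal subgroups\<close>

lemma set_product_pair: "set_product L [M, N] = prod2 M N"
  unfolding set_product_def prod2_def list_all2_Cons2 list_all2_Nil2 by blast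

lemma set_product_one: assumes "M \<subseteq> carrier L" shows "set_product L [M] = M"
  using assms singleton_dom prod_singleton unfolding set_product_def list_all2_Cons2 list_all2_Nil2 by force

lemma S_word_Nil: "S_word L S [] = S"
  unfolding S_word_def by (auto intro: exI[of _ "\<lambda>_. _"])

lemma S_word_Cons: "S_word L S (g # w) = {s \<in> Sg g. s \<up> g \<in> S_word L S w}"
proof (rule Set.set_eqI)
  fix s
  let ?path = "\<lambda>v (x :: nat \<Rightarrow> 'a). (\<forall>i \<le> length v. x i \<in> S) \<and>
     (\<forall>i < length v. x i \<in> conj_dom L (v ! i) \<and> x i \<up> (v ! i) = x (Suc i))"
  have W: "s \<in> S_word L S v \<longleftrightarrow> (\<exists>x. x 0 = s \<and> ?path v x)" for s v
    unfolding S_word_def conj_dom_iff by auto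
  have "s \<in> S_word L S (g # w) \<longleftrightarrow> s \<in> Sg g \<and> s \<up> g \<in> S_word L S w"
  proof
    assume "s \<in> S_word L S (g # w)"
    then obtain x where x: "x 0 = s" "\<And>i. i \<le> Suc (length w) \<Longrightarrow> x i \<in> S"
      "\<And>i. i < Suc (length w) \<Longrightarrow> x i \<in> conj_dom L ((g # w) ! i) \<and> x i \<up> ((g # w) ! i) = x (Suc i)"
      unfolding W by auto
    have x1: "x (Suc 0) = s \<up> g" "s \<in> conj_dom L g" using x(3)[of 0] x(1) by auto
    have "s \<in> Sg g" unfolding Sg_iff using x(1) x(2)[of 0] x(2)[of "Suc 0"] x1 by simp
    moreover have "?path w (\<lambda>i. x (Suc i))" using x(2)[of "Suc _"] x(3)[of "Suc _"] by simp
    then have "s \<up> g \<in> S_word L S w" unfolding W using x1(1) by (intro exI[of _ "\<lambda>i. x (Suc i)"]) simp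
    ultimately show "s \<in> Sg g \<and> s \<up> g \<in> S_word L S w" ..
  next
    assume a: "s \<in> Sg g \<and> s \<up> g \<in> S_word L S w"
    then obtain x where x: "x 0 = s \<up> g" "?path w x" unfolding W by blast
    have sg: "s \<in> S" "s \<in> conj_dom L g" using a Sg_iff by auto
    have "case_nat s x i \<in> S" if "i \<le> length (g # w)" for i
      using that x sg by (cases i) simp_all
    moreover have "case_nat s x i \<in> conj_dom L ((g # w) ! i) \<and> case_nat s x i \<up> ((g # w) ! i) = case_nat s x (Suc i)"
      if "i < length (g # w)" for i using that x sg by (cases i) simp_all
    ultimately show "s \<in> S_word L S (g # w)" unfolding W by (intro exI[of _ "case_nat s x"]) simp
  qed
  then show "s \<in> S_word L S (g # w) \<longleftrightarrow> s \<in> {s \<in> Sg g. s \<up> g \<in> S_word L S w}" by simp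
qed

lemma S_word_mors:
  assumes "P \<in> \<Delta>" "P \<subseteq> S_word L S w" "w \<in> lists (carrier L)"
  obtains Q where "mors P w Q"
  using assms
proof (induction w arbitrary: P thesis)
  case (Cons g w)
  have g: "g \<in> carrier L" "P \<subseteq> Sg g" using Cons.prems(3,4) by (auto simp: S_word_Cons)
  have m: "mor P g (conj_set L P g)" by (rule mor_restrict[OF g(1) Cons.prems(2) g(2)])
  have "conj_set L P g \<subseteq> S_word L S w" using Cons.prems(3) by (auto simp: conj_set_def S_word_Cons)
  then obtain Q where "mors (conj_set L P g) w Q" using Cons.IH[OF _ morD(2)[OF m]] Cons.prems(4) by auto
  then show ?case using Cons.prems(1) m by auto
qed auto

lemma set_product_Cons_sub:
  "set_product L (N # Ns) \<subseteq> prod2 N (set_product L Ns)"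
proof
  fix g assume "g \<in> set_product L (N # Ns)"
  then obtain n ns where w: "n # ns \<in> pg_dom L" "n \<in> N" "list_all2 (\<in>) ns Ns" "g = pg_prod L (n # ns)"
    unfolding set_product_def list_all2_Cons2 by blast
  have "ns \<in> pg_dom L" using append_dom[of "[n]" ns] w(1) by simp
  then have "pg_prod L ns \<in> set_product L Ns" using w(3) unfolding set_product_def by blast
  from prod2I[OF w(2) this prod_Cons(1)[OF w(1)]] show "g \<in> prod2 N (set_product L Ns)"
    using w(4) prod_Cons(2)[OF w(1)] by simp
qed

text \<open>Statement (c) for the list \<open>Ns\<close>, isolated to serve as an induction
  hypothesis.\<close>

definition S_factors where
  "S_factors Ns \<longleftrightarrow> (\<forall>g\<in>set_product L Ns. \<exists>ns\<in>pg_dom L. list_all2 (\<in>) ns Ns \<and> g = pg_prod L ns \<and> Sg g = S_word L S ns)"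

text \<open>Since \<open>Sg x = S_word L S ns\<close>, the second step of the path of
  \<open>[n, x]\<close> can be taken letter by letter along \<open>ns\<close>; this puts
  \<open>n # ns\<close> into the domain.\<close>

lemma S_factors_Cons:
  assumes N: "partial_normal_subgroup L N" and X: "partial_normal_subgroup L (set_product L Ns)"
    and F: "S_factors Ns" and g: "g \<in> prod2 N (set_product L Ns)"
  shows "\<exists>ns\<in>pg_dom L. list_all2 (\<in>) ns (N # Ns) \<and> g = pg_prod L ns \<and> Sg g = S_word L S ns"
proof -
  obtain n x where nx: "n \<in> N" "x \<in> set_product L Ns" "[n, x] \<in> pg_dom L" "g = n \<cdot> x" "Sg g = S_pair n x"
    using prod2_factorization[OF N X g] .
  obtain ns where ns: "ns \<in> pg_dom L" "list_all2 (\<in>) ns Ns" "x = pg_prod L ns" "Sg x = S_word L S ns"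
    using F nx(2) unfolding S_factors_def by blast
  obtain R U where P: "mor (S_pair n x) n R" "mor R x U" using S_pair(2)[OF nx(3)] by blast
  have "ns \<in> lists (carrier L)" using ns(1) dom_words by blast
  then obtain Q where "mors R ns Q"
    using S_word_mors[OF morD(1)[OF P(2)]] mor_sub_Sg[OF P(2)] ns(4) by metis
  then have "mors (S_pair n x) (n # ns) Q" using P(1) by auto
  then have d: "n # ns \<in> pg_dom L" by (rule mors_dom)
  have "g = pg_prod L (n # ns)" using prod_Cons(2)[OF d] nx(4) ns(3) by simp
  moreover have "Sg g = S_word L S (n # ns)" using nx(5) ns(4) by (simp add: S_word_Cons S_pair_def)
  moreover have "list_all2 (\<in>) (n # ns) (N # Ns)" using nx(1) ns(2) by simp
  ultimately show ?thesis using d by blast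
qed

lemma set_product_Cons:
  assumes N: "partial_normal_subgroup L N" and X: "partial_normal_subgroup L (set_product L Ns)"
    and F: "S_factors Ns"
  shows "set_product L (N # Ns) = prod2 N (set_product L Ns)"
proof
  show "set_product L (N # Ns) \<subseteq> prod2 N (set_product L Ns)" by (rule set_product_Cons_sub)
  show "prod2 N (set_product L Ns) \<subseteq> set_product L (N # Ns)"
    using S_factors_Cons[OF N X F] unfolding set_product_def by blast
qed

abbreviation normals where "normals Ns \<equiv> (\<forall>N\<in>set Ns. partial_normal_subgroup L N)"

text \<open>Both claims share one induction: \<open>S_factors\<close> is what identifies the product
  of a longer list with a product of two, because an arbitrary factorization of \<open>x\<close>
  would not make \<open>n # ns\<close> a word of the domain.\<close>

lemma set_product_normal:
  assumes "Ns \<noteq> []" "normals Ns"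
  shows "partial_normal_subgroup L (set_product L Ns)" "S_factors Ns"
proof -
  have "partial_normal_subgroup L (set_product L Ns) \<and> S_factors Ns"
    using assms
  proof (induction Ns rule: list_nonempty_induct)
    case (single N)
    then have N: "partial_normal_subgroup L N" by simp
    have e: "set_product L [N] = N" by (rule set_product_one[OF pnsD(1)[OF N]])
    have "\<exists>ns\<in>pg_dom L. list_all2 (\<in>) ns [N] \<and> g = pg_prod L ns \<and> Sg g = S_word L S ns" if g: "g \<in> N" for g
    proof -
      have gc: "g \<in> carrier L" using g pnsD(1)[OF N] by blast
      have "Sg g = S_word L S [g]" by (auto simp: S_word_Cons S_word_Nil Sg_iff)
      then show ?thesis using g singleton_dom[OF gc] prod_singleton[OF gc] by (intro bexI[of _ "[g]"]) simp_all
    qed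
    then show ?case using N unfolding e S_factors_def by blast
  next
    case (cons N Ns)
    then have N: "partial_normal_subgroup L N" and X: "partial_normal_subgroup L (set_product L Ns)" and F: "S_factors Ns"
      by simp_all
    have e: "set_product L (N # Ns) = prod2 N (set_product L Ns)" by (rule set_product_Cons[OF N X F])
    show ?case using prod2_normal[OF N X] S_factors_Cons[OF N X F] unfolding e S_factors_def by blast
  qed
  then show "partial_normal_subgroup L (set_product L Ns)" "S_factors Ns" by auto
qed

section \<open>Associativity and rearrangement of factors\<close>

lemma set_product_prod2:
  assumes "partial_normal_subgroup L N" "Ns \<noteq> []" "normals Ns"
  shows "set_product L (N # Ns) = prod2 N (set_product L Ns)"
  by (rule set_product_Cons[OF assms(1) set_product_normal[OF assms(2,3)]])

lemma prod2_assoc_sub: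
  assumes M: "partial_normal_subgroup L M" and N: "partial_normal_subgroup L N" and K: "partial_normal_subgroup L K"
  shows "prod2 (prod2 M N) K \<subseteq> prod2 M (prod2 N K)"
proof
  fix g assume g: "g \<in> prod2 (prod2 M N) K"
  obtain x k where x: "x \<in> prod2 M N" "k \<in> K" "[x, k] \<in> pg_dom L" "g = x \<cdot> k" using g by (auto simp: prod2_def)
  obtain m n where mn: "m \<in> M" "n \<in> N" "[m, n] \<in> pg_dom L" "x = m \<cdot> n" "Sg x = S_pair m n"
    using prod2_factorization[OF M N x(1)] .
  obtain R U where P: "mor (S_pair x k) x R" "mor R k U" using S_pair(2)[OF x(3)] by blast
  obtain R1 R' where R: "mor (S_pair x k) m R1" "mor R1 n R'"
    using S_pair_mor[OF mn(3) morD(1)[OF P(1)]] mor_sub_Sg[OF P(1)] mn(5) by metis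
  have "R' = R" using mor_unique[OF mor_comp(1)[OF R]] P(1) mn(4) by simp
  then have R': "mor R1 n R" using R by simp
  have c: "mor R1 (n \<cdot> k) U" "[n, k] \<in> pg_dom L" using mor_comp[OF R' P(2)] by auto
  have "g = m \<cdot> (n \<cdot> k)" using mor_assoc[OF R(1) R' P(2)] x(4) mn(4) by simp
  then show "g \<in> prod2 M (prod2 N K)" using prod2I[OF mn(1) prod2I[OF mn(2) x(2) c(2)] mor_comp(2)[OF R(1) c(1)]] by simp
qed

text \<open>The second inclusion is the first one for the factors in reverse order, by
  commutativity.\<close>

lemma prod2_assoc:
  assumes M: "partial_normal_subgroup L M" and N: "partial_normal_subgroup L N" and K: "partial_normal_subgroup L K"
  shows "prod2 (prod2 M N) K = prod2 M (prod2 N K)"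
proof
  show "prod2 (prod2 M N) K \<subseteq> prod2 M (prod2 N K)" by (rule prod2_assoc_sub[OF assms])
  have "prod2 M (prod2 N K) = prod2 (prod2 K N) M" using prod2_commute[OF M prod2_normal[OF N K]] prod2_commute[OF N K] by simp
  also have "\<dots> \<subseteq> prod2 K (prod2 N M)" by (rule prod2_assoc_sub[OF K N M])
  also have "\<dots> = prod2 (prod2 M N) K" using prod2_commute[OF K prod2_normal[OF N M]] prod2_commute[OF N M] by simp
  finally show "prod2 M (prod2 N K) \<subseteq> prod2 (prod2 M N) K" .
qed

lemma set_product_append:
  assumes "As \<noteq> []" "Bs \<noteq> []" "normals As" "normals Bs"
  shows "set_product L (As @ Bs) = set_product L [set_product L As, set_product L Bs]"
  unfolding set_product_pair using assms
proof (induction As rule: list_nonempty_induct)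
  case (single A)
  then have A: "partial_normal_subgroup L A" by simp
  show ?case using set_product_prod2[OF A single(1,3)] set_product_one[OF pnsD(1)[OF A]] by simp
next
  case (cons A As)
  then have A: "partial_normal_subgroup L A" and As: "normals As" by simp_all
  note X = set_product_normal(1)[OF cons.hyps As] and Y = set_product_normal(1)[OF cons.prems(1,3)]
  have "set_product L ((A # As) @ Bs) = prod2 A (set_product L (As @ Bs))"
    using set_product_prod2[OF A, of "As @ Bs"] cons.hyps As cons.prems(3) by auto
  also have "\<dots> = prod2 A (prod2 (set_product L As) (set_product L Bs))" using cons.IH As cons.prems by simp
  also have "\<dots> = prod2 (prod2 A (set_product L As)) (set_product L Bs)" by (rule prod2_assoc[OF A X Y, symmetric])
  also have "prod2 A (set_product L As) = set_product L (A # As)" by (rule set_product_prod2[OF A cons.hyps As, symmetric])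
  finally show ?case .
qed

lemma set_product_move:
  assumes "normals (As @ M # Bs)"
  shows "set_product L (As @ M # Bs) = set_product L (M # As @ Bs)"
  using assms
proof (induction As)
  case (Cons A As)
  have A: "partial_normal_subgroup L A" and M: "partial_normal_subgroup L M" using Cons.prems by simp_all
  have "set_product L ((A # As) @ M # Bs) = prod2 A (set_product L (As @ M # Bs))"
    using set_product_prod2[OF A, of "As @ M # Bs"] Cons.prems by simp
  also have "\<dots> = prod2 A (set_product L (M # As @ Bs))" using Cons by simp
  also have "\<dots> = set_product L (M # A # As @ Bs)"
  \<comment> \<open>The empty list is excluded from \<open>set_product_prod2\<close>, so the case of
    just two factors is settled by commutativity.\<close>
  proof (cases "As @ Bs = []")
    case True
    then show ?thesis using set_product_pair[of M A] set_product_one[OF pnsD(1)[OF M]] prod2_commute[OF A M] by simp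
  next
    case False
    let ?Y = "set_product L (As @ Bs)"
    have nn: "normals (As @ Bs)" using Cons.prems by auto
    note Y = set_product_normal(1)[OF False nn]
    have "prod2 A (set_product L (M # As @ Bs)) = prod2 A (prod2 M ?Y)" using set_product_prod2[OF M False nn] by simp
    also have "\<dots> = prod2 M (prod2 A ?Y)" using prod2_assoc[OF A M Y] prod2_assoc[OF M A Y] prod2_commute[OF A M] by simp
    also have "\<dots> = set_product L (M # A # As @ Bs)"
      using set_product_prod2[OF A False nn] set_product_prod2[OF M, of "A # As @ Bs"] A nn by simp
    finally show ?thesis .
  qed
  finally show ?case by simp
qed simp

text \<open>Equality of multisets replaces permutations of indices: any rearrangement is reached by
  repeatedly moving one factor to the front.\<close>

lemma set_product_mset:
  assumes "mset Ms = mset Ns" "normals Ms"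
  shows "set_product L Ms = set_product L Ns"
  using assms
proof (induction Ms arbitrary: Ns)
  case (Cons M Ms)
  have M: "partial_normal_subgroup L M" and Ms: "normals Ms" using Cons.prems(2) by simp_all
  have "M \<in> set Ns" using Cons.prems(1) by (metis list.set_intros(1) set_mset_mset)
  then obtain As Bs where Ns: "Ns = As @ M # Bs" by (meson split_list)
  have mm: "mset Ms = mset (As @ Bs)" using Cons.prems(1) Ns by simp
  have "set Ns = set (M # Ms)" using Cons.prems(1) by (metis set_mset_mset)
  then have "normals Ns" using Cons.prems(2) by simp
  then have "set_product L Ns = set_product L (M # As @ Bs)" unfolding Ns by (rule set_product_move)
  also have "\<dots> = set_product L (M # Ms)"
  proof (cases "Ms = []")
    case True
    then show ?thesis using mm by simp
  next
    case False
    then have "As @ Bs \<noteq> []" using mm by (metis mset_zero_iff)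
    moreover have "normals (As @ Bs)" using Ms mm by (metis set_mset_mset)
    ultimately show ?thesis using set_product_prod2[OF M False Ms] set_product_prod2[OF M, of "As @ Bs"] Cons.IH[OF mm Ms] by simp
  qed
  finally show ?case by simp
qed simp

end

theorem theorem2:
  fixes L :: "('a, 'm) partial_grp_scheme"
    and p :: nat and \<Delta> :: "'a set set" and S :: "'a set"
    and l :: nat and N :: "nat \<Rightarrow> 'a set"
  assumes "locality L p \<Delta> S"
    and "l \<ge> 1"
    and "\<And>i. i \<in> {1..l} \<Longrightarrow> partial_normal_subgroup L (N i)"
  shows "partial_normal_subgroup L (set_product L (map N [1..<Suc l]))
    \<and> (\<forall>k. 1 \<le> k \<and> k < l \<longrightarrow>
         set_product L (map N [1..<Suc l]) =
         set_product L [set_product L (map N [1..<Suc k]),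
                        set_product L (map N [Suc k..<Suc l])])
    \<and> (\<forall>\<sigma>. \<sigma> permutes {1..l} \<longrightarrow>
         set_product L (map N [1..<Suc l]) =
         set_product L (map (\<lambda>i. N (\<sigma> i)) [1..<Suc l]))
    \<and> (\<forall>g \<in> set_product L (map N [1..<Suc l]).
         \<exists>ns \<in> pg_dom L. list_all2 (\<in>) ns (map N [1..<Suc l]) \<and>
           g = pg_prod L ns \<and> S_elem L S g = S_word L S ns)"
proof -
  interpret locality L p \<Delta> S by fact
  have ne: "map N [1..<Suc l] \<noteq> []" using assms(2) by simp
  have nl: "normals (map N [1..<Suc l])" using assms(3) by auto
  show ?thesis
  proof (intro conjI allI impI)
    show "partial_normal_subgroup L (set_product L (map N [1..<Suc l]))"
      by (rule set_product_normal(1)[OF ne nl])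
    show "\<forall>g \<in> set_product L (map N [1..<Suc l]). \<exists>ns \<in> pg_dom L. list_all2 (\<in>) ns (map N [1..<Suc l]) \<and>
        g = pg_prod L ns \<and> S_elem L S g = S_word L S ns"
      using set_product_normal(2)[OF ne nl] unfolding S_factors_def .
  next
    fix k assume k: "1 \<le> k \<and> k < l"
    have "[1..<Suc l] = [1..<Suc k] @ [Suc k..<Suc l]"
      using k upt_add_eq_append[of 1 "Suc k" "l - k"] by simp
    then have "map N [1..<Suc l] = map N [1..<Suc k] @ map N [Suc k..<Suc l]" by (metis map_append)
    moreover have "set_product L (map N [1..<Suc k] @ map N [Suc k..<Suc l]) =
        set_product L [set_product L (map N [1..<Suc k]), set_product L (map N [Suc k..<Suc l])]"
      by (rule set_product_append) (use k assms(3) in auto)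
    ultimately show "set_product L (map N [1..<Suc l]) =
        set_product L [set_product L (map N [1..<Suc k]), set_product L (map N [Suc k..<Suc l])]" by simp
  next
    fix \<sigma> assume s: "\<sigma> permutes {1..l}"
    \<comment> \<open>A permutation of \<open>{1..l}\<close> preserves this multiset of indices, so
      both lists have the same multiset of factors.\<close>
    have m: "mset [1..<Suc l] = mset_set {1..l}" by (simp add: atLeastLessThanSuc_atLeastAtMost del: upt_Suc)
    have "mset (map (\<lambda>i. N (\<sigma> i)) [1..<Suc l]) = image_mset N (image_mset \<sigma> (mset_set {1..l}))"
      unfolding mset_map m by (simp add: multiset.map_comp comp_def)
    also have "\<dots> = mset (map N [1..<Suc l])" unfolding mset_map m permutes_image_mset[OF s] ..
    finally show "set_product L (map N [1..<Suc l]) = set_product L (map (\<lambda>i. N (\<sigma> i)) [1..<Suc l])"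
      by (intro set_product_mset[OF _ nl]) simp
  qed
qed

end
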